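(* Let $k\ge 0$ be an integer. Every $k$-dimensional map $f\colon X\to Y$ between compacta admits approximation by $(k+1)$-dimensional simplicial maps.
   Context: All spaces are separable metrizable; a map is a continuous function; a compactum is a compact (metrizable) space; $\dim$ is covering dimension. A map is $m$-dimensional (has dimension at most $m$) if each of its fibers has dimension at most $m$. For a simplicial complex $\mathcal K$, $|\mathcal K|$ is the corresponding polyhedron; a simplicial map $|\mathcal K|\to|\mathcal L|$ is a map sending simplices to simplices and affine on each of them. For an open cover $\omega$ of $X$, a map $\kappa\colon X\to Z$ is an $\omega$-map if $Z$ has an open cover such that the preimage of each of its members is contained in some member of $\omega$. A map $f\colon X\to Y$ admits approximation by $m$-dimensional simplicial maps if for every open cover $\omega_X$ of $X$ and every open cover $\omega_Y$ of $Y$ there exist polyhedra $|\mathcal K|,|\mathcal L|$, an $\omega_X$-map $\kappa_X\colon X\to|\mathcal K|$, an $\omega_Y$-map $\kappa_Y\colon Y\to|\mathcal L|$ and an $m$-dimensional simplicial map $p\colon|\mathcal K|\to|\mathcal L|$ with $p\circ\kappa_X=\kappa_Y\circ f$. *)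

theory Defs
  imports "HOL-Analysis.Analysis"
begin

definition open_cover :: "'a topology \<Rightarrow> 'a set set \<Rightarrow> bool" where
  "open_cover X \<U> \<longleftrightarrow> (\<forall>U\<in>\<U>. openin X U) \<and> \<Union>\<U> = topspace X"

text \<open>Covering dimension at most n. The empty space satisfies this for every n.\<close>

definition covering_dim_le :: "'a topology \<Rightarrow> nat \<Rightarrow> bool" where
  "covering_dim_le X n \<longleftrightarrow>
     (\<forall>\<U>. finite \<U> \<and> open_cover X \<U> \<longrightarrow>
        (\<exists>\<V>. finite \<V> \<and> open_cover X \<V> \<and>
             (\<forall>V\<in>\<V>. \<exists>U\<in>\<U>. V \<subseteq> U) \<and>
             (\<forall>x\<in>topspace X. card {V\<in>\<V>. x \<in> V} \<le> n + 1)))"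

definition dimensional_map ::
    "nat \<Rightarrow> 'a topology \<Rightarrow> 'b topology \<Rightarrow> ('a \<Rightarrow> 'b) \<Rightarrow> bool" where
  "dimensional_map m X Y f \<longleftrightarrow>
     continuous_map X Y f \<and>
     (\<forall>y\<in>topspace Y. covering_dim_le (subtopology X {x \<in> topspace X. f x = y}) m)"

definition cover_map ::
    "'a set set \<Rightarrow> 'a topology \<Rightarrow> 'b topology \<Rightarrow> ('a \<Rightarrow> 'b) \<Rightarrow> bool" where
  "cover_map \<omega> X Z \<kappa> \<longleftrightarrow>
     continuous_map X Z \<kappa> \<and>
     (\<exists>\<V>. open_cover Z \<V> \<and> (\<forall>V\<in>\<V>. \<exists>U\<in>\<omega>. {x \<in> topspace X. \<kappa> x \<in> V} \<subseteq> U))"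

text \<open>Complexes are given by their vertex sets and need be neither finite nor
  finite-dimensional; the empty complex is allowed (it is needed when the space is empty).\<close>

definition simplicial_cplx :: "'v set set \<Rightarrow> bool" where
  "simplicial_cplx K \<longleftrightarrow>
     (\<forall>\<sigma>\<in>K. finite \<sigma> \<and> \<sigma> \<noteq> {} \<and> (\<forall>\<tau>. \<tau> \<subseteq> \<sigma> \<and> \<tau> \<noteq> {} \<longrightarrow> \<tau> \<in> K))"

text \<open>Points of the polyhedron are represented by their barycentric coordinates.\<close>

definition geom_simplex :: "'v set \<Rightarrow> ('v \<Rightarrow> real) set" where
  "geom_simplex \<sigma> = {t. (\<forall>v. 0 \<le> t v) \<and> (\<forall>v. v \<notin> \<sigma> \<longrightarrow> t v = 0) \<and> sum t \<sigma> = 1}"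

definition carrier_of :: "'v set set \<Rightarrow> ('v \<Rightarrow> real) set" where
  "carrier_of K = (\<Union>\<sigma>\<in>K. geom_simplex \<sigma>)"

text \<open>The Whitehead (weak) topology: a set is open iff it meets every closed simplex in a
  relatively open set, each simplex carrying its Euclidean topology.\<close>

definition polyhedron_openin :: "'v set set \<Rightarrow> ('v \<Rightarrow> real) set \<Rightarrow> bool" where
  "polyhedron_openin K U \<longleftrightarrow>
     U \<subseteq> carrier_of K \<and>
     (\<forall>\<sigma>\<in>K. openin (subtopology (powertop_real UNIV) (geom_simplex \<sigma>)) (U \<inter> geom_simplex \<sigma>))"

definition polyhedron_of :: "'v set set \<Rightarrow> ('v \<Rightarrow> real) topology" where
  "polyhedron_of K = topology (polyhedron_openin K)"

lemma istopology_polyhedron: "istopology (polyhedron_openin K)"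
  unfolding istopology_def
proof (intro conjI allI impI)
  fix S T assume "polyhedron_openin K S" "polyhedron_openin K T"
  moreover have "S \<inter> T \<inter> geom_simplex \<sigma> = (S \<inter> geom_simplex \<sigma>) \<inter> (T \<inter> geom_simplex \<sigma>)" for \<sigma>
    by blast
  ultimately show "polyhedron_openin K (S \<inter> T)"
    by (auto simp: polyhedron_openin_def intro: openin_Int)
next
  fix \<K> assume *: "\<forall>S\<in>\<K>. polyhedron_openin K S"
  have eq: "\<Union>\<K> \<inter> geom_simplex \<sigma> = (\<Union>S\<in>\<K>. S \<inter> geom_simplex \<sigma>)" for \<sigma>
    by blast
  have "\<Union>\<K> \<subseteq> carrier_of K"
    using * by (auto simp: polyhedron_openin_def)
  moreover have "openin (subtopology (powertop_real UNIV) (geom_simplex \<sigma>)) (\<Union>\<K> \<inter> geom_simplex \<sigma>)"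
    if "\<sigma> \<in> K" for \<sigma>
    unfolding eq using * that by (intro openin_Union) (auto simp: polyhedron_openin_def)
  ultimately show "polyhedron_openin K (\<Union>\<K>)"
    by (simp add: polyhedron_openin_def)
qed

lemma openin_polyhedron_of [simp]: "openin (polyhedron_of K) U \<longleftrightarrow> polyhedron_openin K U"
  by (simp add: polyhedron_of_def topology_inverse' istopology_polyhedron)

lemma topspace_polyhedron_of [simp]: "topspace (polyhedron_of K) = carrier_of K"
proof -
  have "carrier_of K \<inter> geom_simplex \<sigma> = geom_simplex \<sigma>" if "\<sigma> \<in> K" for \<sigma>
    using that by (auto simp: carrier_of_def)
  then have "polyhedron_openin K (carrier_of K)"
    by (simp add: polyhedron_openin_def openin_subtopology_refl)
  then show ?thesis
    by (auto simp: topspace_def polyhedron_openin_def)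
qed

text \<open>Sending simplices to simplices means that the image of a simplex of K is a whole simplex
  of L (so vertices go to vertices), not merely contained in one.\<close>

definition simplicial_map_on ::
    "'v set set \<Rightarrow> 'w set set \<Rightarrow> (('v \<Rightarrow> real) \<Rightarrow> 'w \<Rightarrow> real) \<Rightarrow> bool" where
  "simplicial_map_on K L p \<longleftrightarrow>
     continuous_map (polyhedron_of K) (polyhedron_of L) p \<and>
     (\<forall>\<sigma>\<in>K. (\<exists>\<tau>\<in>L. p ` geom_simplex \<sigma> = geom_simplex \<tau>) \<and>
        (\<forall>s\<in>geom_simplex \<sigma>. \<forall>t\<in>geom_simplex \<sigma>. \<forall>u::real. 0 \<le> u \<and> u \<le> 1 \<longrightarrow>
           p (\<lambda>v. (1 - u) * s v + u * t v) = (\<lambda>w. (1 - u) * p s w + u * p t w)))"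

text \<open>All spaces are separable metrizable, polyhedra included. The vertices of a complex
  form a closed discrete subset of its polyhedron, so there are only countably many and they
  may be taken to be natural numbers.\<close>

definition admits_simplicial_approximation ::
    "nat \<Rightarrow> 'a topology \<Rightarrow> 'b topology \<Rightarrow> ('a \<Rightarrow> 'b) \<Rightarrow> bool" where
  "admits_simplicial_approximation m X Y f \<longleftrightarrow>
     (\<forall>\<omega>X \<omega>Y. open_cover X \<omega>X \<and> open_cover Y \<omega>Y \<longrightarrow>
        (\<exists>(K :: nat set set) (L :: nat set set) \<kappa>X \<kappa>Y p.
           simplicial_cplx K \<and> metrizable_space (polyhedron_of K) \<and>
           separable_space (polyhedron_of K) \<and>
           simplicial_cplx L \<and> metrizable_space (polyhedron_of L) \<and>
           separable_space (polyhedron_of L) \<and>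
           cover_map \<omega>X X (polyhedron_of K) \<kappa>X \<and>
           cover_map \<omega>Y Y (polyhedron_of L) \<kappa>Y \<and>
           simplicial_map_on K L p \<and>
           dimensional_map m (polyhedron_of K) (polyhedron_of L) p \<and>
           (\<forall>x\<in>topspace X. p (\<kappa>X x) = \<kappa>Y (f x))))"

end

theory Submission
  imports Defs
begin

text \<open>Choose functions \<open>h\<^sub>m\<close> on \<open>X\<close> such that a set in which no \<open>h\<^sub>m\<close> takes both a value
  \<open>\<le> 0\<close> and a value \<open>\<ge> 1\<close> lies in a member of the given cover. It suffices to find
  \<open>g : X \<rightarrow> \<real>\<close> and sets \<open>A\<^sub>0, \<dots>, A\<^sub>k\<close> covering \<open>X\<close> such that every \<open>A\<^sub>r\<close>, restricted to a small
  neighbourhood of a fibre of \<open>f \<times> g\<close>, falls into parts that are apart and small in this sense. A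
  fine partition of unity on \<open>Y\<close>, pulled back to \<open>X\<close>, is then split along \<open>g\<close> and along \<open>k\<close>
  of the \<open>k + 1\<close> functions of a partition of unity belonging to the \<open>A\<^sub>r\<close>. Splitting along a
  function raises the dimension of the fibres between the nerves by at most one, and the final
  splitting into small parts does not raise it at all.

  The \<open>h\<^sub>m\<close> are treated one after the other. Each fibre of \<open>f\<close> has a fine cover by \<open>k + 1\<close>
  disjoint families, which works over a neighbourhood in \<open>Y\<close>. Finitely many of these
  neighbourhoods cover \<open>Y\<close>, and colourings over different ones never have to be compared because
  they are used only over disjoint strips of values of \<open>g\<close>. That this suffices is achieved, as
  with Levin's use of Bing maps, by perturbing \<open>g\<close> into a zigzag: a level set of the new \<open>g\<close> that
  leads from \<open>h\<^sub>m = 0\<close> to \<open>h\<^sub>m = 1\<close> must cross a strip belonging to every neighbourhood. The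
  pieces introduced for later \<open>h\<^sub>m\<close> are so fine that they do not join what was separated before.\<close>

section \<open>Fine colourings near a fibre\<close>

text \<open>The bound \<open>k + 1\<close> comes from counting. If \<pi> pushes one partition of
  unity forward to another, the fibre of the induced simplicial map inside a simplex \<sigma> has
  dimension at most the number of vertices of \<sigma> minus the number of their images. What has to
  be controlled is therefore how many more functions are active at \<open>x\<close> than at
  \<open>f x\<close>. Splitting along a real function with staggered cuts adds at most one. One unit
  is spent on \<open>g\<close> and \<open>k\<close> units on colour weights; the last weight is 1
  minus the others and is controlled by them.

  The obstacle is that colourings with \<open>k + 1\<close> colours exist only near single fibres,
  and overlapping ones need not be compatible. The function \<open>g\<close> lets the neighbourhoods
  take turns. Only colour 0 relies on \<open>g\<close>: what it gives up in the strips goes, in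
  small separated pieces, to the other colours.

  (The entry above contains a stray backslash; the following one replaces it.)\<close>

definition separating :: "'a::metric_space set \<Rightarrow> real \<Rightarrow> ('a \<Rightarrow> real) \<Rightarrow> 'a set \<Rightarrow> bool" where
  "separating S \<eta> h \<Phi> \<longleftrightarrow>
     (\<exists>P Q. \<Phi> \<subseteq> P \<union> Q \<and> {x\<in>S. h x \<le> 0} \<subseteq> P \<and> {x\<in>S. 1 \<le> h x} \<subseteq> Q \<and>
        (\<forall>p\<in>P. \<forall>q\<in>Q. \<eta> \<le> dist p q))"

definition fine_family :: "real \<Rightarrow> real \<Rightarrow> 'a::metric_space set set \<Rightarrow> bool" where
  "fine_family \<epsilon> \<zeta> \<P> \<longleftrightarrow>
     (\<forall>W\<in>\<P>. \<forall>x\<in>W. \<forall>y\<in>W. dist x y < \<epsilon>) \<and>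
     (\<forall>W\<in>\<P>. \<forall>W'\<in>\<P>. W \<noteq> W' \<longrightarrow> (\<forall>x\<in>W. \<forall>y\<in>W'. \<zeta> \<le> dist x y))"

lemma separating_mono:
  assumes "separating S \<eta> h \<Phi>" "\<Phi>' \<subseteq> \<Phi>" "\<eta>' \<le> \<eta>"
  shows "separating S \<eta>' h \<Phi>'"
  using assms unfolding separating_def by (meson order_trans)

text \<open>A piece that comes within \<open>\<eta>/4\<close> of \<open>P\<close> joins
  \<open>P\<close>; its diameter being below \<open>\<eta>/4\<close>, it stays
  \<open>\<eta>/2\<close> away from \<open>Q\<close>. Every other piece joins \<open>Q\<close>.
  Pieces on different sides are distinct, hence \<open>\<zeta>\<close> apart. Since \<open>P\<close>
  and \<open>Q\<close> contain all points of \<open>S\<close> with \<open>h \<le> 0\<close> and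
  \<open>h \<ge> 1\<close>, even those outside \<open>\<Phi>\<close>, a new piece cannot meet both
  of these sets.\<close>

lemma separating_Un_fine_family:
  assumes sep: "separating S \<eta> h \<Phi>" and fine: "fine_family (\<eta>/4) \<zeta> \<P>" and "\<eta> > 0"
  shows "separating S (min \<zeta> (\<eta>/4)) h (\<Phi> \<union> \<Union>\<P>)"
proof -
  obtain P Q where PQ: "\<Phi> \<subseteq> P \<union> Q" "{x\<in>S. h x \<le> 0} \<subseteq> P" "{x\<in>S. 1 \<le> h x} \<subseteq> Q"
      and d: "\<And>p q. p \<in> P \<Longrightarrow> q \<in> Q \<Longrightarrow> \<eta> \<le> dist p q"
    using sep unfolding separating_def by blast
  define near where "near W \<longleftrightarrow> (\<exists>w\<in>W. \<exists>p\<in>P. dist w p < \<eta>/4)" for W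
  define P' where "P' = P \<union> \<Union>{W\<in>\<P>. near W}"
  define Q' where "Q' = Q \<union> \<Union>{W\<in>\<P>. \<not> near W}"
  have "min \<zeta> (\<eta>/4) \<le> dist p q" if p: "p \<in> P'" and q: "q \<in> Q'" for p q
  proof -
    consider "p \<in> P" "q \<in> Q" | W where "p \<in> P" "W \<in> \<P>" "\<not> near W" "q \<in> W"
      | W where "W \<in> \<P>" "near W" "p \<in> W" "q \<in> Q"
      | W W' where "W \<in> \<P>" "near W" "p \<in> W" "W' \<in> \<P>" "\<not> near W'" "q \<in> W'"
      using p q unfolding P'_def Q'_def by blast
    then show ?thesis
    proof cases
      case 1
      then have "\<eta> \<le> dist p q" using d by blast
      moreover have "min \<zeta> (\<eta>/4) \<le> \<eta>/4" by simp
      ultimately show ?thesis using \<open>\<eta> > 0\<close> by linarith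
    next
      case 2
      then have "\<not> dist q p < \<eta>/4" unfolding near_def by blast
      then show ?thesis by (simp add: dist_commute min.coboundedI2)
    next
      case 3
      then obtain w p' where "w \<in> W" "p' \<in> P" "dist w p' < \<eta>/4" unfolding near_def by blast
      moreover have "dist p w < \<eta>/4"
        using fine 3 \<open>w \<in> W\<close> unfolding fine_family_def by blast
      moreover have "\<eta> \<le> dist p' q" using d \<open>p' \<in> P\<close> 3 by blast
      moreover have "dist p' q \<le> dist w p' + dist p w + dist p q"
        using dist_triangle[of p' q w] dist_triangle[of w q p] by (simp add: dist_commute)
      moreover have "min \<zeta> (\<eta>/4) \<le> \<eta>/4" by simp
      ultimately show ?thesis using \<open>\<eta> > 0\<close> by linarith
    next
      case 4
      then have "W \<noteq> W'" by blast
      then have "\<zeta> \<le> dist p q"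
        using fine 4 unfolding fine_family_def by blast
      then show ?thesis by simp
    qed
  qed
  moreover have "\<Phi> \<union> \<Union>\<P> \<subseteq> P' \<union> Q'" "{x\<in>S. h x \<le> 0} \<subseteq> P'" "{x\<in>S. 1 \<le> h x} \<subseteq> Q'"
    using PQ unfolding P'_def Q'_def by blast+
  ultimately show ?thesis unfolding separating_def by blast
qed

text \<open>The positive values below \<open>\<mu>\<close> are fewer than \<open>m\<close>, so one of the \<open>m\<close> intervals of
  length \<open>\<mu>/m\<close> between \<open>0\<close> and \<open>\<mu>\<close> contains none of them.\<close>

lemma gap_in_values:
  fixes \<psi> :: "'v \<Rightarrow> real"
  assumes fin: "finite A" and nonneg: "\<And>v. v \<in> A \<Longrightarrow> 0 \<le> \<psi> v"
    and card: "card {v\<in>A. 0 < \<psi> v} \<le> m" and u: "u \<in> A" "\<mu> \<le> \<psi> u" and "\<mu> > 0"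
  obtains B where "B \<subseteq> A" "B \<noteq> {}" "card B \<le> m" "\<And>v. v \<in> B \<Longrightarrow> \<mu> / m \<le> \<psi> v"
    "\<And>v w. v \<in> B \<Longrightarrow> w \<in> A - B \<Longrightarrow> \<psi> w + \<mu> / m \<le> \<psi> v"
proof -
  define \<theta> where "\<theta> = \<mu> / m"
  have "{v\<in>A. 0 < \<psi> v} \<noteq> {}" using u \<open>\<mu> > 0\<close> by auto
  then have "card {v\<in>A. 0 < \<psi> v} > 0" using fin by (simp add: card_gt_0_iff)
  then have m: "m > 0" using card by linarith
  then have th: "\<theta> > 0" "m * \<theta> = \<mu>" using \<open>\<mu> > 0\<close> by (auto simp: \<theta>_def)
  have "\<exists>i\<in>{1..m}. \<forall>v\<in>A. \<not> ((real i - 1) * \<theta> < \<psi> v \<and> \<psi> v < i * \<theta>)"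
  proof (rule ccontr)
    assume "\<not> ?thesis"
    then obtain c where c: "\<And>i. i \<in> {1..m} \<Longrightarrow> c i \<in> A \<and> (real i - 1) * \<theta> < \<psi> (c i) \<and> \<psi> (c i) < i * \<theta>"
      by metis
    have less: "\<psi> (c i) < \<psi> (c j)" if "i \<in> {1..m}" "j \<in> {1..m}" "i < j" for i j
    proof -
      have "real i * \<theta> \<le> (real j - 1) * \<theta>"
        using that th by (intro mult_right_mono) auto
      then show ?thesis using c[of i] c[of j] that by linarith
    qed
    have "inj_on c {1..m}"
      by (intro linorder_inj_onI) (use less in fastforce)+
    moreover have "c ` {1..m} \<subseteq> {v\<in>A. 0 < \<psi> v} - {u}"
    proof
      fix v assume "v \<in> c ` {1..m}"
      then obtain i where i: "i \<in> {1..m}" "v = c i" by blast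
      have "0 \<le> (real i - 1) * \<theta>" using i th by simp
      then have "0 < \<psi> v" using c[OF i(1)] unfolding i(2) by linarith
      moreover have "i * \<theta> \<le> m * \<theta>" using i th by (intro mult_right_mono) auto
      then have "\<psi> v < \<mu>" using c[OF i(1)] th unfolding i(2) by linarith
      ultimately show "v \<in> {v\<in>A. 0 < \<psi> v} - {u}"
        using c[OF i(1)] i(2) u by auto
    qed
    ultimately have "card {1..m} \<le> card ({v\<in>A. 0 < \<psi> v} - {u})"
      using fin by (intro card_inj_on_le) auto
    then have "m \<le> card ({v\<in>A. 0 < \<psi> v} - {u})" by simp
    also have "\<dots> < card {v\<in>A. 0 < \<psi> v}"
      using fin u \<open>\<mu> > 0\<close> by (intro card_Diff1_less) auto
    finally show False using card by simp
  qed
  then obtain i where i: "i \<in> {1..m}" and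
    gap: "\<And>v. v \<in> A \<Longrightarrow> \<psi> v \<le> (real i - 1) * \<theta> \<or> i * \<theta> \<le> \<psi> v"
    by (meson not_less)
  have "i * \<theta> \<le> m * \<theta>" "1 * \<theta> \<le> i * \<theta>" using i th by (auto intro!: mult_right_mono)
  define B where "B = {v\<in>A. i * \<theta> \<le> \<psi> v}"
  show thesis
  proof (rule that[of B])
    have "u \<in> B" using u th \<open>i * \<theta> \<le> m * \<theta>\<close> unfolding B_def by simp
    then show "B \<noteq> {}" by blast
    have "B \<subseteq> {v\<in>A. 0 < \<psi> v}" 
      unfolding B_def using th \<open>1 * \<theta> \<le> i * \<theta>\<close> by (intro subsetI CollectI conjI) (simp, smt (verit) mem_Collect_eq)
    then have "card B \<le> card {v\<in>A. 0 < \<psi> v}" using fin by (intro card_mono) simp_all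
    then show "card B \<le> m" using card by linarith
    show "\<mu> / m \<le> \<psi> v" if "v \<in> B" for v
      using that \<open>1 * \<theta> \<le> i * \<theta>\<close> unfolding B_def \<theta>_def[symmetric] mem_Collect_eq by linarith
    show "\<psi> w + \<mu> / m \<le> \<psi> v" if "v \<in> B" "w \<in> A - B" for v w
      using that gap[of w] unfolding B_def \<theta>_def[symmetric] by (auto simp: algebra_simps)
  qed (auto simp: B_def)
qed

text \<open>The pieces are indexed by finite sets \<open>B\<close> of members of a fine cover of the fibre: on
  the piece of \<open>B\<close> the members of \<open>B\<close> dominate all others by a definite amount. Two pieces
  with equally large index sets are therefore apart, and the colour is the size of \<open>B\<close>.\<close>

lemma fine_colouring_near_fibre:
  fixes f :: "'a::metric_space \<Rightarrow> 'b::metric_space"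
  assumes S: "compact S" and f: "continuous_on S f" and e: "\<epsilon> > 0"
    and dim: "covering_dim_le (top_of_set {x\<in>S. f x = y}) k"
  obtains \<rho> \<zeta> \<P> where "\<rho> > 0" "\<zeta> > 0" "\<And>r. fine_family \<epsilon> \<zeta> (\<P> r)" "\<And>r. \<Union>(\<P> r) \<subseteq> S"
    "\<And>x. x \<in> S \<Longrightarrow> dist (f x) y < \<rho> \<Longrightarrow> \<exists>r\<le>k. x \<in> \<Union>(\<P> (r::nat))"
proof -
  define F where "F = {x\<in>S. f x = y}"
  have F: "compact F"
  proof -
    have "closedin (top_of_set S) (S \<inter> f -` {y})"
      using f by (simp add: continuous_closedin_preimage)
    moreover have "S \<inter> f -` {y} = F" unfolding F_def by blast
    ultimately show ?thesis using S closedin_compact by metis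
  qed
  obtain \<V> where fV: "finite \<V>" and cV: "open_cover (top_of_set F) \<V>"
    and dV: "\<And>V x z. V \<in> \<V> \<Longrightarrow> x \<in> V \<Longrightarrow> z \<in> V \<Longrightarrow> dist x z < \<epsilon>/2"
    and kV: "\<And>x. x \<in> F \<Longrightarrow> card {V\<in>\<V>. x \<in> V} \<le> k + 1"
  proof -
    have "F \<subseteq> (\<Union>c\<in>F. ball c (\<epsilon>/4))" using e by auto
    then obtain C where C: "C \<subseteq> F" "finite C" "F \<subseteq> (\<Union>c\<in>C. ball c (\<epsilon>/4))"
      using compactE_image[OF F, of F "\<lambda>c. ball c (\<epsilon>/4)"] by blast
    define \<U> where "\<U> = (\<lambda>c. F \<inter> ball c (\<epsilon>/4)) ` C"
    have "finite \<U>" "open_cover (top_of_set F) \<U>"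
      using C unfolding \<U>_def open_cover_def by (auto intro: openin_open_Int)
    then obtain \<V> where V: "finite \<V>" "open_cover (top_of_set F) \<V>" "\<forall>V\<in>\<V>. \<exists>U\<in>\<U>. V \<subseteq> U"
        "\<forall>x\<in>F. card {V\<in>\<V>. x \<in> V} \<le> k + 1"
      using dim[folded F_def, unfolded covering_dim_le_def, rule_format, of \<U>]
      unfolding topspace_euclidean_subtopology by blast
    have "dist x z < \<epsilon>/2" if xz: "V \<in> \<V>" "x \<in> V" "z \<in> V" for V x z
    proof -
      obtain U where "U \<in> \<U>" "V \<subseteq> U" using V(3) xz(1) by blast
      then obtain c where "V \<subseteq> ball c (\<epsilon>/4)" unfolding \<U>_def by auto
      then have "dist c x < \<epsilon>/4" "dist c z < \<epsilon>/4" using xz(2,3) by auto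
      then show ?thesis using dist_triangle[of x z c] by (simp add: dist_commute)
    qed
    then show thesis using that[of \<V>] V by simp
  qed
  \<comment> \<open>The distance to the empty set is 0 by convention, so a member that is all of
    \<open>F\<close> gets the constant 1 instead. Either way \<open>\<psi> V\<close> is 1-Lipschitz,
    and on \<open>F\<close> it is positive exactly on \<open>V\<close>.\<close>
  define \<psi> where "\<psi> V x = (if F \<subseteq> V then 1 else infdist x (F - V))" for V x
  have lip: "\<bar>\<psi> V x - \<psi> V z\<bar> \<le> dist x z" for V x z
    unfolding \<psi>_def by (simp add: infdist_triangle_abs)
  have nonneg: "0 \<le> \<psi> V x" for V x unfolding \<psi>_def by (simp add: infdist_nonneg)
  have pos_in: "x \<in> V" if "x \<in> F" "0 < \<psi> V x" for x V
    using that unfolding \<psi>_def by (auto split: if_splits)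
  have in_pos: "0 < \<psi> V x" if "V \<in> \<V>" "x \<in> V" for x V
  proof (cases "F \<subseteq> V")
    case False
    have "openin (top_of_set F) V" using cV that unfolding open_cover_def by blast
    then have "closedin (top_of_set F) (F - V)" by (simp add: closedin_diff)
    then have "compact (F - V)" using F closedin_compact by blast
    then show ?thesis using that False unfolding \<psi>_def
      by (auto intro!: infdist_pos_not_in_closed compact_imp_closed)
  qed (simp add: \<psi>_def)
  have cont: "continuous_on F (\<psi> V)" for V unfolding \<psi>_def
    by (cases "F \<subseteq> V") (auto intro!: continuous_intros)
  \<comment> \<open>A positive lower bound for the largest \<open>\<psi> V\<close>: the sum over
    \<open>\<V>\<close> attains a positive minimum on the compact set \<open>F\<close>, and the
    largest summand is at least the mean.\<close>
  obtain \<mu> where mu: "\<mu> > 0" "\<And>x. x \<in> F \<Longrightarrow> \<exists>V\<in>\<V>. \<mu> \<le> \<psi> V x"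
  proof (cases "F = {}")
    case False
    define s where "s x = (\<Sum>V\<in>\<V>. \<psi> V x)" for x
    have "continuous_on F s" unfolding s_def by (intro continuous_intros cont)
    then obtain x0 where x0: "x0 \<in> F" "\<And>x. x \<in> F \<Longrightarrow> s x0 \<le> s x"
      using continuous_attains_inf[OF F False] by blast
    have UV: "\<Union>\<V> = F" using cV by (simp add: open_cover_def)
    then obtain V0 where "V0 \<in> \<V>" "x0 \<in> V0" using x0 by blast
    then have "0 < s x0" unfolding s_def using in_pos nonneg fV by (intro sum_pos2) auto
    have cardV: "card \<V> > 0" using \<open>V0 \<in> \<V>\<close> fV card_gt_0_iff by blast
    show ?thesis
    proof (rule that[of "s x0 / card \<V>"])
      show "0 < s x0 / card \<V>" using \<open>0 < s x0\<close> cardV by simp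
      show "\<exists>V\<in>\<V>. s x0 / card \<V> \<le> \<psi> V x" if "x \<in> F" for x
      proof (rule ccontr)
        assume "\<not> ?thesis"
        then have "s x < (\<Sum>V\<in>\<V>. s x0 / card \<V>)"
          unfolding s_def using \<open>V0 \<in> \<V>\<close> fV by (intro sum_strict_mono) auto
        then show False using x0(2)[OF that] cardV by simp
      qed
    qed
  qed (use that[of 1] in auto)
  define \<theta> where "\<theta> = \<mu> / (k + 1)"
  have th: "\<theta> > 0" using mu by (simp add: \<theta>_def)
  define \<eta> where "\<eta> = min (\<theta>/8) (\<epsilon>/4)"
  have eta: "\<eta> > 0" "\<eta> \<le> \<theta>/8" "\<eta> \<le> \<epsilon>/4" using th e by (auto simp: \<eta>_def)
  \<comment> \<open>The margin \<theta> available at points of \<open>F\<close> is halved: a move by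
    less than \<open>\<eta> \<le> \<theta>/8\<close> changes a difference of two 1-Lipschitz
    functions by at most \<open>\<theta>/4\<close>.\<close>
  define W where "W B = {x\<in>S. (\<exists>x'\<in>F. dist x x' < \<eta>) \<and> (\<forall>V\<in>B. \<theta>/2 < \<psi> V x) \<and>
      (\<forall>V\<in>B. \<forall>V'\<in>\<V> - B. \<theta>/2 < \<psi> V x - \<psi> V' x)}" for B
  \<comment> \<open>The index sets that occur have between 1 and \<open>k + 1\<close> elements,
    hence the shift between their size and the colour \<open>r \<le> k\<close>.\<close>
  define \<P> where "\<P> r = W ` {B. B \<subseteq> \<V> \<and> card B = Suc r}" for r :: nat
  have cover: "\<exists>r\<le>k. x \<in> \<Union>(\<P> r)" if x: "x \<in> S" "x' \<in> F" "dist x x' < \<eta>" for x x'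
  proof -
    have "{V \<in> \<V>. 0 < \<psi> V x'} \<subseteq> {V\<in>\<V>. x' \<in> V}" using pos_in x by blast
    then have "card {V \<in> \<V>. 0 < \<psi> V x'} \<le> card {V\<in>\<V>. x' \<in> V}"
      using fV by (intro card_mono) simp_all
    then have c1: "card {V \<in> \<V>. 0 < \<psi> V x'} \<le> k + 1"
      using kV[OF x(2)] by linarith
    obtain U where U: "U \<in> \<V>" "\<mu> \<le> \<psi> U x'" using mu(2) x by blast
    obtain B where B: "B \<subseteq> \<V>" "B \<noteq> {}" "card B \<le> k + 1" "\<And>V. V \<in> B \<Longrightarrow> \<theta> \<le> \<psi> V x'"
      "\<And>V V'. V \<in> B \<Longrightarrow> V' \<in> \<V> - B \<Longrightarrow> \<psi> V' x' + \<theta> \<le> \<psi> V x'"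
      by (rule gap_in_values[of \<V> "\<lambda>V. \<psi> V x'" "k+1" U \<mu>, OF fV nonneg c1 U mu(1)])
        (rule that, simp_all add: \<theta>_def add.commute)
    have close: "\<psi> V x' - \<theta>/8 \<le> \<psi> V x" "\<psi> V x \<le> \<psi> V x' + \<theta>/8" for V
      using lip[of V x x'] x(3) eta by linarith+
    have "x \<in> W B"
    proof -
      have "\<theta>/2 < \<psi> V x" if "V \<in> B" for V
        using B(4)[OF that] close[of V] th by linarith
      moreover have "\<theta>/2 < \<psi> V x - \<psi> V' x" if "V \<in> B" "V' \<in> \<V> - B" for V V'
        using B(5)[OF that] close[of V] close[of V'] th by linarith
      ultimately show ?thesis unfolding W_def using x by blast
    qed
    moreover have "card B \<noteq> 0" using B fV finite_subset by fastforce
    ultimately have "x \<in> \<Union>(\<P> (card B - 1))" "card B - 1 \<le> k"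
      unfolding \<P>_def using B by (auto intro!: bexI[of _ B])
    then show ?thesis by blast
  qed
  have fine: "fine_family \<epsilon> (\<theta>/2) (\<P> r)" for r
    unfolding fine_family_def
  proof (intro conjI ballI impI)
    fix w x z assume "w \<in> \<P> r" and xz: "x \<in> w" "z \<in> w"
    then obtain B where B: "B \<subseteq> \<V>" "card B = Suc r" "w = W B" unfolding \<P>_def by blast
    then obtain V where V: "V \<in> B" by fastforce
    have *: "\<exists>x'\<in>V. dist x x' < \<eta>" if x: "x \<in> W B" for x
    proof -
      obtain x' where x': "x' \<in> F" "dist x x' < \<eta>" "\<theta>/2 < \<psi> V x"
        using x V unfolding W_def by blast
      then have "0 < \<psi> V x'" using lip[of V x x'] eta by linarith
      then show ?thesis using pos_in x' by blast
    qed
    obtain x' where x': "x' \<in> V" "dist x x' < \<eta>" using * B xz by blast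
    obtain z' where z': "z' \<in> V" "dist z z' < \<eta>" using * B xz by blast
    have "dist x' z' < \<epsilon>/2" using dV V B x' z' by blast
    then have "dist x x' + dist x' z' + dist z z' < \<epsilon>" using x' z' eta by linarith
    moreover have "dist x z \<le> dist x x' + dist x' z' + dist z z'"
      using dist_triangle[of x z x'] dist_triangle[of x' z z'] by (simp add: dist_commute)
    ultimately show "dist x z < \<epsilon>" by linarith
  next
    fix w w' x z assume "w \<in> \<P> r" "w' \<in> \<P> r" "w \<noteq> w'" and xz: "x \<in> w" "z \<in> w'"
    then obtain B B' where B: "B \<subseteq> \<V>" "card B = Suc r" "w = W B" "B' \<subseteq> \<V>" "card B' = Suc r" "w' = W B'"
      unfolding \<P>_def by blast
    have "finite B" "finite B'" using B fV finite_subset by blast+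
    \<comment> \<open>Distinct sets of equal size each contain an element that the other lacks. The
      difference \<open>\<psi> V - \<psi> V'\<close> goes from above \<open>\<theta>/2\<close> at
      \<open>x\<close> to below \<open>-\<theta>/2\<close> at \<open>z\<close>, and it is
      2-Lipschitz.\<close>
    then obtain V V' where V: "V \<in> B" "V \<notin> B'" "V' \<in> B'" "V' \<notin> B"
      using B \<open>w \<noteq> w'\<close> by (metis card_subset_eq subsetI)
    have "\<theta>/2 < \<psi> V x - \<psi> V' x" "\<theta>/2 < \<psi> V' z - \<psi> V z"
      using V B xz unfolding W_def by blast+
    then show "\<theta>/2 \<le> dist x z" using lip[of V x z] lip[of V' x z] by linarith
  qed
  have "\<exists>\<rho>>0. \<forall>x\<in>S. dist (f x) y < \<rho> \<longrightarrow> (\<exists>x'\<in>F. dist x x' < \<eta>)"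
  proof -
    \<comment> \<open>The points far from the fibre form a compact set whose image is closed and
      misses \<open>y\<close>; a ball around \<open>y\<close> that avoids this image gives
      \<rho>.\<close>
    define D where "D = S - (\<Union>x'\<in>F. ball x' \<eta>)"
    have "compact D" unfolding D_def using S by (simp add: compact_diff open_UN)
    moreover have "continuous_on D f" using f unfolding D_def by (rule continuous_on_subset) blast
    ultimately have "closed (f ` D)" by (simp add: compact_continuous_image compact_imp_closed)
    moreover have "y \<notin> f ` D" unfolding D_def F_def using eta by auto
    ultimately obtain \<rho> where r: "\<rho> > 0" "ball y \<rho> \<subseteq> - f ` D"
      by (metis Compl_iff open_Compl open_contains_ball)
    have "\<exists>x'\<in>F. dist x x' < \<eta>" if "x \<in> S" "dist (f x) y < \<rho>" for x
    proof -
      have "f x \<in> ball y \<rho>" using that by (simp add: dist_commute)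
      then have "x \<notin> D" using r by blast
      then show ?thesis using that unfolding D_def by (auto simp: dist_commute)
    qed
    then show ?thesis using r by blast
  qed
  then obtain \<rho> where rho: "\<rho> > 0" "\<And>x. x \<in> S \<Longrightarrow> dist (f x) y < \<rho> \<Longrightarrow> \<exists>x'\<in>F. dist x x' < \<eta>"
    by blast
  show thesis
  proof (rule that[of \<rho> "\<theta>/2" \<P>])
    show "\<exists>r\<le>k. x \<in> \<Union>(\<P> r)" if "x \<in> S" "dist (f x) y < \<rho>" for x
      using rho(2)[OF that] cover[OF that(1)] by blast
    show "\<Union>(\<P> r) \<subseteq> S" for r unfolding \<P>_def W_def by auto
  qed (use rho th fine in auto)
qed

section \<open>The zigzag\<close>

text \<open>As \<open>pi < 4\<close>, the angle is within \<open>1/3\<close> of a multiple of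
  \<open>pi\<close>. The value \<open>2/3\<close> is what the amplitude 3 of the cosine in the
  zigzag calls for: it makes that term at least 2 in absolute value.\<close>

lemma cos_near_int_multiple:
  fixes j :: int
  assumes "b > 0" "\<bar>s - real_of_int j * b\<bar> < b/12"
  shows "2/3 \<le> (if even j then 1 else -1) * cos (pi * s / b)"
proof -
  define u where "u = pi * (s - j * b) / b"
  have "\<bar>u\<bar> = pi * (\<bar>s - j * b\<bar> / b)" using assms(1) by (simp add: u_def abs_mult)
  also have "\<dots> \<le> 4 * (1/12)" using assms pi_less_4 by (intro mult_mono) (auto simp: field_simps)
  finally have u: "\<bar>u\<bar> \<le> 1/3" by simp
  have "cos (pi * s / b) = cos (u + j * pi)"
    using assms(1) by (simp add: u_def field_simps)
  also have "\<dots> = cos u * cos (j * pi)" using sin_npi_int[of j] by (simp add: cos_add mult.commute)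
  also have "cos (j * pi) = (if even j then 1 else -1)"
    using cos_npi_int[of j] by (simp add: mult.commute)
  finally have "(if even j then 1 else -1) * cos (pi * s / b) = cos u" by simp
  moreover have "cos u = 1 - 2 * (sin (u/2))\<^sup>2" using cos_double_sin[of "u/2"] by simp
  moreover have "(sin (u/2))\<^sup>2 \<le> (1/6)\<^sup>2"
    using abs_sin_x_le_abs_x[of "u/2"] u by (intro power2_le_iff_abs_le[THEN iffD2]) auto
  ultimately show ?thesis by (simp add: power2_eq_square)
qed

text \<open>On a level set of the perturbed \<open>g\<close> with value near \<open>c\<close>, points with \<open>h\<close> near
  \<open>0\<close> have \<open>g\<close> near \<open>c - a\<close> and points with \<open>h\<close> near \<open>1\<close> have \<open>g\<close> near \<open>c + a\<close>, while the strip
  \<open>2jb \<le> g \<le> (2j+1)b\<close> can be entered only with large \<open>h\<close> and left only with small \<open>h\<close>.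
  So a set that meets this strip in a union of small separate pieces gets cut there.\<close>

lemma separating_by_zigzag:
  fixes g h :: "'a::metric_space \<Rightarrow> real" and a b c :: real and j :: int
  assumes ab: "0 < b" "b \<le> a" and \<eta>: "\<eta> \<le> \<zeta>"
    and j: "c - a/2 < 2 * j * b" "(2 * j + 1) * b < c + a/2"
    and \<Phi>: "\<Phi> \<subseteq> S"
    and level: "\<And>x. x \<in> \<Phi> \<Longrightarrow>
        \<bar>g x + a * max (-1) (min 1 (3 * cos (pi * g x / b) + 4 - 8 * h x)) - c\<bar> < a/8"
    and gmod: "\<And>x y. x \<in> S \<Longrightarrow> y \<in> S \<Longrightarrow> dist x y < \<eta> \<Longrightarrow> \<bar>g x - g y\<bar> < b/12"
    and hmod: "\<And>x y. x \<in> S \<Longrightarrow> y \<in> S \<Longrightarrow> dist x y < \<eta> \<Longrightarrow> \<bar>h x - h y\<bar> < 1/64"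
    and fine: "fine_family \<epsilon> \<zeta> \<P>" "\<Union>\<P> \<subseteq> S"
    and hfine: "\<And>x y. x \<in> S \<Longrightarrow> y \<in> S \<Longrightarrow> dist x y < \<epsilon> \<Longrightarrow> \<bar>h x - h y\<bar> < 1/8"
    and strip: "\<And>x. x \<in> \<Phi> \<Longrightarrow> 2 * j * b \<le> g x \<Longrightarrow> g x \<le> (2 * j + 1) * b \<Longrightarrow> x \<in> \<Union>\<P>"
  shows "separating S \<eta> h \<Phi>"
proof -
  have a: "a > 0" using ab by linarith
  define s\<^sub>0 s\<^sub>1 where "s\<^sub>0 = 2 * j * b" and "s\<^sub>1 = (2 * j + 1) * b"
  have s01: "c - a/2 < s\<^sub>0" "s\<^sub>1 < c + a/2" "s\<^sub>1 = s\<^sub>0 + b"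
    using j by (auto simp: s\<^sub>0_def s\<^sub>1_def algebra_simps)
  \<comment> \<open>The term \<open>4 - 8 * h\<close> runs from 4 to -4 as \<open>h\<close> runs
    from 0 to 1, so at the ends it outweighs the cosine: \<open>\<beta> \<ge> 3/4\<close> for
    \<open>h < 1/32\<close>, and \<open>\<beta> \<le> -3/4\<close> for \<open>h > 31/32\<close>. In
    between the cosine decides: where it is at least \<open>2/3\<close>, \<beta> is 1 up to
    \<open>h = 5/8\<close>; where it is at most \<open>-2/3\<close>, \<beta> is -1 from
    \<open>h = 3/8\<close> on.\<close>
  define \<beta> where "\<beta> x = max (-1) (min 1 (3 * cos (pi * g x / b) + 4 - 8 * h x))" for x
  have lev: "c - a/8 < g x + a * \<beta> x" "g x + a * \<beta> x < c + a/8" if "x \<in> \<Phi>" for x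
    using level[OF that] unfolding \<beta>_def by linarith+
  have cos1: "-1 \<le> cos (pi * g x / b)" "cos (pi * g x / b) \<le> 1" for x by simp_all
  have low: "g x < s\<^sub>0" if x: "x \<in> \<Phi>" "h x < 1/32" for x
  proof -
    have "3/4 \<le> \<beta> x" using x(2) cos1[of x] unfolding \<beta>_def by linarith
    then have "a * (3/4) \<le> a * \<beta> x" using a by simp
    then show ?thesis using lev[OF x(1)] s01 a by linarith
  qed
  have high: "s\<^sub>1 < g x" if x: "x \<in> \<Phi>" "h x > 31/32" for x
  proof -
    have "\<beta> x \<le> -(3/4)" using x(2) cos1[of x] unfolding \<beta>_def by linarith
    then have "a * \<beta> x \<le> a * (-(3/4))" using a by (intro mult_left_mono) auto
    then show ?thesis using lev[OF x(1)] s01 a by linarith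
  qed
  \<comment> \<open>At the lower end of the strip the cosine is near 1. With
    \<open>h x \<le> 5/8\<close> the perturbation would be the full \<open>a\<close>, so
    \<open>g x\<close> would lie below \<open>c - 7 * a / 8\<close>, whereas the strip starts above
    \<open>c - a/2\<close>.\<close>
  have enter: "5/8 < h x" if x: "x \<in> \<Phi>" "\<bar>g x - s\<^sub>0\<bar> < b/12" for x
  proof (rule ccontr)
    assume "\<not> ?thesis"
    moreover have "2/3 \<le> cos (pi * g x / b)"
      using cos_near_int_multiple[OF ab(1), of "g x" "2 * j"] x(2) by (simp add: s\<^sub>0_def)
    ultimately have "\<beta> x = 1" unfolding \<beta>_def by linarith
    then show False using lev[OF x(1)] s01 x(2) ab by simp
  qed
  have leave: "h x < 3/8" if x: "x \<in> \<Phi>" "\<bar>g x - s\<^sub>1\<bar> < b/12" for x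
  proof (rule ccontr)
    assume "\<not> ?thesis"
    moreover have "2/3 \<le> - cos (pi * g x / b)"
      using cos_near_int_multiple[OF ab(1), of "g x" "2 * j + 1"] x(2) by (simp add: s\<^sub>1_def)
    ultimately have "\<beta> x = -1" unfolding \<beta>_def by linarith
    then show False using lev[OF x(1)] s01 x(2) ab by simp
  qed
  \<comment> \<open>A piece reaching the lower end of the strip has a point with
    \<open>h > 5/8\<close>, one reaching the upper end a point with \<open>h < 3/8\<close>. As
    \<open>h\<close> varies by less than \<open>1/8\<close> on a piece, the test at
    \<open>1/2\<close> sends the former to \<open>P\<close>, which contains the part below the
    strip, and the latter to \<open>Q\<close>, which contains the part above.\<close>
  define up where "up W \<longleftrightarrow> (\<forall>z\<in>W. 1/2 < h z)" for W
  define strp where "strp = {x\<in>\<Phi>. s\<^sub>0 \<le> g x \<and> g x \<le> s\<^sub>1}"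
  define P where "P = {x\<in>S. h x \<le> 0} \<union> {x\<in>\<Phi>. g x < s\<^sub>0} \<union> {x\<in>strp. \<exists>W\<in>\<P>. x \<in> W \<and> up W}"
  define Q where "Q = {x\<in>S. 1 \<le> h x} \<union> {x\<in>\<Phi>. s\<^sub>1 < g x} \<union> {x\<in>strp. \<exists>W\<in>\<P>. x \<in> W \<and> \<not> up W}"
  have osc: "\<bar>h x - h z\<bar> < 1/8" if "W \<in> \<P>" "x \<in> W" "z \<in> W" for W x z
  proof (rule hfine)
    show "dist x z < \<epsilon>" using fine(1) that unfolding fine_family_def by blast
    show "x \<in> S" "z \<in> S" using fine(2) that by blast+
  qed
  have "\<eta> \<le> dist p q" if p: "p \<in> P" and q: "q \<in> Q" for p q
  proof (rule ccontr)
    assume "\<not> ?thesis"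
    then have d: "dist p q < \<eta>" by simp
    have "p \<in> S" "q \<in> S" using p q \<Phi> unfolding P_def Q_def strp_def by blast+
    then have gh: "\<bar>g p - g q\<bar> < b/12" "\<bar>h p - h q\<bar> < 1/64" using gmod[OF _ _ d] hmod[OF _ _ d] by simp_all
    consider "h p \<le> 0" | "p \<in> \<Phi>" "g p < s\<^sub>0" | W where "p \<in> \<Phi>" "s\<^sub>0 \<le> g p" "g p \<le> s\<^sub>1" "W \<in> \<P>" "p \<in> W" "up W"
      using p unfolding P_def strp_def by blast
    note pcases = this
    consider "1 \<le> h q" | "q \<in> \<Phi>" "s\<^sub>1 < g q" | W where "q \<in> \<Phi>" "s\<^sub>0 \<le> g q" "g q \<le> s\<^sub>1" "W \<in> \<P>" "q \<in> W" "\<not> up W"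
      using q unfolding Q_def strp_def by blast
    then show False
    proof cases
      case 1
      show False using pcases
      proof cases
        case 2 then show False using high[of p] gh \<open>1 \<le> h q\<close> s01 ab by linarith
      next
        case 3 then show False using high[of p] gh \<open>1 \<le> h q\<close> s01 ab by linarith
      qed (use gh 1 in linarith)
    next
      case q: 2
      show False using pcases
      proof cases
        case 1 then show False using low[of q] gh q s01 ab by linarith
      next
        case 2 then show False using gh q s01 ab by linarith
      next
        case 3
        then have "\<bar>g p - s\<^sub>1\<bar> < b/12" using gh q by linarith
        then have "h p < 3/8" using leave 3 by blast
        moreover have "1/2 < h p" using 3 unfolding up_def by blast
        ultimately show False by linarith
      qed
    next
      case q: 3
      show False using pcases
      proof cases
        case 1 then show False using low[of q] gh q s01 ab by linarith
      next
        case 2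
        then have "\<bar>g q - s\<^sub>0\<bar> < b/12" using gh q by linarith
        then have h: "5/8 < h q" using enter q by blast
        obtain z where "z \<in> W" "h z \<le> 1/2" using q unfolding up_def by fastforce
        then show False using osc[of W q z] q h by linarith
      next
        case (3 W')
        then have "W' \<noteq> W" using q by blast
        then have "\<zeta> \<le> dist p q" using fine(1) q 3 unfolding fine_family_def by blast
        then show False using d \<eta> by linarith
      qed
    qed
  qed
  moreover have "\<Phi> \<subseteq> P \<union> Q"
  proof
    fix x assume x: "x \<in> \<Phi>"
    show "x \<in> P \<union> Q"
    proof (cases "s\<^sub>0 \<le> g x \<and> g x \<le> s\<^sub>1")
      case True
      then obtain W where "W \<in> \<P>" "x \<in> W" using strip[OF x] unfolding s\<^sub>0_def s\<^sub>1_def by blast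
      moreover have "x \<in> strp" using True x unfolding strp_def by blast
      ultimately show ?thesis unfolding P_def Q_def by blast
    next
      case False
      then have "g x < s\<^sub>0 \<or> s\<^sub>1 < g x" by linarith
      then show ?thesis using x unfolding P_def Q_def by blast
    qed
  qed
  moreover have "{x\<in>S. h x \<le> 0} \<subseteq> P" "{x\<in>S. 1 \<le> h x} \<subseteq> Q" unfolding P_def Q_def by blast+
  ultimately show ?thesis unfolding separating_def by blast
qed

text \<open>Colour 0 is separated with the help of \<open>g\<close>, and only for the first
  \<open>q\<close> functions; the colours \<open>1, ..., k\<close> separate all \<open>N\<close>
  functions over small balls of the target at every stage. They start empty, and each stage hands
  them, in fine pieces, what it removes from colour 0.\<close>

definition stage ::
    "'a::metric_space set \<Rightarrow> ('a \<Rightarrow> 'b::metric_space) \<Rightarrow> nat \<Rightarrow> (nat \<Rightarrow> 'a \<Rightarrow> real) \<Rightarrow> nat \<Rightarrow>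
      nat \<Rightarrow> ('a \<Rightarrow> real) \<Rightarrow> (nat \<Rightarrow> 'a set) \<Rightarrow> real \<Rightarrow> bool" where
  "stage S f k h N q g A \<eta> \<longleftrightarrow>
     continuous_on S g \<and> 0 < \<eta> \<and> S \<subseteq> (\<Union>r\<le>k. A r) \<and>
     (\<forall>r\<in>{1..k}. \<forall>m<N. \<forall>y\<in>f ` S. separating S \<eta> (h m) (A r \<inter> {x\<in>S. dist (f x) y < \<eta>})) \<and>
     (\<forall>m<q. \<forall>y\<in>f ` S. \<forall>c.
        separating S \<eta> (h m) (A 0 \<inter> {x\<in>S. dist (f x) y < \<eta> \<and> \<bar>g x - c\<bar> < \<eta>}))"

section \<open>Moduli, strips of values of \<open>g\<close>, and the passage to the next test
  function\<close>

lemma uniform_modulus: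
  fixes u :: "'a::metric_space \<Rightarrow> 'b::metric_space"
  assumes "compact S" "continuous_on S u" "e > 0"
  obtains d where "d > 0" "\<And>x y. x \<in> S \<Longrightarrow> y \<in> S \<Longrightarrow> dist x y < d \<Longrightarrow> dist (u x) (u y) < e"
  using compact_uniformly_continuous[OF assms(2,1)] assms(3)
  unfolding uniformly_continuous_on_def by (metis dist_commute)

lemma finite_positive_lower_bound:
  fixes u :: "'a \<Rightarrow> real"
  assumes "finite A" "\<And>x. x \<in> A \<Longrightarrow> 0 < u x"
  obtains m where "m > 0" "\<And>x. x \<in> A \<Longrightarrow> m \<le> u x"
proof (cases "A = {}")
  case False
  show thesis
    by (rule that[of "Min (u ` A)"]) (use assms False in auto)
qed (use that[of 1] in auto)

lemma finite_labels:
  assumes "finite A"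
  obtains l where "inj_on l A" "\<And>x. x \<in> A \<Longrightarrow> l x < card A + (1::nat)"
proof -
  obtain l where "bij_betw l A {0..<card A}" using ex_bij_betw_finite_nat[OF assms] by blast
  then have inj: "inj_on l A" and im: "l ` A = {0..<card A}" unfolding bij_betw_def by auto
  have "l x < card A + 1" if "x \<in> A" for x
  proof -
    have "l x \<in> {0..<card A}" using im that by blast
    then show ?thesis by simp
  qed
  then show thesis using that[of l] inj by blast
qed

definition strips :: "real \<Rightarrow> nat \<Rightarrow> nat \<Rightarrow> real set" where
  "strips b n i = {s. \<exists>t::int. 2 * real_of_int (int i + int n * t) * b \<le> s \<and> s \<le> (2 * real_of_int (int i + int n * t) + 1) * b}"

lemma strips_apart:
  assumes "s \<in> strips b n i" "s' \<in> strips b n i'" "i < n" "i' < n" "i \<noteq> i'" "b > 0"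
  shows "b \<le> \<bar>s - s'\<bar>"
proof -
  obtain t t' where t: "2 * real_of_int (int i + int n * t) * b \<le> s" "s \<le> (2 * real_of_int (int i + int n * t) + 1) * b"
    "2 * real_of_int (int i' + int n * t') * b \<le> s'" "s' \<le> (2 * real_of_int (int i' + int n * t') + 1) * b"
    using assms(1,2) unfolding strips_def by blast
  define j j' where "j = int i + int n * t" and "j' = int i' + int n * t'"
  have "j mod int n = int i" "j' mod int n = int i'"
    unfolding j_def j'_def using assms(3,4) by simp_all
  then have "j \<noteq> j'" using assms(5) by auto
  have *: "b \<le> v - u" if "u \<le> (2 * real_of_int k + 1) * b" "2 * real_of_int k' * b \<le> v" "k < k'" for k k' :: int and u v
  proof -
    have "(2 * real_of_int k + 2) * b \<le> 2 * real_of_int k' * b"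
      using that(3) assms(6) by (intro mult_right_mono) auto
    then show ?thesis using that by (simp add: algebra_simps)
  qed
  show ?thesis
  proof (cases "j < j'")
    case True
    then have "b \<le> s' - s" using *[of s j j' s'] t unfolding j_def j'_def by simp
    then show ?thesis by linarith
  next
    case False
    then have "b \<le> s - s'" using *[of s' j' j s] t \<open>j \<noteq> j'\<close> unfolding j_def j'_def by simp
    then show ?thesis by linarith
  qed
qed

text \<open>One round through all \<open>n\<close> classes takes length
  \<open>2 * n * b = a/2\<close>. The first strip of class \<open>i\<close> that starts after
  \<open>c - a/2\<close> thus starts no later than \<open>c\<close>, and its length
  \<open>b \<le> a/4\<close> keeps it inside the window.\<close>

lemma strip_in_window:
  fixes a b c :: real
  assumes "i < n" "a > 0" "b = a / (4 * n)"
  obtains j :: int where "c - a/2 < 2 * real_of_int j * b" "(2 * real_of_int j + 1) * b < c + a/2"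
    "{s. 2 * real_of_int j * b \<le> s \<and> s \<le> (2 * real_of_int j + 1) * b} \<subseteq> strips b n i"
proof -
  define x where "x = (c - a/2) / (2 * b)"
  define t where "t = \<lfloor>(x - i) / n\<rfloor> + 1"
  define j where "j = int i + int n * t"
  have n: "real n \<ge> 1" using assms(1) by simp
  have b: "b > 0" "4 * (n * b) = a" using assms(2,3) n by simp_all
  have t: "(x - i) / n < t" "t \<le> (x - i) / n + 1" unfolding t_def by linarith+
  have "x - i < n * t" "n * t \<le> x - i + n"
    using t n by (simp_all add: field_simps)
  then have "x < j" "j \<le> x + n" unfolding j_def by auto
  then have "2 * b * x < 2 * b * j" "2 * b * j \<le> 2 * b * (x + n)" using b by simp_all
  moreover have "2 * b * x = c - a/2" unfolding x_def using b by simp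
  ultimately have 1: "c - a/2 < 2 * real_of_int j * b" "2 * real_of_int j * b \<le> c - a/2 + 2 * (n * b)"
    by (simp_all add: algebra_simps)
  have "1 * b \<le> n * b" using n b by (intro mult_right_mono) auto
  then have "b \<le> a/4" using b by linarith
  then have 2: "(2 * real_of_int j + 1) * b < c + a/2" using 1 b assms(2) by (simp add: algebra_simps)
  show thesis
    by (rule that[of j]) (use 1 2 in \<open>auto simp: strips_def j_def\<close>)
qed

text \<open>Colour 0 keeps its earlier separations because \<open>A' 0\<close> is contained in
  \<open>A 0\<close> and \<open>g'\<close> differs from \<open>g\<close> by at most
  \<open>a = \<eta>/2\<close>, so that a narrow band of values of \<open>g'\<close> lies in a band
  of half-width \<eta> for \<open>g\<close>. The other colours keep theirs by
  \<open>separating_Un_fine_family\<close>. The zigzag adds the separation of \<open>h q\<close> in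
  colour 0.\<close>

lemma stage_Suc:
  fixes f :: "'a::metric_space \<Rightarrow> 'b::metric_space"
  assumes S: "compact S" and f: "continuous_on S f"
    and dim: "\<And>y. y \<in> f ` S \<Longrightarrow> covering_dim_le (top_of_set {x\<in>S. f x = y}) k"
    and h: "\<And>m. m < N \<Longrightarrow> continuous_on S (h m)" and q: "q < N"
    and stage: "stage S f k h N q g A \<eta>"
  obtains g' A' \<eta>' where "stage S f k h N (Suc q) g' A' \<eta>'"
proof -
  have g: "continuous_on S g" and eta: "\<eta> > 0" and cov: "S \<subseteq> (\<Union>r\<le>k. A r)"
    and sepr: "\<And>r m y. r \<in> {1..k} \<Longrightarrow> m < N \<Longrightarrow> y \<in> f ` S \<Longrightarrow>
      separating S \<eta> (h m) (A r \<inter> {x\<in>S. dist (f x) y < \<eta>})"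
    and sep0: "\<And>m y c. m < q \<Longrightarrow> y \<in> f ` S \<Longrightarrow>
      separating S \<eta> (h m) (A 0 \<inter> {x\<in>S. dist (f x) y < \<eta> \<and> \<bar>g x - c\<bar> < \<eta>})"
    using stage unfolding stage_def by blast+
  obtain \<epsilon>0 where e0: "\<epsilon>0 > 0" "\<And>x y. x \<in> S \<Longrightarrow> y \<in> S \<Longrightarrow> dist x y < \<epsilon>0 \<Longrightarrow> dist (h q x) (h q y) < 1/8"
    using uniform_modulus[OF S h[OF q], of "1/8"] by auto
  \<comment> \<open>The bound \<open>\<epsilon>0\<close> limits the oscillation of
    \<open>h q\<close> on pieces, as the zigzag requires; \<open>\<eta>/4\<close> is the diameter
    that \<open>separating_Un_fine_family\<close> tolerates.\<close>
  define \<epsilon> where "\<epsilon> = min \<epsilon>0 (\<eta>/4)"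
  have e: "\<epsilon> > 0" "\<epsilon> \<le> \<epsilon>0" "\<epsilon> \<le> \<eta>/4" using e0 eta by (auto simp: \<epsilon>_def)
  define Loc where "Loc y \<rho> \<zeta> \<P> \<longleftrightarrow> \<rho> > 0 \<and> \<zeta> > 0 \<and>
      (\<forall>r::nat. fine_family \<epsilon> \<zeta> (\<P> r) \<and> \<Union>(\<P> r) \<subseteq> S) \<and>
      (\<forall>x\<in>S. dist (f x) y < \<rho> \<longrightarrow> (\<exists>r\<le>k. x \<in> \<Union>(\<P> r)))" for y \<rho> \<zeta> \<P>
  have "\<exists>\<rho> \<zeta> \<P>. Loc y \<rho> \<zeta> \<P>" if y: "y \<in> f ` S" for y
    by (rule fine_colouring_near_fibre[OF S f e(1) dim[OF y]]) (unfold Loc_def, blast)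
  then obtain \<rho> \<zeta> \<P> where Loc: "\<And>y. y \<in> f ` S \<Longrightarrow> Loc y (\<rho> y) (\<zeta> y) (\<P> y)"
    by metis
  have loc: "\<And>y. y \<in> f ` S \<Longrightarrow> \<rho> y > 0" "\<And>y. y \<in> f ` S \<Longrightarrow> \<zeta> y > 0"
      "\<And>y r. y \<in> f ` S \<Longrightarrow> fine_family \<epsilon> (\<zeta> y) (\<P> y r)" "\<And>y r. y \<in> f ` S \<Longrightarrow> \<Union>(\<P> y r) \<subseteq> S"
      "\<And>y x. y \<in> f ` S \<Longrightarrow> x \<in> S \<Longrightarrow> dist (f x) y < \<rho> y \<Longrightarrow> \<exists>r\<le>k. x \<in> \<Union>(\<P> y r)"
    using Loc unfolding Loc_def by blast+
  have fS: "compact (f ` S)" using S f compact_continuous_image by blast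
  have "f ` S \<subseteq> (\<Union>y\<in>f ` S. ball y (\<rho> y / 2))" using loc(1) by force
  then obtain Y where Y: "Y \<subseteq> f ` S" "finite Y" "f ` S \<subseteq> (\<Union>y\<in>Y. ball y (\<rho> y / 2))"
    using compactE_image[OF fS, of "f ` S" "\<lambda>y. ball y (\<rho> y / 2)"] by blast
  define n where "n = card Y + 1"
  obtain l where l: "inj_on l Y" "\<And>y. y \<in> Y \<Longrightarrow> l y < n"
    by (rule finite_labels[OF Y(2)], rule that) (assumption, unfold n_def, blast)
  have pos: "0 < \<rho> y / 2" "0 < \<zeta> y" if "y \<in> Y" for y
    using loc(1,2)[of y] subsetD[OF Y(1) that] by simp_all
  obtain \<rho>0 where r0: "\<rho>0 > 0" "\<And>y. y \<in> Y \<Longrightarrow> \<rho>0 \<le> \<rho> y / 2"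
    using finite_positive_lower_bound[of Y "\<lambda>y. \<rho> y / 2", OF Y(2) pos(1)] by blast
  obtain \<zeta>0 where z0: "\<zeta>0 > 0" "\<And>y. y \<in> Y \<Longrightarrow> \<zeta>0 \<le> \<zeta> y"
    using finite_positive_lower_bound[of Y \<zeta>, OF Y(2) pos(2)] by blast
  define a where "a = \<eta>/2"
  define b where "b = a / (4 * real n)"
  have a: "a > 0" using eta by (simp add: a_def)
  have b: "b > 0" "b \<le> a" using a by (auto simp: b_def n_def field_simps)
  obtain \<eta>1 where e1: "\<eta>1 > 0" "\<And>x y. x \<in> S \<Longrightarrow> y \<in> S \<Longrightarrow> dist x y < \<eta>1 \<Longrightarrow> dist (g x) (g y) < b/12"
    using uniform_modulus[OF S g, of "b/12"] b by auto
  obtain \<eta>2 where e2: "\<eta>2 > 0" "\<And>x y. x \<in> S \<Longrightarrow> y \<in> S \<Longrightarrow> dist x y < \<eta>2 \<Longrightarrow> dist (h q x) (h q y) < 1/64"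
    using uniform_modulus[OF S h[OF q], of "1/64"] by auto
  define \<zeta>' where "\<zeta>' = min \<zeta>0 \<eta>1"
  define \<eta>' where "\<eta>' = min (min \<zeta>' \<eta>2) (min (\<eta>/16) \<rho>0)"
  have eta': "\<eta>' > 0" "\<eta>' \<le> \<zeta>0" "\<eta>' \<le> \<eta>1" "\<eta>' \<le> \<eta>2" "\<eta>' \<le> \<eta>/16" "\<eta>' \<le> \<rho>0" "\<eta>' \<le> \<zeta>'"
    using r0 z0 e1 e2 eta by (auto simp: \<eta>'_def \<zeta>'_def)
  define R where "R y = {x\<in>S. dist (f x) y < \<rho> y \<and> g x \<in> strips b n (l y)}" for y
  define \<Q> where "\<Q> r = {W \<inter> R y | y W. y \<in> Y \<and> W \<in> \<P> y r}" for r
  \<comment> \<open>In the strips belonging to \<open>y\<close>, colour 0 keeps only what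
    \<open>\<P> y 0\<close> covers. A point removed there is covered by some \<open>\<P> y r\<close>
    with \<open>r \<ge> 1\<close>, which is why these pieces, cut down to \<open>R y\<close>, are
    added to colour \<open>r\<close>.\<close>
  define A' where "A' r = (if r = 0 then {x\<in>A 0. \<forall>y\<in>Y. x \<in> R y \<longrightarrow> x \<in> \<Union>(\<P> y 0)} else A r \<union> \<Union>(\<Q> r))" for r
  define g' where "g' x = g x + a * max (-1) (min 1 (3 * cos (pi * g x / b) + 4 - 8 * h q x))" for x
  have cont: "continuous_on S g'"
    unfolding g'_def using g h[OF q] b by (intro continuous_intros) auto
  have cov': "S \<subseteq> (\<Union>r\<le>k. A' r)"
  proof
    fix x assume x: "x \<in> S"
    then obtain r where r: "r \<le> k" "x \<in> A r" using cov by blast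
    show "x \<in> (\<Union>r\<le>k. A' r)"
    proof (cases "r = 0 \<and> x \<notin> A' 0")
      case True
      then obtain y where y: "y \<in> Y" "x \<in> R y" "x \<notin> \<Union>(\<P> y 0)"
        using r unfolding A'_def by auto
      then have "dist (f x) y < \<rho> y" unfolding R_def by blast
      then obtain r' where r': "r' \<le> k" "x \<in> \<Union>(\<P> y r')" using loc(5) Y(1) y(1) x by blast
      then have "r' \<noteq> 0" using y by metis
      moreover have "x \<in> \<Union>(\<Q> r')" using r'(2) y unfolding \<Q>_def by blast
      ultimately show ?thesis using r' unfolding A'_def by auto
    next
      case False
      then have "x \<in> A' r" using r unfolding A'_def by auto
      then show ?thesis using r by blast
    qed
  qed
  have fineQ: "fine_family (\<eta>/4) \<zeta>' (\<Q> r)" for r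
    unfolding fine_family_def
  proof (intro conjI ballI impI)
    fix w x z assume w: "w \<in> \<Q> r" and xz: "x \<in> w" "z \<in> w"
    then obtain y W where "y \<in> Y" "W \<in> \<P> y r" "x \<in> W" "z \<in> W" unfolding \<Q>_def by blast
    then have "dist x z < \<epsilon>" using loc(3)[of y r] Y(1) unfolding fine_family_def by blast
    then show "dist x z < \<eta>/4" using e by linarith
  next
    fix w w' x z assume w: "w \<in> \<Q> r" "w' \<in> \<Q> r" "w \<noteq> w'" and xz: "x \<in> w" "z \<in> w'"
    obtain y W where W: "y \<in> Y" "W \<in> \<P> y r" "w = W \<inter> R y" using w unfolding \<Q>_def by blast
    obtain y' W' where W': "y' \<in> Y" "W' \<in> \<P> y' r" "w' = W' \<inter> R y'" using w unfolding \<Q>_def by blast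
    show "\<zeta>' \<le> dist x z"
    proof (cases "y = y'")
      case True
      then have "\<zeta> y \<le> dist x z"
        using loc(3)[of y r] Y(1) W W' w(3) xz unfolding fine_family_def by blast
      then show ?thesis using z0(2)[OF W(1)] unfolding \<zeta>'_def by linarith
    next
      case False
      \<comment> \<open>Pieces belonging to different centres lie in strips of different classes, so
        \<open>g\<close> differs by at least \<open>b\<close> between them, and the modulus of
        \<open>g\<close> keeps them apart.\<close>
      then have "l y \<noteq> l y'" using l(1) W(1) W'(1) by (meson inj_onD)
      moreover have "g x \<in> strips b n (l y)" "g z \<in> strips b n (l y')" and S': "x \<in> S" "z \<in> S"
        using xz W W' unfolding R_def by blast+
      ultimately have "b \<le> \<bar>g x - g z\<bar>" using strips_apart l(2) W(1) W'(1) b(1) by blast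
      then have "\<not> dist (g x) (g z) < b/12" using b by (simp add: dist_real_def)
      then have "\<eta>1 \<le> dist x z" using e1(2)[OF S'] by linarith
      then show ?thesis unfolding \<zeta>'_def by linarith
    qed
  qed
  have sepr': "separating S \<eta>' (h m) (A' r \<inter> {x\<in>S. dist (f x) y < \<eta>'})"
    if r: "r \<in> {1..k}" "m < N" "y \<in> f ` S" for r m y
  proof -
    have *: "separating S (min \<zeta>' (\<eta>/4)) (h m) (A r \<inter> {x\<in>S. dist (f x) y < \<eta>} \<union> \<Union>(\<Q> r))"
      by (rule separating_Un_fine_family[OF sepr[OF r] fineQ eta])
    show ?thesis
    proof (rule separating_mono[OF *])
      have "A' r = A r \<union> \<Union>(\<Q> r)" using r unfolding A'_def by auto
      moreover have "{x\<in>S. dist (f x) y < \<eta>'} \<subseteq> {x\<in>S. dist (f x) y < \<eta>}" using eta' eta by auto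
      ultimately show "A' r \<inter> {x\<in>S. dist (f x) y < \<eta>'} \<subseteq> A r \<inter> {x\<in>S. dist (f x) y < \<eta>} \<union> \<Union>(\<Q> r)"
        by blast
      show "\<eta>' \<le> min \<zeta>' (\<eta>/4)" using eta' eta by simp
    qed
  qed
  have near: "\<bar>g' x - g x\<bar> \<le> a" for x
  proof -
    have "\<bar>max (-1) (min 1 (3 * cos (pi * g x / b) + 4 - 8 * h q x))\<bar> \<le> 1" by linarith
    then have "a * \<bar>max (-1) (min 1 (3 * cos (pi * g x / b) + 4 - 8 * h q x))\<bar> \<le> a * 1"
      using a by (intro mult_left_mono) auto
    then show ?thesis using a unfolding g'_def by (simp add: abs_mult)
  qed
  have sep0': "separating S \<eta>' (h m) (A' 0 \<inter> {x\<in>S. dist (f x) y < \<eta>' \<and> \<bar>g' x - c\<bar> < \<eta>'})"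
    if m: "m < Suc q" and y: "y \<in> f ` S" for m y c
  proof (cases "m < q")
    case True
    show ?thesis
    proof (rule separating_mono[OF sep0[OF True y, of c]])
      show "A' 0 \<inter> {x\<in>S. dist (f x) y < \<eta>' \<and> \<bar>g' x - c\<bar> < \<eta>'} \<subseteq>
          A 0 \<inter> {x\<in>S. dist (f x) y < \<eta> \<and> \<bar>g x - c\<bar> < \<eta>}"
      proof
        fix x assume x: "x \<in> A' 0 \<inter> {x\<in>S. dist (f x) y < \<eta>' \<and> \<bar>g' x - c\<bar> < \<eta>'}"
        then have "dist (f x) y < \<eta>'" "\<bar>g' x - c\<bar> < \<eta>'" by blast+
        then have "\<bar>g x - c\<bar> < \<eta>" "dist (f x) y < \<eta>"
          using near[of x] eta' eta unfolding a_def by linarith+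
        then show "x \<in> A 0 \<inter> {x\<in>S. dist (f x) y < \<eta> \<and> \<bar>g x - c\<bar> < \<eta>}"
          using x unfolding A'_def by simp
      qed
      show "\<eta>' \<le> \<eta>" using eta' eta by linarith
    qed
  next
    case False
    then have [simp]: "m = q" using m by simp
    \<comment> \<open>One chosen neighbourhood suffices over \<open>y\<close>: a strip of its class
      lies in the window around \<open>c\<close>, and the part of \<open>A' 0\<close> near the fibre
      of \<open>y\<close> meets that strip only in the fine family \<open>\<P> y0 0\<close>.\<close>
    obtain y0 where y0: "y0 \<in> Y" "dist y0 y < \<rho> y0 / 2" using Y(3) y by auto
    obtain j where j: "c - a/2 < 2 * real_of_int j * b" "(2 * real_of_int j + 1) * b < c + a/2"
      "{s. 2 * real_of_int j * b \<le> s \<and> s \<le> (2 * real_of_int j + 1) * b} \<subseteq> strips b n (l y0)"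
      using strip_in_window[OF l(2)[OF y0(1)] a b_def, of c] by blast
    show ?thesis unfolding \<open>m = q\<close>
    proof (rule separating_by_zigzag[where \<epsilon> = \<epsilon> and \<zeta> = "\<zeta> y0" and \<P> = "\<P> y0 0" and j = j and g = g and a = a and b = b and c = c])
      show "0 < b" "b \<le> a" by fact+
      show "\<eta>' \<le> \<zeta> y0" using eta' z0(2)[OF y0(1)] by linarith
      show "c - a/2 < real_of_int (2 * j) * b" "real_of_int (2 * j + 1) * b < c + a/2" using j by simp_all
      show "fine_family \<epsilon> (\<zeta> y0) (\<P> y0 0)" "\<Union>(\<P> y0 0) \<subseteq> S" using loc(3,4) subsetD[OF Y(1) y0(1)] by simp_all
      show "A' 0 \<inter> {x\<in>S. dist (f x) y < \<eta>' \<and> \<bar>g' x - c\<bar> < \<eta>'} \<subseteq> S" by blast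
      show "\<bar>g x - g z\<bar> < b/12" if "x \<in> S" "z \<in> S" "dist x z < \<eta>'" for x z
        using e1(2)[OF that(1,2)] that(3) eta' by (simp add: dist_real_def)
      show "\<bar>h q x - h q z\<bar> < 1/64" if "x \<in> S" "z \<in> S" "dist x z < \<eta>'" for x z
        using e2(2)[OF that(1,2)] that(3) eta' by (simp add: dist_real_def)
      show "\<bar>h q x - h q z\<bar> < 1/8" if "x \<in> S" "z \<in> S" "dist x z < \<epsilon>" for x z
        using e0(2)[OF that(1,2)] that(3) e by (simp add: dist_real_def)
    next
      fix x assume x: "x \<in> A' 0 \<inter> {x\<in>S. dist (f x) y < \<eta>' \<and> \<bar>g' x - c\<bar> < \<eta>'}"
      then show "\<bar>g x + a * max (- 1) (min 1 (3 * cos (pi * g x / b) + 4 - 8 * h q x)) - c\<bar> < a / 8"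
        using eta' unfolding g'_def a_def by simp
      assume s: "real_of_int (2 * j) * b \<le> g x" "g x \<le> real_of_int (2 * j + 1) * b"
      have "g x \<in> strips b n (l y0)" using s j(3) by auto
      moreover have "dist (f x) y0 < \<rho> y0"
      proof -
        have "dist (f x) y < \<rho> y0 / 2" using x eta' r0(2)[OF y0(1)] by auto
        then show ?thesis using y0(2) dist_triangle[of "f x" y0 y] by (simp add: dist_commute)
      qed
      ultimately have "x \<in> R y0" using x unfolding R_def by blast
      then show "x \<in> \<Union>(\<P> y0 0)" using x y0(1) unfolding A'_def by auto
    qed
  qed
  have "stage S f k h N (Suc q) g' A' \<eta>'"
    unfolding stage_def using cont eta'(1) cov' sepr' sep0' by simp
  then show thesis by (rule that)
qed

lemma uniform_separation:
  fixes f :: "'a::metric_space \<Rightarrow> 'b::metric_space" and h :: "nat \<Rightarrow> 'a \<Rightarrow> real"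
  assumes S: "compact S" and f: "continuous_on S f"
    and dim: "\<And>y. y \<in> f ` S \<Longrightarrow> covering_dim_le (top_of_set {x\<in>S. f x = y}) k"
    and h: "\<And>m. m < N \<Longrightarrow> continuous_on S (h m)"
  obtains g A \<eta> where "continuous_on S g" "\<eta> > 0" "S \<subseteq> (\<Union>r\<le>k. A (r::nat))"
    "\<And>r m y c. r \<le> k \<Longrightarrow> m < N \<Longrightarrow> y \<in> f ` S \<Longrightarrow>
       separating S \<eta> (h m) (A r \<inter> {x\<in>S. dist (f x) y < \<eta> \<and> \<bar>g x - c\<bar> < \<eta>})"
proof -
  have "\<exists>g A \<eta>. stage S f k h N q g A \<eta>" if "q \<le> N" for q
    using that
  proof (induction q)
    case 0
    have "\<exists>d>0. \<forall>x\<in>S. \<forall>z\<in>S. h m x \<le> 0 \<longrightarrow> 1 \<le> h m z \<longrightarrow> d \<le> dist x z" if m: "m < N" for m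
    proof -
      obtain d where "d > 0" "\<And>x y. x \<in> S \<Longrightarrow> y \<in> S \<Longrightarrow> dist x y < d \<Longrightarrow> dist (h m x) (h m y) < 1"
        using uniform_modulus[OF S h[OF m], of 1] by auto
      then have "d \<le> dist x z" if "x \<in> S" "z \<in> S" "h m x \<le> 0" "1 \<le> h m z" for x z
        using that by (force simp: dist_real_def not_less[symmetric])
      then show ?thesis using \<open>d > 0\<close> by blast
    qed
    then obtain d where d: "\<And>m. m \<in> {..<N} \<Longrightarrow> d m > 0"
      "\<And>m x z. m < N \<Longrightarrow> x \<in> S \<Longrightarrow> z \<in> S \<Longrightarrow> h m x \<le> 0 \<Longrightarrow> 1 \<le> h m z \<Longrightarrow> d m \<le> dist x z"
      by simp metis
    obtain \<eta> where eta: "\<eta> > 0" "\<And>m. m \<in> {..<N} \<Longrightarrow> \<eta> \<le> d m"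
      using finite_positive_lower_bound[of "{..<N}" d, OF finite_lessThan d(1)] by blast
    \<comment> \<open>For the empty set, separation only says that the sets
      \<open>h m \<le> 0\<close> and \<open>h m \<ge> 1\<close> are \<eta> apart. The induction can
      therefore start with everything in colour 0.\<close>
    have "separating S \<eta> (h m) {}" if "m < N" for m
      unfolding separating_def
    proof (intro exI conjI ballI)
      show "{x\<in>S. h m x \<le> 0} \<subseteq> {x\<in>S. h m x \<le> 0}" "{x\<in>S. 1 \<le> h m x} \<subseteq> {x\<in>S. 1 \<le> h m x}" by auto
      show "\<eta> \<le> dist p q" if "p \<in> {x\<in>S. h m x \<le> 0}" "q \<in> {x\<in>S. 1 \<le> h m x}" for p q
        using d(2)[of m p q] eta(2)[of m] that \<open>m < N\<close> by auto
    qed auto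
    then have "stage S f k h N 0 (\<lambda>_. 0) (\<lambda>r. if r = 0 then S else {}) \<eta>"
      unfolding stage_def using eta by auto
    then show ?case by blast
  next
    case (Suc q)
    then obtain g A \<eta> where st: "stage S f k h N q g A \<eta>" by auto
    have "q < N" using Suc.prems by simp
    then obtain g' A' \<eta>' where "stage S f k h N (Suc q) g' A' \<eta>'"
      using stage_Suc[OF S f _ _ _ st] dim h by metis
    then show ?case by blast
  qed
  then obtain g A \<eta> where st: "stage S f k h N N g A \<eta>" by blast
  show thesis
  proof (rule that[of g \<eta> A])
    fix r m y c assume r: "r \<le> k" "m < N" "y \<in> f ` S"
    show "separating S \<eta> (h m) (A r \<inter> {x\<in>S. dist (f x) y < \<eta> \<and> \<bar>g x - c\<bar> < \<eta>})"
    proof (cases "r = 0")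
      case True
      then show ?thesis using st r unfolding stage_def by blast
    next
      case False
      then have "r \<in> {1..k}" using r(1) by simp
      then have "separating S \<eta> (h m) (A r \<inter> {x\<in>S. dist (f x) y < \<eta>})"
        using st r(2,3) unfolding stage_def by blast
      then show ?thesis by (rule separating_mono) auto
    qed
  qed (use st in \<open>auto simp: stage_def\<close>)
qed

section \<open>Splitting partitions of unity\<close>

definition partition_of_unity :: "'a::topological_space set \<Rightarrow> nat set \<Rightarrow> (nat \<Rightarrow> 'a \<Rightarrow> real) \<Rightarrow> bool" where
  "partition_of_unity S V \<phi> \<longleftrightarrow> finite V \<and>
     (\<forall>v\<in>V. continuous_on S (\<phi> v) \<and> (\<forall>x\<in>S. 0 \<le> \<phi> v x)) \<and> (\<forall>x\<in>S. (\<Sum>v\<in>V. \<phi> v x) = 1)"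

text \<open>This identity makes the simplicial map induced by \<pi> on the nerves commute with the
  canonical maps of the two partitions.\<close>

definition refines_partition ::
    "'a set \<Rightarrow> nat set \<Rightarrow> (nat \<Rightarrow> 'a \<Rightarrow> real) \<Rightarrow> (nat \<Rightarrow> nat) \<Rightarrow> nat set \<Rightarrow> (nat \<Rightarrow> 'a \<Rightarrow> real) \<Rightarrow> bool" where
  "refines_partition S V' \<phi>' \<pi> V \<phi> \<longleftrightarrow>
     \<pi> ` V' \<subseteq> V \<and> (\<forall>v\<in>V. \<forall>x\<in>S. (\<Sum>w\<in>{w\<in>V'. \<pi> w = v}. \<phi>' w x) = \<phi> v x)"

text \<open>These are the vertices of the smallest simplex of the nerve that contains the image of
  \<open>x\<close>.\<close>

definition active :: "nat set \<Rightarrow> (nat \<Rightarrow> 'a \<Rightarrow> real) \<Rightarrow> 'a \<Rightarrow> nat set" where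
  "active V \<phi> x = {v\<in>V. 0 < \<phi> v x}"

lemma refines_partition_trans:
  assumes "refines_partition S V2 \<phi>2 \<rho> V1 \<phi>1" "refines_partition S V1 \<phi>1 \<pi> V \<phi>" "finite V1" "finite V2"
  shows "refines_partition S V2 \<phi>2 (\<pi> \<circ> \<rho>) V \<phi>"
  unfolding refines_partition_def
proof (intro conjI ballI)
  show "(\<pi> \<circ> \<rho>) ` V2 \<subseteq> V" using assms(1,2) unfolding refines_partition_def by force
  fix v x assume vx: "v \<in> V" "x \<in> S"
  have "(\<Sum>w\<in>{w\<in>V2. (\<pi> \<circ> \<rho>) w = v}. \<phi>2 w x) =
      (\<Sum>u\<in>{u\<in>V1. \<pi> u = v}. \<Sum>w\<in>{w\<in>{w\<in>V2. (\<pi> \<circ> \<rho>) w = v}. \<rho> w = u}. \<phi>2 w x)"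
    by (rule sum.group[symmetric]) (use assms in \<open>auto simp: refines_partition_def\<close>)
  also have "\<dots> = (\<Sum>u\<in>{u\<in>V1. \<pi> u = v}. \<phi>1 u x)"
  proof (rule sum.cong)
    fix u assume u: "u \<in> {u\<in>V1. \<pi> u = v}"
    then have "{w\<in>{w\<in>V2. (\<pi> \<circ> \<rho>) w = v}. \<rho> w = u} = {w\<in>V2. \<rho> w = u}" by auto
    then show "(\<Sum>w\<in>{w\<in>{w\<in>V2. (\<pi> \<circ> \<rho>) w = v}. \<rho> w = u}. \<phi>2 w x) = \<phi>1 u x"
      using assms(1) u vx unfolding refines_partition_def by simp
  qed simp
  also have "\<dots> = \<phi> v x" using assms(2) vx unfolding refines_partition_def by simp
  finally show "(\<Sum>w\<in>{w\<in>V2. (\<pi> \<circ> \<rho>) w = v}. \<phi>2 w x) = \<phi> v x" .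
qed

text \<open>The factors \<open>\<theta> v i\<close> are asked to be continuous only after
  multiplication by \<open>\<phi> v\<close>, and to sum to 1 only where \<open>\<phi> v\<close> is
  positive; this admits indicator functions of separated parts of a support. Pairs are encoded as
  naturals so that vertices remain natural numbers.\<close>

lemma partition_of_unity_refine:
  fixes \<theta> :: "nat \<Rightarrow> 'i::countable \<Rightarrow> 'a::topological_space \<Rightarrow> real"
  assumes pou: "partition_of_unity S V \<phi>" and I: "finite I"
    and nonneg: "\<And>v i x. v \<in> V \<Longrightarrow> i \<in> I \<Longrightarrow> x \<in> S \<Longrightarrow> 0 \<le> \<theta> v i x"
    and cont: "\<And>v i. v \<in> V \<Longrightarrow> i \<in> I \<Longrightarrow> continuous_on S (\<lambda>x. \<phi> v x * \<theta> v i x)"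
    and one: "\<And>v x. v \<in> V \<Longrightarrow> x \<in> S \<Longrightarrow> 0 < \<phi> v x \<Longrightarrow> (\<Sum>i\<in>I. \<theta> v i x) = 1"
  obtains V' \<phi>' \<pi> where "partition_of_unity S V' \<phi>'" "refines_partition S V' \<phi>' \<pi> V \<phi>"
    "\<And>x. x \<in> S \<Longrightarrow> card (active V' \<phi>' x) = card {(v, i). v \<in> V \<and> i \<in> I \<and> 0 < \<phi> v x \<and> 0 < \<theta> v i x}"
    "\<And>w. w \<in> V' \<Longrightarrow> \<exists>v\<in>V. \<exists>i\<in>I. \<forall>x\<in>S. 0 < \<phi>' w x \<longrightarrow> 0 < \<phi> v x \<and> 0 < \<theta> v i x"
proof -
  define V' where "V' = (to_nat :: nat \<times> 'i \<Rightarrow> nat) ` (V \<times> I)"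
  define \<pi> where "\<pi> w = fst (from_nat w :: nat \<times> 'i)" for w
  define \<phi>' where "\<phi>' w x = \<phi> (\<pi> w) x * \<theta> (\<pi> w) (snd (from_nat w :: nat \<times> 'i)) x" for w x
  have V: "finite V" and cV: "\<And>v. v \<in> V \<Longrightarrow> continuous_on S (\<phi> v)"
    and nV: "\<And>v x. v \<in> V \<Longrightarrow> x \<in> S \<Longrightarrow> 0 \<le> \<phi> v x" and oV: "\<And>x. x \<in> S \<Longrightarrow> (\<Sum>v\<in>V. \<phi> v x) = 1"
    using pou unfolding partition_of_unity_def by auto
  have ref: "(\<Sum>w\<in>{w\<in>V'. \<pi> w = v}. \<phi>' w x) = \<phi> v x" if v: "v \<in> V" "x \<in> S" for v x
  proof -
    have eq: "{w\<in>V'. \<pi> w = v} = (\<lambda>i. to_nat (v, i)) ` I"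
      unfolding V'_def \<pi>_def using v by auto
    have "(\<Sum>w\<in>{w\<in>V'. \<pi> w = v}. \<phi>' w x) = (\<Sum>i\<in>I. \<phi> v x * \<theta> v i x)"
      unfolding eq by (subst sum.reindex) (auto simp: inj_on_def \<phi>'_def \<pi>_def)
    also have "\<dots> = \<phi> v x * (\<Sum>i\<in>I. \<theta> v i x)" by (simp add: sum_distrib_left)
    also have "\<dots> = \<phi> v x" using one[OF v] nV[OF v] by (cases "\<phi> v x = 0") auto
    finally show ?thesis .
  qed
  have sub: "\<pi> ` V' \<subseteq> V" unfolding V'_def \<pi>_def by auto
  have fin: "finite V'" unfolding V'_def using V I by simp
  show thesis
  proof (rule that[of V' \<phi>' \<pi>])
    show "refines_partition S V' \<phi>' \<pi> V \<phi>" unfolding refines_partition_def using sub ref by blast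
    have "(\<Sum>w\<in>V'. \<phi>' w x) = 1" if "x \<in> S" for x
    proof -
      have "(\<Sum>w\<in>V'. \<phi>' w x) = (\<Sum>v\<in>V. \<Sum>w\<in>{w\<in>V'. \<pi> w = v}. \<phi>' w x)"
        by (rule sum.group[symmetric]) (use fin V sub in auto)
      also have "\<dots> = (\<Sum>v\<in>V. \<phi> v x)" using ref that by (intro sum.cong) auto
      finally show ?thesis using oV that by simp
    qed
    moreover have "continuous_on S (\<phi>' w)" "\<forall>x\<in>S. 0 \<le> \<phi>' w x" if "w \<in> V'" for w
    proof -
      from that obtain v i where "v \<in> V" "i \<in> I" "w = to_nat (v, i)" unfolding V'_def by auto
      then show "continuous_on S (\<phi>' w)" "\<forall>x\<in>S. 0 \<le> \<phi>' w x"
        using cont nonneg nV unfolding \<phi>'_def[abs_def] \<pi>_def by (auto intro: mult_nonneg_nonneg)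
    qed
    ultimately show "partition_of_unity S V' \<phi>'" unfolding partition_of_unity_def using fin by blast
  next
    fix x assume x: "x \<in> S"
    have "active V' \<phi>' x = to_nat ` {(v, i). v \<in> V \<and> i \<in> I \<and> 0 < \<phi> v x \<and> 0 < \<theta> v i x}"
      unfolding active_def V'_def \<phi>'_def \<pi>_def
      using nV[OF _ x] nonneg[OF _ _ x] by (force simp: zero_less_mult_iff image_iff dest: leD)
    then show "card (active V' \<phi>' x) = card {(v, i). v \<in> V \<and> i \<in> I \<and> 0 < \<phi> v x \<and> 0 < \<theta> v i x}"
      by (simp add: card_image)
  next
    fix w assume "w \<in> V'"
    then obtain v i where vi: "v \<in> V" "i \<in> I" "w = to_nat (v, i)" unfolding V'_def by auto
    have "0 < \<phi> v x \<and> 0 < \<theta> v i x" if "x \<in> S" "0 < \<phi>' w x" for x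
      using that nV[OF vi(1) that(1)] nonneg[OF vi(1,2) that(1)] vi(3) unfolding \<phi>'_def \<pi>_def
      by (auto simp: zero_less_mult_iff)
    then show "\<exists>v\<in>V. \<exists>i\<in>I. \<forall>x\<in>S. 0 < \<phi>' w x \<longrightarrow> 0 < \<phi> v x \<and> 0 < \<theta> v i x"
      using vi by blast
  qed
qed

text \<open>All supports are cut along \<open>G\<close>, at places staggered from one support to the
  next: in units of \<tau>, the cuts of different functions are at different integers, and each
  transition happens within \<open>1/4\<close> of its cut. A point lies in at most one transition,
  so at most one active function is doubled there.\<close>

lemma partition_of_unity_split:
  fixes G :: "'a::metric_space \<Rightarrow> real"
  assumes pou: "partition_of_unity S V \<phi>" and S: "compact S" and G: "continuous_on S G" and d: "\<delta> > 0"
  obtains V' \<phi>' \<pi> where "partition_of_unity S V' \<phi>'" "refines_partition S V' \<phi>' \<pi> V \<phi>"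
    "\<And>x. x \<in> S \<Longrightarrow> card (active V' \<phi>' x) \<le> card (active V \<phi> x) + 1"
    "\<And>w. w \<in> V' \<Longrightarrow> \<exists>v\<in>V. \<forall>x\<in>S. 0 < \<phi>' w x \<longrightarrow> 0 < \<phi> v x"
    "\<And>w x z. w \<in> V' \<Longrightarrow> x \<in> S \<Longrightarrow> z \<in> S \<Longrightarrow> 0 < \<phi>' w x \<Longrightarrow> 0 < \<phi>' w z \<Longrightarrow> \<bar>G x - G z\<bar> < \<delta>"
proof -
  have V: "finite V" and cV: "\<And>v. v \<in> V \<Longrightarrow> continuous_on S (\<phi> v)"
    using pou unfolding partition_of_unity_def by auto
  define n where "n = card V + 1"
  obtain l where l: "inj_on l V" "\<And>v. v \<in> V \<Longrightarrow> l v < n"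
    by (rule finite_labels[OF V], rule that) (assumption, unfold n_def, blast)
  \<comment> \<open>In units of \<tau> the values of \<open>G\<close> on a piece spread over less
    than \<open>n + 1/2\<close>, which is below \<open>2 * n\<close> as
    \<open>n \<ge> 1\<close>.\<close>
  define \<tau> where "\<tau> = \<delta> / (2 * real n)"
  have n: "real n \<ge> 1" unfolding n_def by simp
  have tau: "\<tau> > 0" "\<tau> * (2 * real n) = \<delta>" using d n by (auto simp: \<tau>_def)
  define s where "s x = G x / \<tau>" for x
  have s: "continuous_on S s" unfolding s_def using G tau by (intro continuous_intros) auto
  have "bounded (s ` S)" using S s compact_continuous_image compact_imp_bounded by blast
  then obtain B where B: "\<And>x. x \<in> S \<Longrightarrow> \<bar>s x\<bar> \<le> B" unfolding bounded_iff by auto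
  \<comment> \<open>The margin 2 puts the first cut below and the last cut above the range of
    \<open>s\<close>, whatever the offset \<open>l v < n\<close>, so that the ramps telescope to
    1.\<close>
  obtain M where M: "B + 2 \<le> real M" using real_arch_simple by blast
  define p where "p v i = int n * (int i - int M) + int (l v)" for v i
  define ramp where "ramp u = max 0 (min 1 (2 * u + 1/2))" for u :: real
  define \<theta> where "\<theta> v i x = ramp (s x - p v i) - ramp (s x - p v (Suc i))" for v i x
  have p_Suc: "p v (Suc i) = p v i + int n" for v i by (simp add: p_def algebra_simps)
  have ramp_mono: "u \<le> u' \<Longrightarrow> ramp u \<le> ramp u'" for u u' unfolding ramp_def by auto
  have th_nonneg: "0 \<le> \<theta> v i x" for v i x
    unfolding \<theta>_def using ramp_mono[of "s x - p v (Suc i)" "s x - p v i"] by (simp add: p_Suc)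
  have th_pos: "p v i - 1/4 < s x" "s x < p v (Suc i) + 1/4" if t: "0 < \<theta> v i x" for v i x
  proof -
    show "p v i - 1/4 < s x"
    proof (rule ccontr)
      assume "\<not> ?thesis"
      then have "ramp (s x - p v i) = 0" unfolding ramp_def by auto
      then show False using t unfolding \<theta>_def ramp_def by auto
    qed
    show "s x < p v (Suc i) + 1/4"
    proof (rule ccontr)
      assume "\<not> ?thesis"
      then have "ramp (s x - p v (Suc i)) = 1" unfolding ramp_def by auto
      then show False using t unfolding \<theta>_def ramp_def by auto
    qed
  qed
  have th_sum: "(\<Sum>i<2*M. \<theta> v i x) = 1" if v: "v \<in> V" "x \<in> S" for v x
  proof -
    have "(\<Sum>i<2*M. \<theta> v i x) = ramp (s x - p v 0) - ramp (s x - p v (2*M))"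
      unfolding \<theta>_def by (rule sum_lessThan_telescope')
    moreover have "p v 0 + 1/4 \<le> s x"
    proof -
      define K where "K = real n * (real M - 1)"
      have "real_of_int (p v 0) \<le> - K - 1"
        using l(2)[OF v(1)] unfolding p_def K_def by (simp add: algebra_simps)
      moreover have "1 * (real M - 1) \<le> K" unfolding K_def
        using n M B[OF v(2)] by (intro mult_right_mono) auto
      moreover have "2 - real M \<le> s x" using M B[OF v(2)] by (simp add: abs_le_iff)
      ultimately show ?thesis by simp
    qed
    then have "ramp (s x - p v 0) = 1" unfolding ramp_def by auto
    moreover have "s x \<le> p v (2*M) - 1/4"
    proof -
      define K where "K = real n * real M"
      have "K \<le> real_of_int (p v (2*M))" unfolding p_def K_def by (simp add: algebra_simps)
      moreover have "1 * real M \<le> K" unfolding K_def using n by (intro mult_right_mono) auto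
      ultimately show ?thesis using M B[OF v(2)] by linarith
    qed
    then have "ramp (s x - p v (2*M)) = 0" unfolding ramp_def by auto
    ultimately show ?thesis by simp
  qed
  have cont: "continuous_on S (\<lambda>x. \<phi> v x * \<theta> v i x)" if "v \<in> V" for v i
    unfolding \<theta>_def ramp_def using cV[OF that] s by (intro continuous_intros)
  obtain V' \<phi>' \<pi> where R: "partition_of_unity S V' \<phi>'" "refines_partition S V' \<phi>' \<pi> V \<phi>"
    "\<And>x. x \<in> S \<Longrightarrow> card (active V' \<phi>' x) = card {(v, i). v \<in> V \<and> i \<in> {..<2*M} \<and> 0 < \<phi> v x \<and> 0 < \<theta> v i x}"
    "\<And>w. w \<in> V' \<Longrightarrow> \<exists>v\<in>V. \<exists>i\<in>{..<2*M}. \<forall>x\<in>S. 0 < \<phi>' w x \<longrightarrow> 0 < \<phi> v x \<and> 0 < \<theta> v i x"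
    using partition_of_unity_refine[OF pou, of "{..<2*M}" \<theta>] th_nonneg th_sum cont by auto
  have count: "card {(v, i). v \<in> V \<and> i \<in> {..<2*M} \<and> 0 < \<phi> v x \<and> 0 < \<theta> v i x} \<le> card (active V \<phi> x) + 1"
    (is "card ?Z \<le> _") if x: "x \<in> S" for x
  proof -
    \<comment> \<open>In \<open>Z1\<close>, where \<open>s x\<close> lies before the upper
      transition, each active \<open>v\<close> has at most one index. \<open>Z2\<close> collects the
      pairs whose upper transition is in progress. There is at most one: only one integer is that
      close to \<open>s x\<close>, and its residue modulo \<open>n\<close> determines
      \<open>v\<close>.\<close>
    define Z1 where "Z1 = {(v, i). (v, i) \<in> ?Z \<and> s x < p v (Suc i) - 1/4}"
    define Z2 where "Z2 = {(v, i). (v, i) \<in> ?Z \<and> p v (Suc i) - 1/4 \<le> s x}"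
    have "?Z \<subseteq> V \<times> {..<2*M}" by auto
    then have fin: "finite ?Z" using V by (meson finite_SigmaI finite_lessThan finite_subset)
    have "?Z = Z1 \<union> Z2" unfolding Z1_def Z2_def by auto
    then have "card ?Z \<le> card Z1 + card Z2" by (simp add: card_Un_le)
    moreover have "card Z1 \<le> card (active V \<phi> x)"
    proof (rule card_inj_on_le)
      show "inj_on fst Z1"
      proof (rule inj_onI)
        fix a c assume ac: "a \<in> Z1" "c \<in> Z1" "fst a = fst c"
        obtain v i i' where a: "a = (v, i)" "c = (v, i')" using ac(3) by (metis prod.collapse)
        have *: False if "i < i'" "s x < p v (Suc i) - 1/4" "p v i' - 1/4 < s x" for i i'
        proof -
          have "int n * (int i' - int i - 1) \<ge> 0" using that(1) by simp
          then have "p v (Suc i) \<le> p v i'" unfolding p_def by (simp add: algebra_simps)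
          then show False using that by linarith
        qed
        have "p v i - 1/4 < s x" "p v i' - 1/4 < s x" "s x < p v (Suc i) - 1/4" "s x < p v (Suc i') - 1/4"
          using ac(1,2) th_pos(1) unfolding a Z1_def by auto
        then have "i = i'" using *[of i i'] *[of i' i] by (meson linorder_neqE_nat)
        then show "a = c" using a by simp
      qed
      show "fst ` Z1 \<subseteq> active V \<phi> x" unfolding Z1_def active_def by auto
      show "finite (active V \<phi> x)" using V unfolding active_def by simp
    qed
    moreover have "card Z2 \<le> 1"
    proof -
      have "a = c" if ac: "a \<in> Z2" "c \<in> Z2" for a c
      proof -
        obtain v i v' i' where a: "a = (v, i)" "c = (v', i')" by (metis prod.collapse)
        have vv: "v \<in> V" "v' \<in> V" using ac unfolding a Z2_def by auto
        have "p v (Suc i) - 1/4 \<le> s x" "p v' (Suc i') - 1/4 \<le> s x"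
          "s x < p v (Suc i) + 1/4" "s x < p v' (Suc i') + 1/4"
          using ac th_pos(2) unfolding a Z2_def by auto
        then have "\<bar>real_of_int (p v (Suc i) - p v' (Suc i'))\<bar> < 1" by (simp add: abs_less_iff)
        then have eq: "p v (Suc i) = p v' (Suc i')" by linarith
        have "p v (Suc i) mod int n = int (l v)" "p v' (Suc i') mod int n = int (l v')"
          unfolding p_def using l(2) vv by simp_all
        then have "l v = l v'" using eq by simp
        then have "v = v'" using l(1) vv by (meson inj_onD)
        then have "i = i'" using eq n unfolding p_def by simp
        then show ?thesis using a \<open>v = v'\<close> by simp
      qed
      moreover have "finite Z2" using fin \<open>?Z = Z1 \<union> Z2\<close> by simp
      ultimately show ?thesis by (simp add: card_le_Suc0_iff_eq)
    qed
    ultimately show ?thesis by linarith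
  qed
  show thesis
  proof (rule that[OF R(1,2)])
    show "card (active V' \<phi>' x) \<le> card (active V \<phi> x) + 1" if "x \<in> S" for x
      using R(3)[OF that] count[OF that] by simp
    show "\<exists>v\<in>V. \<forall>x\<in>S. 0 < \<phi>' w x \<longrightarrow> 0 < \<phi> v x" if "w \<in> V'" for w
      using R(4)[OF that] by blast
    fix w x z assume w: "w \<in> V'" and xz: "x \<in> S" "z \<in> S" "0 < \<phi>' w x" "0 < \<phi>' w z"
    obtain v i where "0 < \<theta> v i x" "0 < \<theta> v i z" using R(4)[OF w] xz by blast
    then have "\<bar>s x - s z\<bar> < n + 1/2"
      using th_pos[of v i x] th_pos[of v i z] p_Suc[of v i] by linarith
    then have "\<tau> * \<bar>s x - s z\<bar> < \<tau> * (n + 1/2)" using tau by simp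
    moreover have "\<tau> * \<bar>s x - s z\<bar> = \<bar>G x - G z\<bar>"
      unfolding s_def using tau(1) by (simp add: abs_div_pos[symmetric] diff_divide_distrib[symmetric])
    moreover have "\<tau> * 1 \<le> \<tau> * n" using tau n by (intro mult_left_mono) auto
    moreover have "\<tau> * (n + 1/2) = \<tau> * n + \<tau>/2" "\<delta> = 2 * (\<tau> * n)"
      using tau by (simp_all add: algebra_simps)
    ultimately show "\<bar>G x - G z\<bar> < \<delta>" using tau(1) by linarith
  qed
qed

lemma partition_of_unity_split_many:
  fixes G :: "nat \<Rightarrow> 'a::metric_space \<Rightarrow> real"
  assumes pou: "partition_of_unity S V \<phi>" and S: "compact S" and d: "\<delta> > 0"
    and G: "\<And>a. a < m \<Longrightarrow> continuous_on S (G a)"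
  obtains V' \<phi>' \<pi> where "partition_of_unity S V' \<phi>'" "refines_partition S V' \<phi>' \<pi> V \<phi>"
    "\<And>x. x \<in> S \<Longrightarrow> card (active V' \<phi>' x) \<le> card (active V \<phi> x) + m"
    "\<And>w. w \<in> V' \<Longrightarrow> \<exists>v\<in>V. \<forall>x\<in>S. 0 < \<phi>' w x \<longrightarrow> 0 < \<phi> v x"
    "\<And>a w x z. a < m \<Longrightarrow> w \<in> V' \<Longrightarrow> x \<in> S \<Longrightarrow> z \<in> S \<Longrightarrow> 0 < \<phi>' w x \<Longrightarrow> 0 < \<phi>' w z \<Longrightarrow>
       \<bar>G a x - G a z\<bar> < \<delta>"
  using G
proof (induction m arbitrary: thesis)
  case 0
  have "refines_partition S V \<phi> id V \<phi>"
    unfolding refines_partition_def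
  proof (intro conjI ballI)
    fix v x assume "v \<in> V"
    then have "{w \<in> V. id w = v} = {v}" by auto
    then show "(\<Sum>w\<in>{w \<in> V. id w = v}. \<phi> w x) = \<phi> v x" by simp
  qed simp
  then show ?case by (rule 0(1)[OF pou]) auto
next
  case (Suc m)
  obtain V1 \<phi>1 \<pi>1 where 1: "partition_of_unity S V1 \<phi>1" "refines_partition S V1 \<phi>1 \<pi>1 V \<phi>"
    "\<And>x. x \<in> S \<Longrightarrow> card (active V1 \<phi>1 x) \<le> card (active V \<phi> x) + m"
    "\<And>w. w \<in> V1 \<Longrightarrow> \<exists>v\<in>V. \<forall>x\<in>S. 0 < \<phi>1 w x \<longrightarrow> 0 < \<phi> v x"
    "\<And>a w x z. a < m \<Longrightarrow> w \<in> V1 \<Longrightarrow> x \<in> S \<Longrightarrow> z \<in> S \<Longrightarrow> 0 < \<phi>1 w x \<Longrightarrow> 0 < \<phi>1 w z \<Longrightarrow>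
       \<bar>G a x - G a z\<bar> < \<delta>"
    by (rule Suc.IH) (use Suc.prems in auto)
  obtain V2 \<phi>2 \<pi>2 where 2: "partition_of_unity S V2 \<phi>2" "refines_partition S V2 \<phi>2 \<pi>2 V1 \<phi>1"
    "\<And>x. x \<in> S \<Longrightarrow> card (active V2 \<phi>2 x) \<le> card (active V1 \<phi>1 x) + 1"
    "\<And>w. w \<in> V2 \<Longrightarrow> \<exists>v\<in>V1. \<forall>x\<in>S. 0 < \<phi>2 w x \<longrightarrow> 0 < \<phi>1 v x"
    "\<And>w x z. w \<in> V2 \<Longrightarrow> x \<in> S \<Longrightarrow> z \<in> S \<Longrightarrow> 0 < \<phi>2 w x \<Longrightarrow> 0 < \<phi>2 w z \<Longrightarrow> \<bar>G m x - G m z\<bar> < \<delta>"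
    using partition_of_unity_split[OF 1(1) S _ d, of "G m"] Suc.prems(2) by (metis lessI)
  have fin: "finite V1" "finite V2" using 1(1) 2(1) unfolding partition_of_unity_def by auto
  show ?case
  proof (rule Suc.prems(1)[OF 2(1) refines_partition_trans[OF 2(2) 1(2) fin]])
    show "card (active V2 \<phi>2 x) \<le> card (active V \<phi> x) + Suc m" if "x \<in> S" for x
      using 1(3)[OF that] 2(3)[OF that] by linarith
    show "\<exists>v\<in>V. \<forall>x\<in>S. 0 < \<phi>2 w x \<longrightarrow> 0 < \<phi> v x" if "w \<in> V2" for w
    proof -
      obtain u where u: "u \<in> V1" "\<forall>x\<in>S. 0 < \<phi>2 w x \<longrightarrow> 0 < \<phi>1 u x" using 2(4) \<open>w \<in> V2\<close> by blast
      obtain v where "v \<in> V" "\<forall>x\<in>S. 0 < \<phi>1 u x \<longrightarrow> 0 < \<phi> v x" using 1(4) u by blast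
      then show ?thesis using u by blast
    qed
    fix a w x z assume a: "a < Suc m" and w: "w \<in> V2" "x \<in> S" "z \<in> S" "0 < \<phi>2 w x" "0 < \<phi>2 w z"
    show "\<bar>G a x - G a z\<bar> < \<delta>"
    proof (cases "a = m")
      case True
      then show ?thesis using 2(5) w by blast
    next
      case False
      obtain u where u: "u \<in> V1" "\<forall>x\<in>S. 0 < \<phi>2 w x \<longrightarrow> 0 < \<phi>1 u x" using 2(4) w(1) by blast
      have "a < m" using a False by simp
      then show ?thesis using 1(5)[of a u x z] u w by blast
    qed
  qed
qed

section \<open>From separated supports to supports inside members of the given cover\<close>

lemma infdist_less_imp_near:
  assumes "A \<noteq> {}" "infdist x A < e"
  obtains a where "a \<in> A" "dist x a < e"
  using assms unfolding infdist_notempty[OF assms(1)] by (auto simp: cINF_less_iff)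

text \<open>A colour weight is positive on a neighbourhood of its class, not only on the class.
  Thickening both sides by \<sigma> costs \<open>2 * \<sigma>\<close> of their distance.\<close>

lemma separating_thicken:
  assumes sep: "separating S \<eta> h \<Phi>" and "0 < \<sigma>" "\<eta>' + 2 * \<sigma> \<le> \<eta>"
    and near: "\<And>x. x \<in> \<Phi>' \<Longrightarrow> \<exists>a\<in>\<Phi>. dist x a < \<sigma>"
  shows "separating S \<eta>' h \<Phi>'"
proof -
  obtain P Q where PQ: "\<Phi> \<subseteq> P \<union> Q" "{x\<in>S. h x \<le> 0} \<subseteq> P" "{x\<in>S. 1 \<le> h x} \<subseteq> Q"
      and d: "\<And>p q. p \<in> P \<Longrightarrow> q \<in> Q \<Longrightarrow> \<eta> \<le> dist p q"
    using sep unfolding separating_def by blast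
  define thick where "thick R = {x. \<exists>p\<in>R. dist x p < \<sigma>}" for R :: "'a set"
  have thick: "R \<subseteq> thick R" for R unfolding thick_def using \<open>0 < \<sigma>\<close> by force
  have "\<eta>' \<le> dist x z" if xz: "x \<in> thick P" "z \<in> thick Q" for x z
  proof -
    obtain p q where pq: "p \<in> P" "q \<in> Q" "dist x p < \<sigma>" "dist z q < \<sigma>"
      using xz unfolding thick_def by blast
    have "dist p q \<le> dist x p + dist x z + dist z q"
      using dist_triangle[of p q x] dist_triangle[of x q z] by (simp add: dist_commute)
    then show ?thesis using d[OF pq(1,2)] pq(3,4) assms(3) by linarith
  qed
  moreover have "\<Phi>' \<subseteq> thick P \<union> thick Q"
    using near PQ(1) unfolding thick_def by blast
  ultimately show ?thesis
    unfolding separating_def using PQ(2,3) thick[of P] thick[of Q] by (meson subset_trans)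
qed

text \<open>Near a point where \<open>u\<close> is positive, \<open>sep\<close> makes membership in
  \<open>E\<close> constant; where \<open>u\<close> vanishes, the product is squeezed between 0 and
  \<open>u\<close>.\<close>

lemma continuous_on_cut_off:
  fixes u :: "'a::metric_space \<Rightarrow> real"
  assumes u: "continuous_on S u" and nonneg: "\<And>x. x \<in> S \<Longrightarrow> 0 \<le> u x" and "e > 0"
    and sep: "\<And>x z. x \<in> S \<Longrightarrow> z \<in> S \<Longrightarrow> 0 < u x \<Longrightarrow> 0 < u z \<Longrightarrow> dist x z < e \<Longrightarrow> x \<in> E \<Longrightarrow> z \<in> E"
  shows "continuous_on S (\<lambda>x. u x * (if x \<in> E then 1 else 0))"
  unfolding continuous_on_iff
proof (intro ballI allI impI)
  fix x and \<epsilon> :: real assume x: "x \<in> S" and "\<epsilon> > 0"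
  define w where "w x = u x * (if x \<in> E then 1 else 0)" for x
  have key: "\<exists>d>0. \<forall>z\<in>S. dist z x < d \<longrightarrow> dist (w z) (w x) < \<epsilon>"
  proof (cases "u x = 0")
    case True
    obtain d where "d > 0" "\<forall>z\<in>S. dist z x < d \<longrightarrow> dist (u z) (u x) < \<epsilon>"
      using u x \<open>\<epsilon> > 0\<close> unfolding continuous_on_iff by blast
    moreover have "dist (w z) (w x) \<le> dist (u z) (u x)" if "z \<in> S" for z
      using True unfolding w_def by (simp add: dist_real_def)
    ultimately show ?thesis using le_less_trans by meson
  next
    case False
    then have pos: "0 < u x" using nonneg[OF x] by simp
    obtain d where d: "d > 0" "\<And>z. z \<in> S \<Longrightarrow> dist z x < d \<Longrightarrow> dist (u z) (u x) < min \<epsilon> (u x)"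
      using u x \<open>\<epsilon> > 0\<close> pos unfolding continuous_on_iff by (metis min_less_iff_conj)
    have "dist (w z) (w x) < \<epsilon>" if z: "z \<in> S" "dist z x < min d e" for z
    proof -
      have dz: "dist (u z) (u x) < min \<epsilon> (u x)" using d(2) z by simp
      then have "0 < u z" by (simp add: dist_real_def abs_less_iff)
      then have "x \<in> E \<longleftrightarrow> z \<in> E"
        using sep[of x z] sep[of z x] x z pos by (auto simp: dist_commute)
      then show ?thesis using dz \<open>\<epsilon> > 0\<close> unfolding w_def by auto
    qed
    then show ?thesis using d(1) \<open>e > 0\<close> by (intro exI[of _ "min d e"]) auto
  qed
  then show "\<exists>d>0. \<forall>z\<in>S. dist z x < d \<longrightarrow>
      dist (u z * (if z \<in> E then 1 else 0)) (u x * (if x \<in> E then 1 else 0)) < \<epsilon>"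
    unfolding w_def .
qed

lemma fine_partition_of_unity:
  fixes T :: "'b::metric_space set"
  assumes T: "compact T" and cov: "T \<subseteq> \<Union>\<V>" "\<And>U. U \<in> \<V> \<Longrightarrow> open U" and e: "e > 0"
  obtains J \<xi> where "partition_of_unity T J \<xi>"
    "\<And>j. j \<in> J \<Longrightarrow> \<exists>U\<in>\<V>. \<forall>y\<in>T. 0 < \<xi> j y \<longrightarrow> y \<in> U"
    "\<And>j y z. j \<in> J \<Longrightarrow> y \<in> T \<Longrightarrow> z \<in> T \<Longrightarrow> 0 < \<xi> j y \<Longrightarrow> 0 < \<xi> j z \<Longrightarrow> dist y z < e"
proof -
  obtain \<delta>0 where d0: "\<delta>0 > 0" "\<And>y. y \<in> T \<Longrightarrow> \<exists>U\<in>\<V>. ball y \<delta>0 \<subseteq> U"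
    using Heine_Borel_lemma[OF T cov] by metis
  define \<delta> where "\<delta> = min \<delta>0 (e/2)"
  have d: "\<delta> > 0" "\<delta> \<le> \<delta>0" "2 * \<delta> \<le> e" using d0 e by (auto simp: \<delta>_def)
  have "T \<subseteq> (\<Union>y\<in>T. ball y \<delta>)" using d by auto
  then obtain C where C: "C \<subseteq> T" "finite C" "T \<subseteq> (\<Union>y\<in>C. ball y \<delta>)"
    using compactE_image[OF T, of T "\<lambda>y. ball y \<delta>"] by blast
  obtain c where c: "bij_betw c {0..<card C} C" using ex_bij_betw_nat_finite[OF C(2)] by blast
  define J where "J = {0..<card C}"
  have cJ: "c ` J = C" using c unfolding J_def bij_betw_def by blast
  define u where "u j y = max 0 (\<delta> - dist y (c j))" for j y
  define s where "s y = (\<Sum>j\<in>J. u j y)" for y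
  have spos: "0 < s y" if "y \<in> T" for y
  proof -
    obtain j where j: "j \<in> J" "y \<in> ball (c j) \<delta>" using C(3) cJ \<open>y \<in> T\<close> by blast
    then have "0 < u j y" unfolding u_def by (simp add: dist_commute)
    then show ?thesis unfolding s_def using j by (intro sum_pos2[of J j]) (auto simp: u_def J_def)
  qed
  have pos: "y \<in> ball (c j) \<delta>" if "y \<in> T" "0 < u j y / s y" for j y
    using that spos[of y] unfolding u_def by (auto simp: zero_less_divide_iff dist_commute split: if_splits)
  show thesis
  proof (rule that[of J "\<lambda>j y. u j y / s y"])
    have "continuous_on T (\<lambda>y. u j y / s y)" for j
      unfolding s_def u_def using spos unfolding s_def u_def
      by (intro continuous_intros ballI) (metis less_irrefl)
    moreover have "0 \<le> u j y / s y" if "y \<in> T" for j y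
      using spos[OF that] unfolding u_def by simp
    moreover have "(\<Sum>j\<in>J. u j y / s y) = 1" if "y \<in> T" for y
      using spos[OF that] unfolding sum_divide_distrib[symmetric] s_def by simp
    ultimately show "partition_of_unity T J (\<lambda>j y. u j y / s y)"
      unfolding partition_of_unity_def J_def by simp
  next
    fix j assume "j \<in> J"
    then have "c j \<in> T" using cJ C(1) by blast
    then obtain U where "U \<in> \<V>" "ball (c j) \<delta>0 \<subseteq> U" using d0(2) by blast
    moreover have "ball (c j) \<delta> \<subseteq> ball (c j) \<delta>0" using d(2) by auto
    ultimately show "\<exists>U\<in>\<V>. \<forall>y\<in>T. 0 < u j y / s y \<longrightarrow> y \<in> U" using pos by blast
  next
    fix j y z assume "j \<in> J" "y \<in> T" "z \<in> T" "0 < u j y / s y" "0 < u j z / s z"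
    then have "y \<in> ball (c j) \<delta>" "z \<in> ball (c j) \<delta>" using pos by blast+
    then show "dist y z < e" using dist_triangle[of y z "c j"] d(3) by (simp add: dist_commute)
  qed
qed

text \<open>Each support is divided according to the set of all \<open>m\<close> for which a point
  lies in \<open>P v m\<close>. Nearby points of a support agree on this code, so its parts are cut
  out continuously, and a point has only one code, so the number of active functions does not grow.
  If a part contains a point with \<open>h m \<le> 0\<close>, it lies in \<open>P v m\<close>, which
  is disjoint from \<open>Q v m\<close> and hence from \<open>h m \<ge> 1\<close>.\<close>

lemma ex_small_split:
  fixes \<phi> h :: "nat \<Rightarrow> 'a::metric_space \<Rightarrow> real"
  assumes pou: "partition_of_unity S V \<phi>" and e: "e > 0"
    and sep: "\<And>v m. v \<in> V \<Longrightarrow> m < N \<Longrightarrow> separating S e (h m) {x\<in>S. 0 < \<phi> v x}"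
    and h: "\<And>x. x \<in> S \<Longrightarrow> \<exists>m<N. h m x \<le> 0"
  obtains V' \<phi>' \<pi> where "partition_of_unity S V' \<phi>'" "refines_partition S V' \<phi>' \<pi> V \<phi>"
    "\<And>x. x \<in> S \<Longrightarrow> card (active V' \<phi>' x) \<le> card (active V \<phi> x)"
    "\<And>w. w \<in> V' \<Longrightarrow> (\<exists>m<N. \<forall>x\<in>S. 0 < \<phi>' w x \<longrightarrow> h m x < 1) \<or> (\<forall>x\<in>S. \<phi>' w x \<le> 0)"
proof -
  define Sp where "Sp v m P Q \<longleftrightarrow> {x\<in>S. 0 < \<phi> v x} \<subseteq> P \<union> Q \<and> {x\<in>S. h m x \<le> 0} \<subseteq> P \<and>
      {x\<in>S. 1 \<le> h m x} \<subseteq> Q \<and> (\<forall>p\<in>P. \<forall>q\<in>Q. e \<le> dist p q)" for v m P Q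
  have "\<exists>P Q. Sp v m P Q" if "v \<in> V" "m < N" for v m
    using sep[OF that] unfolding separating_def Sp_def .
  then obtain P Q where "\<And>v m. v \<in> V \<Longrightarrow> m < N \<Longrightarrow> Sp v m (P v m) (Q v m)"
    by metis
  then have PQ: "\<And>v m. v \<in> V \<Longrightarrow> m < N \<Longrightarrow> {x\<in>S. 0 < \<phi> v x} \<subseteq> P v m \<union> Q v m \<and>
      {x\<in>S. h m x \<le> 0} \<subseteq> P v m \<and> {x\<in>S. 1 \<le> h m x} \<subseteq> Q v m \<and> (\<forall>p\<in>P v m. \<forall>q\<in>Q v m. e \<le> dist p q)"
    unfolding Sp_def by blast
  define code where "code v x = {m\<in>{..<N}. x \<in> P v m}" for v x
  have same: "code v x = code v z" if v: "v \<in> V" and "x \<in> S" "z \<in> S" "0 < \<phi> v x" "0 < \<phi> v z" "dist x z < e" for v x z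
  proof -
    have *: "z \<in> P v m" if "m < N" "x \<in> P v m" "x \<in> S" "z \<in> S" "0 < \<phi> v z" "dist x z < e" for m x z
    proof (rule ccontr)
      assume "z \<notin> P v m"
      then have "z \<in> Q v m" using PQ[OF v, of m] that by blast
      then have "e \<le> dist x z" using PQ[OF v, of m] that by blast
      then show False using that by simp
    qed
    have "dist z x < e" using that by (simp add: dist_commute)
    then show ?thesis using that *[of _ x z] *[of _ z x] unfolding code_def by auto
  qed
  define I where "I = set_encode ` Pow {..<N}"
  define E where "E v i = {x. set_encode (code v x) = i}" for v i
  define \<theta> :: "nat \<Rightarrow> nat \<Rightarrow> 'a \<Rightarrow> real" where "\<theta> v i x = (if x \<in> E v i then 1 else 0)" for v i x
  have codeI: "set_encode (code v x) \<in> I" for v x unfolding I_def code_def by auto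
  have finI: "finite I" unfolding I_def by simp
  obtain V' \<phi>' \<pi> where R: "partition_of_unity S V' \<phi>'" "refines_partition S V' \<phi>' \<pi> V \<phi>"
    "\<And>x. x \<in> S \<Longrightarrow> card (active V' \<phi>' x) = card {(v, i). v \<in> V \<and> i \<in> I \<and> 0 < \<phi> v x \<and> 0 < \<theta> v i x}"
    "\<And>w. w \<in> V' \<Longrightarrow> \<exists>v\<in>V. \<exists>i\<in>I. \<forall>x\<in>S. 0 < \<phi>' w x \<longrightarrow> 0 < \<phi> v x \<and> 0 < \<theta> v i x"
  proof (rule partition_of_unity_refine[OF pou finI, of \<theta>])
    show "continuous_on S (\<lambda>x. \<phi> v x * \<theta> v i x)" if v: "v \<in> V" "i \<in> I" for v i
      unfolding \<theta>_def
    proof (rule continuous_on_cut_off[OF _ _ e])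
      show "continuous_on S (\<phi> v)" "\<And>x. x \<in> S \<Longrightarrow> 0 \<le> \<phi> v x"
        using pou v unfolding partition_of_unity_def by auto
      show "z \<in> E v i" if "x \<in> S" "z \<in> S" "0 < \<phi> v x" "0 < \<phi> v z" "dist x z < e" "x \<in> E v i" for x z
        using same[OF v(1), of x z] that unfolding E_def by simp
    qed
    show "(\<Sum>i\<in>I. \<theta> v i x) = 1" for v x
    proof -
      have "(\<Sum>i\<in>I. \<theta> v i x) = (\<Sum>i\<in>I. if i = set_encode (code v x) then 1 else 0)"
        unfolding \<theta>_def E_def by (intro sum.cong) auto
      then show ?thesis using codeI finI by simp
    qed
  qed (auto simp: \<theta>_def)
  show thesis
  proof (rule that[OF R(1,2)])
    fix x assume x: "x \<in> S"
    have "{(v, i). v \<in> V \<and> i \<in> I \<and> 0 < \<phi> v x \<and> 0 < \<theta> v i x} \<subseteq> (\<lambda>v. (v, set_encode (code v x))) ` active V \<phi> x"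
      unfolding active_def \<theta>_def E_def by (auto split: if_splits)
    moreover have "finite (active V \<phi> x)"
      using pou unfolding active_def partition_of_unity_def by simp
    ultimately show "card (active V' \<phi>' x) \<le> card (active V \<phi> x)"
      unfolding R(3)[OF x] by (meson card_image_le card_mono finite_imageI order_trans)
  next
    fix w assume w: "w \<in> V'"
    obtain v i where vi: "v \<in> V" "i \<in> I" "\<And>x. x \<in> S \<Longrightarrow> 0 < \<phi>' w x \<Longrightarrow> 0 < \<phi> v x \<and> 0 < \<theta> v i x"
      using R(4)[OF w] by blast
    show "(\<exists>m<N. \<forall>x\<in>S. 0 < \<phi>' w x \<longrightarrow> h m x < 1) \<or> (\<forall>x\<in>S. \<phi>' w x \<le> 0)"
    proof (cases "\<exists>x\<in>S. 0 < \<phi>' w x")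
      case True
      then obtain x where x: "x \<in> S" "0 < \<phi>' w x" by blast
      obtain m where m: "m < N" "h m x \<le> 0" using h[OF x(1)] by blast
      then have "x \<in> P v m" using PQ[OF vi(1), of m] x by auto
      then have mx: "m \<in> code v x" using m unfolding code_def by simp
      have "h m z < 1" if z: "z \<in> S" "0 < \<phi>' w z" for z
      proof (rule ccontr)
        assume "\<not> ?thesis"
        then have zQ: "z \<in> Q v m" using PQ[OF vi(1), of m] m z by auto
        have "set_encode (code v x) = set_encode (code v z)"
          using vi(3)[OF x] vi(3)[OF z] unfolding \<theta>_def E_def by (auto split: if_splits)
        moreover have "finite (code v x)" "finite (code v z)" unfolding code_def by auto
        ultimately have "code v x = code v z" using set_encode_eq by blast
        then have "z \<in> P v m" using mx unfolding code_def by auto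
        then have "e \<le> dist z z" using PQ[OF vi(1), of m] m zQ by blast
        then show False using e by simp
      qed
      then show ?thesis using m by blast
    qed (auto simp: not_less)
  qed
qed

text \<open>The partition of unity obtained from \<open>g\<close> and the colour functions makes \<open>g\<close> and
  \<open>f\<close> nearly constant and one colour function positive on each support, so that each support
  splits into small pieces which are uniformly apart.\<close>

lemma partitions_of_unity_over_map:
  fixes f :: "'a::metric_space \<Rightarrow> 'b::metric_space"
  assumes S: "compact S" and T: "compact T" and f: "continuous_on S f" and fST: "f ` S \<subseteq> T"
    and dim: "\<And>y. y \<in> f ` S \<Longrightarrow> covering_dim_le (top_of_set {x\<in>S. f x = y}) k"
    and covS: "S \<subseteq> \<Union>\<U>" "\<And>U. U \<in> \<U> \<Longrightarrow> open U"
    and covT: "T \<subseteq> \<Union>\<V>" "\<And>U. U \<in> \<V> \<Longrightarrow> open U"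
  obtains V \<phi> \<pi> J \<xi> where "partition_of_unity T J \<xi>" "partition_of_unity S V \<phi>"
    "refines_partition S V \<phi> \<pi> J (\<lambda>j x. \<xi> j (f x))"
    "\<And>v. v \<in> V \<Longrightarrow> \<exists>x\<in>S. 0 < \<phi> v x \<Longrightarrow> \<exists>U\<in>\<U>. \<forall>x\<in>S. 0 < \<phi> v x \<longrightarrow> x \<in> U"
    "\<And>j. j \<in> J \<Longrightarrow> \<exists>U\<in>\<V>. \<forall>y\<in>T. 0 < \<xi> j y \<longrightarrow> y \<in> U"
    "\<And>x. x \<in> S \<Longrightarrow> card (active V \<phi> x) \<le> card (active J \<xi> (f x)) + (k + 1)"
proof -
  obtain \<delta> where d: "\<delta> > 0" "\<And>x. x \<in> S \<Longrightarrow> \<exists>U\<in>\<U>. ball x \<delta> \<subseteq> U"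
    using Heine_Borel_lemma[OF S covS] by metis
  have "S \<subseteq> (\<Union>x\<in>S. ball x (\<delta>/2))" using d(1) by auto
  then obtain C where C: "C \<subseteq> S" "finite C" "S \<subseteq> (\<Union>x\<in>C. ball x (\<delta>/2))"
    using compactE_image[OF S, of S "\<lambda>x. ball x (\<delta>/2)"] by blast
  define N where "N = card C"
  obtain c where "bij_betw c {0..<N} C" using ex_bij_betw_nat_finite[OF C(2)] unfolding N_def by blast
  then have cN: "c ` {0..<N} = C" unfolding bij_betw_def by blast
  \<comment> \<open>Scaled so that \<open>h m \<le> 0\<close> on the ball of radius
    \<open>\<delta>/2\<close> about \<open>c m\<close>, these balls covering \<open>S\<close>, and
    \<open>h m < 1\<close> exactly on the ball of radius \<delta>, which lies in a member of
    \<open>\<U>\<close>.\<close>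
  define h where "h m x = 2 * dist x (c m) / \<delta> - 1" for m x
  have h: "continuous_on S (h m)" for m unfolding h_def using d by (intro continuous_intros) auto
  have h0: "\<exists>m<N. h m x \<le> 0" if "x \<in> S" for x
  proof -
    obtain y where "y \<in> C" "x \<in> ball y (\<delta>/2)" using C(3) \<open>x \<in> S\<close> by blast
    then obtain m where "m < N" "x \<in> ball (c m) (\<delta>/2)" using cN by auto
    moreover from this have "h m x \<le> 0" unfolding h_def using d(1) by (simp add: dist_commute field_simps)
    ultimately show ?thesis by blast
  qed
  have h1: "\<exists>U\<in>\<U>. \<forall>x. h m x < 1 \<longrightarrow> x \<in> U" if "m < N" for m
  proof -
    have "c m \<in> S" using cN C(1) \<open>m < N\<close> by auto
    then obtain U where U: "U \<in> \<U>" "ball (c m) \<delta> \<subseteq> U" using d(2) by blast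
    have "x \<in> ball (c m) \<delta>" if "h m x < 1" for x
      using that d(1) unfolding h_def by (simp add: dist_commute field_simps)
    then show ?thesis using U by blast
  qed
  obtain g A \<eta> where g: "continuous_on S g" and eta: "\<eta> > 0" and cov: "S \<subseteq> (\<Union>r\<le>k. A (r::nat))"
    and sep: "\<And>r m y c. r \<le> k \<Longrightarrow> m < N \<Longrightarrow> y \<in> f ` S \<Longrightarrow>
       separating S \<eta> (h m) (A r \<inter> {x\<in>S. dist (f x) y < \<eta> \<and> \<bar>g x - c\<bar> < \<eta>})"
  proof (rule uniform_separation[where S = S and f = f and k = k and h = h and N = N])
    show "compact S" "continuous_on S f" by fact+
    show "covering_dim_le (top_of_set {x \<in> S. f x = y}) k" if "y \<in> f ` S" for y by (rule dim[OF that])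
    show "continuous_on S (h m)" for m by (rule h)
  qed (rule that)
  obtain \<sigma>1 where s1: "\<sigma>1 > 0" "\<And>x y. x \<in> S \<Longrightarrow> y \<in> S \<Longrightarrow> dist x y < \<sigma>1 \<Longrightarrow> dist (f x) (f y) < \<eta>/2"
    using uniform_modulus[OF S f, of "\<eta>/2"] eta by auto
  obtain \<sigma>2 where s2: "\<sigma>2 > 0" "\<And>x y. x \<in> S \<Longrightarrow> y \<in> S \<Longrightarrow> dist x y < \<sigma>2 \<Longrightarrow> dist (g x) (g y) < \<eta>/2"
    using uniform_modulus[OF S g, of "\<eta>/2"] eta by auto
  define \<sigma> where "\<sigma> = min (\<eta>/3) (min \<sigma>1 \<sigma>2)"
  have sig: "\<sigma> > 0" "\<sigma> \<le> \<eta>/3" "\<sigma> \<le> \<sigma>1" "\<sigma> \<le> \<sigma>2" using s1 s2 eta by (auto simp: \<sigma>_def)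
  have thick: "separating S (\<eta>/3) (h m) {x\<in>S. (\<exists>a\<in>A r \<inter> S. dist x a < \<sigma>) \<and> dist (f x) y < \<eta>/2 \<and> \<bar>g x - c\<bar> < \<eta>/2}"
    if r: "r \<le> k" "m < N" "y \<in> f ` S" for r m y c
  proof (rule separating_thicken[OF sep[OF r, of c] sig(1)])
    show "\<eta>/3 + 2 * \<sigma> \<le> \<eta>" using sig by linarith
    fix x assume "x \<in> {x\<in>S. (\<exists>a\<in>A r \<inter> S. dist x a < \<sigma>) \<and> dist (f x) y < \<eta>/2 \<and> \<bar>g x - c\<bar> < \<eta>/2}"
    then obtain a where a: "x \<in> S" "a \<in> A r" "a \<in> S" "dist x a < \<sigma>" "dist (f x) y < \<eta>/2" "\<bar>g x - c\<bar> < \<eta>/2"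
      by blast
    have "dist (f x) (f a) < \<eta>/2" using s1(2)[OF a(1,3)] a(4) sig by linarith
    then have fa: "dist (f a) y < \<eta>"
      using a(5) dist_triangle[of "f a" y "f x"] by (simp add: dist_commute)
    have "dist (g x) (g a) < \<eta>/2" using s2(2)[OF a(1,3)] a(4) sig by linarith
    then have "\<bar>g a - c\<bar> < \<eta>" using a(6) unfolding dist_real_def by linarith
    then show "\<exists>a\<in>A r \<inter> {x\<in>S. dist (f x) y < \<eta> \<and> \<bar>g x - c\<bar> < \<eta>}. dist x a < \<sigma>"
      using a fa by blast
  qed
  \<comment> \<open>A colour class may be empty; the conventional distance 0 to the empty set would
    then give it the full weight \<sigma> everywhere.\<close>
  define u where "u r x = (if A r \<inter> S = {} then 0 else max 0 (\<sigma> - infdist x (A r \<inter> S)))" for r x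
  define s where "s x = (\<Sum>r\<le>k. u r x)" for x
  define l where "l r x = u r x / s x" for r x
  have u_nonneg: "0 \<le> u r x" for r x unfolding u_def by simp
  have spos: "0 < s x" if x: "x \<in> S" for x
  proof -
    obtain r where r: "r \<le> k" "x \<in> A r \<inter> S" using cov x by blast
    then have "0 < u r x" unfolding u_def using sig by auto
    then show ?thesis unfolding s_def using r u_nonneg by (intro sum_pos2[of "{..k}" r]) auto
  qed
  have ucont: "continuous_on S (u r)" for r
    unfolding u_def by (cases "A r \<inter> S = {}") (auto intro!: continuous_intros)
  have lcont: "continuous_on S (l r)" for r
    unfolding l_def s_def
  proof (intro continuous_intros ucont ballI)
    show "(\<Sum>r\<le>k. u r x) \<noteq> 0" if "x \<in> S" for x using spos[OF that] unfolding s_def by simp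
  qed
  have lsum: "(\<Sum>r\<le>k. l r x) = 1" if "x \<in> S" for x
    using spos[OF that] unfolding l_def sum_divide_distrib[symmetric] s_def by simp
  have lpos: "\<exists>a\<in>A r \<inter> S. dist x a < \<sigma>" if x: "x \<in> S" "0 < l r x" for r x
  proof -
    have "0 < u r x" using x spos[OF x(1)] unfolding l_def by (simp add: zero_less_divide_iff)
    then have "A r \<inter> S \<noteq> {}" "infdist x (A r \<inter> S) < \<sigma>" unfolding u_def by (auto split: if_splits)
    then show ?thesis using infdist_less_imp_near by metis
  qed
  obtain J \<xi> where J: "partition_of_unity T J \<xi>"
    "\<And>j. j \<in> J \<Longrightarrow> \<exists>U\<in>\<V>. \<forall>y\<in>T. 0 < \<xi> j y \<longrightarrow> y \<in> U"
    "\<And>j y z. j \<in> J \<Longrightarrow> y \<in> T \<Longrightarrow> z \<in> T \<Longrightarrow> 0 < \<xi> j y \<Longrightarrow> 0 < \<xi> j z \<Longrightarrow> dist y z < \<eta>/2"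
    by (rule fine_partition_of_unity[OF T covT half_gt_zero[OF eta]]) (assumption, rule that)
  have pJ: "partition_of_unity S J (\<lambda>j x. \<xi> j (f x))"
    using J(1) fST unfolding partition_of_unity_def
    by (auto intro!: continuous_on_compose2[OF _ f, of T])
  \<comment> \<open>Index 0 is taken by \<open>g\<close> in place of \<open>l 0\<close>. The
    oscillation of \<open>l 0\<close> is controlled by the other weights because all of them sum to
    1, which keeps the number of splittings at \<open>k + 1\<close>.\<close>
  define G where "G a = (if a = 0 then g else l a)" for a
  \<comment> \<open>At a given point some weight is at least \<open>1 / (k + 1)\<close>. With
    oscillations below \<open>1 / (k + 1)^2\<close> for the weights \<open>1, ..., k\<close>, none
    of these can drop from there to 0, and neither can weight 0, which falls by at most
    \<open>k / (k + 1)^2\<close>.\<close>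
  define \<delta>' where "\<delta>' = min (\<eta>/2) (1 / (real k + 1)^2)"
  have d': "\<delta>' > 0" "\<delta>' \<le> \<eta>/2" "\<delta>' \<le> 1 / (real k + 1)^2" using eta by (auto simp: \<delta>'_def)
  have Gc: "continuous_on S (G a)" for a unfolding G_def using g lcont by simp
  obtain V1 \<phi>1 \<pi>1 where V1: "partition_of_unity S V1 \<phi>1" "refines_partition S V1 \<phi>1 \<pi>1 J (\<lambda>j x. \<xi> j (f x))"
    "\<And>x. x \<in> S \<Longrightarrow> card (active V1 \<phi>1 x) \<le> card (active J (\<lambda>j x. \<xi> j (f x)) x) + (k + 1)"
    "\<And>w. w \<in> V1 \<Longrightarrow> \<exists>v\<in>J. \<forall>x\<in>S. 0 < \<phi>1 w x \<longrightarrow> 0 < \<xi> v (f x)"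
    "\<And>a w x z. a < k + 1 \<Longrightarrow> w \<in> V1 \<Longrightarrow> x \<in> S \<Longrightarrow> z \<in> S \<Longrightarrow> 0 < \<phi>1 w x \<Longrightarrow> 0 < \<phi>1 w z \<Longrightarrow>
       \<bar>G a x - G a z\<bar> < \<delta>'"
    by (rule partition_of_unity_split_many[where m = "k + 1" and G = G, OF pJ S d'(1)]) (rule Gc, rule that)
  have sepV: "separating S (\<eta>/3) (h m) {x\<in>S. 0 < \<phi>1 v x}" if v: "v \<in> V1" "m < N" for v m
  proof (cases "\<exists>x\<in>S. 0 < \<phi>1 v x")
    case True
    then obtain x0 where x0: "x0 \<in> S" "0 < \<phi>1 v x0" by blast
    have osc: "\<bar>l a x - l a x0\<bar> < 1 / (real k + 1)^2" if "a \<in> {1..k}" "x \<in> S" "0 < \<phi>1 v x" for a x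
      using V1(5)[of a v x x0] that x0 v d'(3) unfolding G_def by auto
    obtain r where r: "r \<le> k" "1 / (real k + 1) \<le> l r x0"
    proof (rule ccontr)
      assume "\<not> thesis"
      then have "l r x0 < 1 / (real k + 1)" if "r \<in> {..k}" for r using that \<open>\<And>r. r \<le> k \<Longrightarrow> 1 / (real k + 1) \<le> l r x0 \<Longrightarrow> thesis\<close> by (meson atMost_iff not_less)
      then have "(\<Sum>r\<le>k. l r x0) < (\<Sum>r\<le>k. 1 / (real k + 1))" by (intro sum_strict_mono) auto
      then show False using lsum[OF x0(1)] by simp
    qed
    have k1: "1 / (real k + 1)^2 \<le> 1 / (real k + 1)" "k * (1 / (real k + 1)^2) < 1 / (real k + 1)"
      by (simp_all add: power2_eq_square divide_simps)
    have "0 < l r x" if x: "x \<in> S" "0 < \<phi>1 v x" for x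
    proof (cases "r = 0")
      case True
      have split: "l 0 z = 1 - (\<Sum>a\<in>{1..k}. l a z)" if "z \<in> S" for z
      proof -
        have "{..k} = insert 0 {1..k}" by auto
        then show ?thesis using lsum[OF that] by simp
      qed
      have "l 0 x0 - l 0 x = (\<Sum>a\<in>{1..k}. l a x - l a x0)"
        unfolding split[OF x(1)] split[OF x0(1)] by (simp add: sum_subtractf)
      also have "\<dots> \<le> (\<Sum>a\<in>{1..k}. 1 / (real k + 1)^2)"
        by (intro sum_mono) (use osc x in \<open>fastforce simp: abs_less_iff\<close>)
      also have "\<dots> < 1 / (real k + 1)" using k1(2) by simp
      finally show ?thesis using r(2) True by simp
    next
      case False
      then have "\<bar>l r x - l r x0\<bar> < 1 / (real k + 1)^2" using osc[of r x] r(1) x by simp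
      then show ?thesis using r(2) k1(1) by linarith
    qed
    then have near: "\<exists>a\<in>A r \<inter> S. dist x a < \<sigma>" if "x \<in> S" "0 < \<phi>1 v x" for x
      using lpos that by blast
    obtain j where j: "j \<in> J" "\<And>x. x \<in> S \<Longrightarrow> 0 < \<phi>1 v x \<Longrightarrow> 0 < \<xi> j (f x)" using V1(4)[OF v(1)] by blast
    show ?thesis
    proof (rule separating_mono[OF thick[OF r(1) v(2), of "f x0" "g x0"]])
      show "f x0 \<in> f ` S" using x0 by blast
      show "{x\<in>S. 0 < \<phi>1 v x} \<subseteq> {x\<in>S. (\<exists>a\<in>A r \<inter> S. dist x a < \<sigma>) \<and>
          dist (f x) (f x0) < \<eta>/2 \<and> \<bar>g x - g x0\<bar> < \<eta>/2}"
      proof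
        fix x assume "x \<in> {x\<in>S. 0 < \<phi>1 v x}"
        then have x: "x \<in> S" "0 < \<phi>1 v x" by auto
        have "dist (f x) (f x0) < \<eta>/2" using J(3)[OF j(1)] j(2) x x0 fST by blast
        moreover have "\<bar>g x - g x0\<bar> < \<eta>/2" using V1(5)[of 0 v x x0] v x x0 d'(2) unfolding G_def by auto
        ultimately show "x \<in> {x\<in>S. (\<exists>a\<in>A r \<inter> S. dist x a < \<sigma>) \<and>
          dist (f x) (f x0) < \<eta>/2 \<and> \<bar>g x - g x0\<bar> < \<eta>/2}" using near x by blast
      qed
    qed simp
  next
    case False
    \<comment> \<open>What remains for an empty support is that \<open>h m \<le> 0\<close> and
      \<open>h m \<ge> 1\<close> are apart, and any instance of \<open>thick\<close> contains
      this.\<close>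
    then have e: "{x\<in>S. 0 < \<phi>1 v x} = {}" by blast
    show ?thesis
    proof (cases "S = {}")
      case True
      then show ?thesis unfolding separating_def by auto
    next
      case False
      then obtain y where "y \<in> f ` S" by blast
      then show ?thesis unfolding e by (intro separating_mono[OF thick[OF le0 v(2), of y 0]]) auto
    qed
  qed
  obtain V2 \<phi>2 \<pi>2 where V2: "partition_of_unity S V2 \<phi>2" "refines_partition S V2 \<phi>2 \<pi>2 V1 \<phi>1"
    "\<And>x. x \<in> S \<Longrightarrow> card (active V2 \<phi>2 x) \<le> card (active V1 \<phi>1 x)"
    "\<And>w. w \<in> V2 \<Longrightarrow> (\<exists>m<N. \<forall>x\<in>S. 0 < \<phi>2 w x \<longrightarrow> h m x < 1) \<or> (\<forall>x\<in>S. \<phi>2 w x \<le> 0)"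
  proof (rule ex_small_split[where N = N and h = h, OF V1(1)])
    show "0 < \<eta>/3" using eta by simp
    show "separating S (\<eta>/3) (h m) {x\<in>S. 0 < \<phi>1 v x}" if "v \<in> V1" "m < N" for v m by (rule sepV[OF that])
    show "\<exists>m<N. h m x \<le> 0" if "x \<in> S" for x by (rule h0[OF that])
  qed (rule that)
  have fin: "finite V1" "finite V2" using V1(1) V2(1) unfolding partition_of_unity_def by auto
  show thesis
  proof (rule that[OF J(1) V2(1) refines_partition_trans[OF V2(2) V1(2) fin] _ J(2)])
    show "card (active V2 \<phi>2 x) \<le> card (active J \<xi> (f x)) + (k + 1)" if "x \<in> S" for x
      using V2(3)[OF that] V1(3)[OF that] unfolding active_def by simp
    show "\<exists>U\<in>\<U>. \<forall>x\<in>S. 0 < \<phi>2 v x \<longrightarrow> x \<in> U" if v: "v \<in> V2" "\<exists>x\<in>S. 0 < \<phi>2 v x" for v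
    proof -
      obtain m where "m < N" "\<forall>x\<in>S. 0 < \<phi>2 v x \<longrightarrow> h m x < 1" using V2(4)[OF v(1)] v(2) by force
      then show ?thesis using h1[of m] by blast
    qed
  qed
qed

section \<open>Covering dimension of the fibres of a simplicial map\<close>

text \<open>Finitely many closed sets in a compact space swell to open sets without raising the
  order of the cover. Closed covers are what cutting into cells produces.\<close>

lemma covering_dim_le_closed_covers:
  fixes \<Phi> :: "'a::metric_space set"
  assumes \<Phi>: "compact \<Phi>"
    and cov: "\<And>\<U>. \<Phi> \<subseteq> \<Union>\<U> \<Longrightarrow> (\<And>U. U \<in> \<U> \<Longrightarrow> open U) \<Longrightarrow>
      \<exists>\<C>. finite \<C> \<and> \<Phi> \<subseteq> \<Union>\<C> \<and> (\<forall>C\<in>\<C>. closed C \<and> (\<exists>U\<in>\<U>. C \<subseteq> U)) \<and>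
        (\<forall>x\<in>\<Phi>. card {C\<in>\<C>. x \<in> C} \<le> n + 1)"
  shows "covering_dim_le (top_of_set \<Phi>) n"
  unfolding covering_dim_le_def
proof (intro allI impI)
  fix \<W> assume W: "finite \<W> \<and> open_cover (top_of_set \<Phi>) \<W>"
  define \<U> where "\<U> = {U. open U \<and> \<Phi> \<inter> U \<in> \<W>}"
  have "\<Phi> \<subseteq> \<Union>\<U>"
  proof
    fix x assume "x \<in> \<Phi>"
    then obtain w where w: "w \<in> \<W>" "x \<in> w" using W unfolding open_cover_def by auto
    then obtain U where "open U" "w = \<Phi> \<inter> U" using W unfolding open_cover_def openin_open by blast
    then show "x \<in> \<Union>\<U>" using w unfolding \<U>_def by auto
  qed
  moreover have "open U" if "U \<in> \<U>" for U using that unfolding \<U>_def by blast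
  ultimately have "\<exists>\<C>. finite \<C> \<and> \<Phi> \<subseteq> \<Union>\<C> \<and> (\<forall>C\<in>\<C>. closed C \<and> (\<exists>U\<in>\<U>. C \<subseteq> U)) \<and>
        (\<forall>x\<in>\<Phi>. card {C\<in>\<C>. x \<in> C} \<le> n + 1)"
    by (rule cov)
  then obtain \<C>0 where C0: "finite \<C>0" "\<Phi> \<subseteq> \<Union>\<C>0" "\<forall>C\<in>\<C>0. closed C \<and> (\<exists>U\<in>\<U>. C \<subseteq> U)"
      "\<forall>x\<in>\<Phi>. card {C\<in>\<C>0. x \<in> C} \<le> n + 1"
    by (elim exE conjE)
  \<comment> \<open>An empty member has distance 0 to every point by convention and would swell to
    everything.\<close>
  define \<C> where "\<C> = \<C>0 - {{}}"
  have C: "finite \<C>" "\<Phi> \<subseteq> \<Union>\<C>" "\<And>C. C \<in> \<C> \<Longrightarrow> closed C \<and> C \<noteq> {}"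
    using C0 unfolding \<C>_def by auto
  have "\<forall>C\<in>\<C>. \<exists>U. U \<in> \<U> \<and> C \<subseteq> U" using C0(3) unfolding \<C>_def by blast
  then obtain U where U: "\<And>C. C \<in> \<C> \<Longrightarrow> U C \<in> \<U> \<and> C \<subseteq> U C" by metis
  \<comment> \<open>Only sets containing \<open>x\<close> come close to points near
    \<open>x\<close>: a third of the least distance from \<open>x\<close> to the sets missing it
    serves as \<open>r\<close>.\<close>
  have "\<exists>r>0. \<forall>z\<in>ball x (2 * r). \<forall>C\<in>\<C>. infdist z C < r \<longrightarrow> x \<in> C" for x
  proof -
    have pos: "0 < infdist x C" if "C \<in> {C\<in>\<C>. x \<notin> C}" for C
      using that C(3) infdist_pos_not_in_closed by blast
    have "finite {C\<in>\<C>. x \<notin> C}" using C(1) by simp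
    then obtain m where m: "m > 0" "\<And>C. C \<in> {C\<in>\<C>. x \<notin> C} \<Longrightarrow> m \<le> infdist x C"
      by (rule finite_positive_lower_bound[OF _ pos]) (assumption, rule that)
    have "x \<in> C" if "z \<in> ball x (2 * (m/3))" "C \<in> \<C>" "infdist z C < m/3" for z C
    proof (rule ccontr)
      assume "x \<notin> C"
      then have "m \<le> infdist x C" using m that by blast
      then show False using that infdist_triangle[of x C z] by auto
    qed
    then show ?thesis using m(1) by (intro exI[of _ "m/3"]) auto
  qed
  then obtain r where r: "\<And>x. r x > 0" "\<And>x z C. z \<in> ball x (2 * r x) \<Longrightarrow> C \<in> \<C> \<Longrightarrow> infdist z C < r x \<Longrightarrow> x \<in> C"
    by metis
  have "\<Phi> \<subseteq> (\<Union>x\<in>\<Phi>. ball x (r x))" using r(1) by auto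
  then obtain X where X: "X \<subseteq> \<Phi>" "finite X" "\<Phi> \<subseteq> (\<Union>x\<in>X. ball x (r x))"
    using compactE_image[OF \<Phi>, of \<Phi> "\<lambda>x. ball x (r x)"] by blast
  obtain \<nu> where nu: "\<nu> > 0" "\<And>x. x \<in> X \<Longrightarrow> \<nu> \<le> r x"
    using finite_positive_lower_bound[of X r, OF X(2) r(1)] by blast
  \<comment> \<open>All sets close to \<open>z\<close> contain a chosen centre near
    \<open>z\<close>, so their number is at most the order of the closed cover at that
    centre.\<close>
  have order: "card {C\<in>\<C>. infdist z C < \<nu>} \<le> n + 1" if z: "z \<in> \<Phi>" for z
  proof -
    obtain x where x: "x \<in> X" "z \<in> ball x (r x)" using X z by blast
    then have "z \<in> ball x (2 * r x)" using r(1)[of x] by auto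
    then have "{C\<in>\<C>. infdist z C < \<nu>} \<subseteq> {C\<in>\<C>0. x \<in> C}"
      using r(2) nu(2)[OF x(1)] unfolding \<C>_def by fastforce
    then have "card {C\<in>\<C>. infdist z C < \<nu>} \<le> card {C\<in>\<C>0. x \<in> C}"
      using C0(1) by (intro card_mono) auto
    then show ?thesis using bspec[OF C0(4), of x] x(1) X(1) by fastforce
  qed
  define sw where "sw C = \<Phi> \<inter> ({x. infdist x C < \<nu>} \<inter> U C)" for C
  define \<V> where "\<V> = sw ` \<C>"
  have opn: "openin (top_of_set \<Phi>) (sw C)" if "C \<in> \<C>" for C
  proof -
    have "open {x. infdist x C < \<nu>}"
      by (intro open_Collect_less continuous_intros)
    moreover have "open (U C)" using U[OF that] unfolding \<U>_def by blast
    ultimately show ?thesis unfolding sw_def by (intro openin_open_Int open_Int)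
  qed
  have "\<Phi> \<subseteq> \<Union>\<V>"
  proof
    fix x assume x: "x \<in> \<Phi>"
    then obtain C where "C \<in> \<C>" "x \<in> C" using C(2) by blast
    then have "x \<in> sw C" using x U nu(1) unfolding sw_def by auto
    then show "x \<in> \<Union>\<V>" using \<open>C \<in> \<C>\<close> unfolding \<V>_def by blast
  qed
  then have "open_cover (top_of_set \<Phi>) \<V>"
    using opn unfolding open_cover_def \<V>_def sw_def by auto
  moreover have "\<forall>V\<in>\<V>. \<exists>w\<in>\<W>. V \<subseteq> w"
  proof
    fix V assume "V \<in> \<V>"
    then obtain C where "C \<in> \<C>" "V = sw C" unfolding \<V>_def by blast
    then have "\<Phi> \<inter> U C \<in> \<W>" "V \<subseteq> \<Phi> \<inter> U C" using U unfolding \<U>_def sw_def by auto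
    then show "\<exists>w\<in>\<W>. V \<subseteq> w" by blast
  qed
  moreover have "card {V\<in>\<V>. x \<in> V} \<le> n + 1" if x: "x \<in> \<Phi>" for x
  proof -
    have "{V\<in>\<V>. x \<in> V} \<subseteq> sw ` {C\<in>\<C>. infdist x C < \<nu>}" unfolding \<V>_def sw_def by auto
    then have "card {V\<in>\<V>. x \<in> V} \<le> card (sw ` {C\<in>\<C>. infdist x C < \<nu>})"
      using C(1) by (intro card_mono) auto
    also have "\<dots> \<le> card {C\<in>\<C>. infdist x C < \<nu>}" using C(1) by (intro card_image_le) auto
    finally show ?thesis using order[OF x] by linarith
  qed
  ultimately show "\<exists>\<V>. finite \<V> \<and> open_cover (top_of_set \<Phi>) \<V> \<and> (\<forall>V\<in>\<V>. \<exists>U\<in>\<W>. V \<subseteq> U) \<and>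
      (\<forall>x\<in>topspace (top_of_set \<Phi>). card {V \<in> \<V>. x \<in> V} \<le> n + 1)"
    using C(1) unfolding \<V>_def by (intro exI[of _ "sw ` \<C>"]) auto
qed

text \<open>The metric on functions adds the coordinate distances, truncated at 1, with weights
  \<open>(1/2)^n\<close>; the factor 2 is the sum of these weights.\<close>

lemma dist_fun_le:
  fixes s t :: "'i::countable \<Rightarrow> 'a::metric_space"
  assumes "\<And>v. dist (s v) (t v) \<le> e"
  shows "dist s t \<le> 2 * e"
proof -
  have e: "0 \<le> e" using assms[of undefined] zero_le_dist[of "s undefined" "t undefined"] by linarith
  have sm: "summable (\<lambda>n. (1/2)^n * e)" by (intro summable_mult2 summable_geometric) auto
  have "dist s t = (\<Sum>n. (1/2)^n * min (dist (s (from_nat n)) (t (from_nat n))) 1)"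
    by (simp add: dist_fun_def)
  also have "\<dots> \<le> (\<Sum>n. (1/2)^n * e)"
  proof (rule suminf_le)
    show "(1/2)^n * min (dist (s (from_nat n)) (t (from_nat n))) 1 \<le> (1/2)^n * e" for n
      by (intro mult_left_mono) (use assms[of "from_nat n"] in auto)
    show "summable (\<lambda>n. (1/2)^n * min (dist (s (from_nat n)) (t (from_nat n))) 1)"
      by (rule summable_comparison_test'[OF summable_geometric[of "1/2"], of 0])
        (auto simp: abs_mult mult_le_cancel_left1)
  qed (rule sm)
  also have "\<dots> = 2 * e"
    using suminf_mult2[of "\<lambda>n. (1/2)^n" e] suminf_geometric[of "1/2::real"] by (simp add: summable_geometric)
  finally show ?thesis .
qed

text \<open>Cutting every cell along a grid of values of the coordinate \<open>u\<close>, with different grid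
  lines for different cells, so that at any point at most one cell is cut.\<close>

lemma cut_cells:
  fixes u :: "'a::topological_space \<Rightarrow> real" and \<tau> \<alpha> \<epsilon> :: real
  assumes fin: "finite \<C>" and cl: "\<And>C. C \<in> \<C> \<Longrightarrow> closed C" and u: "continuous_on UNIV u"
    and rng: "\<And>x. x \<in> \<Phi> \<Longrightarrow> 0 \<le> u x \<and> u x \<le> 1" and cov: "\<Phi> \<subseteq> \<Union>\<C>"
    and \<tau>: "\<tau> > 0" "\<tau> * (card \<C> + 1) \<le> \<epsilon>"
  obtains \<C>' where "finite \<C>'" "\<And>C. C \<in> \<C>' \<Longrightarrow> closed C" "\<Phi> \<subseteq> \<Union>\<C>'"
    "\<And>C. C \<in> \<C>' \<Longrightarrow> \<exists>B\<in>\<C>. C \<subseteq> B" "\<And>C x y. C \<in> \<C>' \<Longrightarrow> x \<in> C \<Longrightarrow> y \<in> C \<Longrightarrow> \<bar>u x - u y\<bar> \<le> \<epsilon>"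
    "\<And>x. x \<in> \<Phi> \<Longrightarrow> card {C\<in>\<C>'. x \<in> C} \<le>
        card {C\<in>\<C>. x \<in> C} + (if \<exists>z::int. u x = \<alpha> + \<tau> * z then 1 else 0)"
proof -
  define n where "n = card \<C> + 1"
  obtain l where l: "inj_on l \<C>" "\<And>C. C \<in> \<C> \<Longrightarrow> l C < n"
    by (rule finite_labels[OF fin], rule that) (assumption, unfold n_def, blast)
  have n: "real n \<ge> 1" "n > 0" unfolding n_def by simp_all
  define s where "s x = (u x - \<alpha>) / \<tau>" for x
  have us: "u x = \<alpha> + \<tau> * s x" for x using \<tau> unfolding s_def by simp
  define p where "p C z = int n * z + int (l C)" for C and z :: int
  define cell where "cell C z = C \<inter> {x. real_of_int (p C z) \<le> s x \<and> s x \<le> real_of_int (p C (z + 1))}" for C z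
  obtain M where M: "(1 + \<bar>\<alpha>\<bar>) / \<tau> + 2 \<le> real M" using real_arch_simple by blast
  \<comment> \<open>The extra index below \<open>- int M\<close> allows for the offset
    \<open>l C / n < 1\<close>, which can lower the index by one.\<close>
  define \<C>' where "\<C>' = (\<lambda>(C, z). cell C z) ` (\<C> \<times> {- int M - 1..int M})"
  have p1: "p C (z + 1) = p C z + int n" for C z unfolding p_def by (simp add: algebra_simps)
  have scont: "continuous_on UNIV s" unfolding s_def using u \<tau> by (intro continuous_intros) auto
  show thesis
  proof (rule that[of \<C>'])
    show "finite \<C>'" unfolding \<C>'_def using fin by simp
    show "closed C" if C: "C \<in> \<C>'" for C
    proof -
      have "closed {x. real_of_int (p B z) \<le> s x \<and> s x \<le> real_of_int (p B (z + 1))}" for B z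
        by (intro closed_Collect_conj closed_Collect_le scont continuous_on_const)
      then show ?thesis using C cl unfolding \<C>'_def cell_def by (auto intro!: closed_Int)
    qed
    show "\<exists>B\<in>\<C>. C \<subseteq> B" if "C \<in> \<C>'" for C using that unfolding \<C>'_def cell_def by auto
    show "\<Phi> \<subseteq> \<Union>\<C>'"
    proof
      fix x assume x: "x \<in> \<Phi>"
      then obtain C where C: "C \<in> \<C>" "x \<in> C" using cov by blast
      define z where "z = \<lfloor>(s x - l C) / n\<rfloor>"
      have z: "real_of_int z \<le> (s x - l C) / n" "(s x - l C) / n < z + 1" unfolding z_def by linarith+
      then have "real n * z \<le> s x - l C" "s x - l C < real n * (z + 1)" using n by (simp_all add: field_simps)
      then have "x \<in> cell C z" unfolding cell_def p_def using C by (simp add: algebra_simps)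
      moreover have "z \<in> {- int M - 1..int M}"
      proof -
        have "\<bar>u x - \<alpha>\<bar> \<le> 1 + \<bar>\<alpha>\<bar>" using rng[OF x] by linarith
        then have "\<bar>s x\<bar> \<le> (1 + \<bar>\<alpha>\<bar>) / \<tau>" unfolding s_def using \<tau> by (simp add: divide_right_mono)
        then have sM: "\<bar>s x\<bar> \<le> M" using M by linarith
        have "\<bar>s x / n\<bar> \<le> \<bar>s x\<bar> / 1" unfolding abs_divide using n by (intro frac_le) auto
        then have "\<bar>s x / n\<bar> \<le> M" using sM by simp
        moreover have "0 \<le> l C / n" "l C / n < 1" using l(2)[OF C(1)] n by auto
        ultimately have "- real M - 1 < (s x - l C) / n" "(s x - l C) / n \<le> M"
          unfolding diff_divide_distrib by linarith+
        then show ?thesis using z by simp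
      qed
      ultimately show "x \<in> \<Union>\<C>'" using C unfolding \<C>'_def by blast
    qed
    show "\<bar>u x - u y\<bar> \<le> \<epsilon>" if C: "C \<in> \<C>'" "x \<in> C" "y \<in> C" for C x y
    proof -
      obtain B z where "real_of_int (p B z) \<le> s x \<and> s x \<le> real_of_int (p B (z + 1))"
        "real_of_int (p B z) \<le> s y \<and> s y \<le> real_of_int (p B (z + 1))"
        using C unfolding \<C>'_def cell_def by auto
      then have "\<bar>s x - s y\<bar> \<le> n" unfolding p1 by auto
      then have "\<tau> * \<bar>s x - s y\<bar> \<le> \<tau> * n" using \<tau> by simp
      moreover have "\<tau> * \<bar>s x - s y\<bar> = \<bar>u x - u y\<bar>"
        unfolding us using \<tau>(1) by (simp add: abs_mult right_diff_distrib[symmetric])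
      ultimately show ?thesis using \<tau>(2) unfolding n_def by simp
    qed
    fix x assume x: "x \<in> \<Phi>"
    define Z where "Z = {(C, z). C \<in> \<C> \<and> z \<in> {- int M - 1..int M} \<and> x \<in> cell C z}"
    \<comment> \<open>Read as half-open, the cells leave one index for each old cell containing
      \<open>x\<close>. In the exceptions \<open>s x\<close> is the upper end; this integer
      determines the old cell by its residue and then the index, so there is at most one.\<close>
    define Z1 where "Z1 = {(C, z). (C, z) \<in> Z \<and> s x < p C (z + 1)}"
    define Z2 where "Z2 = {(C, z). (C, z) \<in> Z \<and> s x = p C (z + 1)}"
    have "Z \<subseteq> \<C> \<times> {- int M - 1..int M}" unfolding Z_def by auto
    then have finZ: "finite Z" using fin by (meson finite_SigmaI finite_atLeastAtMost_int finite_subset)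
    have Z12: "Z = Z1 \<union> Z2" unfolding Z1_def Z2_def Z_def cell_def by auto
    have "{C\<in>\<C>'. x \<in> C} \<subseteq> (\<lambda>(C, z). cell C z) ` Z" unfolding \<C>'_def Z_def by auto
    then have "card {C\<in>\<C>'. x \<in> C} \<le> card ((\<lambda>(C, z). cell C z) ` Z)"
      using finZ by (intro card_mono) auto
    also have "\<dots> \<le> card Z" using finZ by (rule card_image_le)
    also have "\<dots> \<le> card Z1 + card Z2" unfolding Z12 by (rule card_Un_le)
    also have "card Z1 \<le> card {C\<in>\<C>. x \<in> C}"
    proof (rule card_inj_on_le)
      show "inj_on fst Z1"
      proof (rule inj_onI)
        fix a c assume ac: "a \<in> Z1" "c \<in> Z1" "fst a = fst c"
        obtain B i i' where a: "a = (B, i)" "c = (B, i')" using ac(3) by (metis prod.collapse)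
        have *: False if "i < i'" "s x < p B (i + 1)" "p B i' \<le> s x" for i i'
        proof -
          have "int n * (i + 1) \<le> int n * i'" using that(1) by (intro mult_left_mono) auto
          then have "p B (i + 1) \<le> p B i'" unfolding p_def by simp
          then show False using that by linarith
        qed
        have "p B i \<le> s x" "p B i' \<le> s x" "s x < p B (i + 1)" "s x < p B (i' + 1)"
          using ac(1,2) unfolding a Z1_def Z_def cell_def by auto
        then have "i = i'" using *[of i i'] *[of i' i] by (meson linorder_neqE)
        then show "a = c" using a by simp
      qed
      show "fst ` Z1 \<subseteq> {C\<in>\<C>. x \<in> C}" unfolding Z1_def Z_def cell_def by auto
      show "finite {C\<in>\<C>. x \<in> C}" using fin by simp
    qed
    also have "card Z2 \<le> (if \<exists>z::int. u x = \<alpha> + \<tau> * z then 1 else 0)"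
    proof (cases "Z2 = {}")
      case False
      then obtain B z where "s x = p B (z + 1)" unfolding Z2_def by auto
      then have "\<exists>z::int. u x = \<alpha> + \<tau> * z" using us by metis
      moreover have "a = c" if ac: "a \<in> Z2" "c \<in> Z2" for a c
      proof -
        obtain v i v' i' where a: "a = (v, i)" "c = (v', i')" by (metis prod.collapse)
        have vv: "v \<in> \<C>" "v' \<in> \<C>" "s x = p v (i + 1)" "s x = p v' (i' + 1)"
          using ac unfolding a Z2_def Z_def by auto
        then have eq: "p v (i + 1) = p v' (i' + 1)" by simp
        have "p v (i + 1) mod int n = int (l v)" "p v' (i' + 1) mod int n = int (l v')"
          unfolding p_def using l(2) vv by simp_all
        then have "l v = l v'" using eq by simp
        then have "v = v'" using l(1) vv by (meson inj_onD)
        then have "i = i'" using eq n unfolding p_def by simp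
        then show ?thesis using a \<open>v = v'\<close> by simp
      qed
      moreover have "finite Z2" using finZ Z12 by simp
      ultimately show ?thesis by (simp add: card_le_Suc0_iff_eq)
    qed simp
    finally show "card {C\<in>\<C>'. x \<in> C} \<le>
        card {C\<in>\<C>. x \<in> C} + (if \<exists>z::int. u x = \<alpha> + \<tau> * z then 1 else 0)"
      by simp
  qed
qed

text \<open>The set \<open>Q\<close> collects all sums of grid values, at most one for each coordinate treated so
  far; the offset of the next grid is chosen so that no such sum hits the forbidden set \<open>R\<close>.\<close>

lemma generic_cells:
  fixes \<Phi> :: "(nat \<Rightarrow> real) set" and R :: "real set"
  assumes \<Phi>: "compact \<Phi>" and rng: "\<And>t v. t \<in> \<Phi> \<Longrightarrow> 0 \<le> t v \<and> t v \<le> 1"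
    and V: "finite V" and R: "countable R" and \<epsilon>: "\<epsilon> > 0"
  obtains \<C> \<Gamma> where "finite \<C>" "\<And>C. C \<in> \<C> \<Longrightarrow> closed C" "\<Phi> \<subseteq> \<Union>\<C>"
    "\<And>C s t v. C \<in> \<C> \<Longrightarrow> s \<in> C \<Longrightarrow> t \<in> C \<Longrightarrow> v \<in> V \<Longrightarrow> \<bar>s v - t v\<bar> \<le> \<epsilon>"
    "\<And>t. t \<in> \<Phi> \<Longrightarrow> card {C\<in>\<C>. t \<in> C} \<le> 1 + card {v\<in>V. t v \<in> \<Gamma> v}"
    "\<And>C. C \<in> \<C> \<Longrightarrow> C \<subseteq> \<Phi>"
    "\<And>W t. W \<subseteq> V \<Longrightarrow> W \<noteq> {} \<Longrightarrow> \<forall>v\<in>W. t v \<in> \<Gamma> v \<Longrightarrow> sum t W \<notin> R"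
proof -
  \<comment> \<open>\<open>Q\<close> also contains the empty sum, so that the choice of the next
    offset covers a single coordinate as well. Avoiding \<open>R\<close> is demanded of nonempty
    sums only, since \<open>R\<close> may contain 0.\<close>
  have "\<exists>\<C> \<Gamma> Q. finite \<C> \<and> (\<forall>C\<in>\<C>. closed C \<and> C \<subseteq> \<Phi>) \<and> \<Phi> \<subseteq> \<Union>\<C> \<and>
      (\<forall>C\<in>\<C>. \<forall>s\<in>C. \<forall>t\<in>C. \<forall>v\<in>V. \<bar>s v - t v\<bar> \<le> \<epsilon>) \<and>
      (\<forall>t\<in>\<Phi>. card {C\<in>\<C>. t \<in> C} \<le> 1 + card {v\<in>V. t v \<in> \<Gamma> v}) \<and>
      countable Q \<and> (\<forall>W t. W \<subseteq> V \<longrightarrow> (\<forall>v\<in>W. t v \<in> \<Gamma> v) \<longrightarrow> sum t W \<in> Q \<and> (W \<noteq> {} \<longrightarrow> sum t W \<notin> R))"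
    using V
  proof (induction V)
    case empty
    show ?case
      by (rule exI[of _ "{\<Phi>}"], rule exI[of _ "\<lambda>_. {}"], rule exI[of _ "{0}"])
        (use compact_imp_closed[OF \<Phi>] in \<open>auto simp: card_le_Suc0_iff_eq\<close>)
  next
    case (insert v V)
    obtain \<C> \<Gamma> Q where IH: "finite \<C> \<and> (\<forall>C\<in>\<C>. closed C \<and> C \<subseteq> \<Phi>) \<and> \<Phi> \<subseteq> \<Union>\<C> \<and>
        (\<forall>C\<in>\<C>. \<forall>s\<in>C. \<forall>t\<in>C. \<forall>v\<in>V. \<bar>s v - t v\<bar> \<le> \<epsilon>) \<and>
        (\<forall>t\<in>\<Phi>. card {C\<in>\<C>. t \<in> C} \<le> 1 + card {v\<in>V. t v \<in> \<Gamma> v}) \<and>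
        countable Q \<and> (\<forall>W t. W \<subseteq> V \<longrightarrow> (\<forall>v\<in>W. t v \<in> \<Gamma> v) \<longrightarrow> sum t W \<in> Q \<and> (W \<noteq> {} \<longrightarrow> sum t W \<notin> R))"
      using insert.IH by (elim exE)
    have C: "finite \<C>" "\<And>C. C \<in> \<C> \<Longrightarrow> closed C" "\<And>C. C \<in> \<C> \<Longrightarrow> C \<subseteq> \<Phi>" "\<Phi> \<subseteq> \<Union>\<C>"
      and osc: "\<And>C s t w. C \<in> \<C> \<Longrightarrow> s \<in> C \<Longrightarrow> t \<in> C \<Longrightarrow> w \<in> V \<Longrightarrow> \<bar>s w - t w\<bar> \<le> \<epsilon>"
      and ord: "\<And>t. t \<in> \<Phi> \<Longrightarrow> card {C\<in>\<C>. t \<in> C} \<le> 1 + card {w\<in>V. t w \<in> \<Gamma> w}"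
      and Q: "countable Q"
      and gen: "\<And>W t. W \<subseteq> V \<Longrightarrow> \<forall>v\<in>W. t v \<in> \<Gamma> v \<Longrightarrow> sum t W \<in> Q \<and> (W \<noteq> {} \<longrightarrow> sum t W \<notin> R)"
      using IH by simp_all
    define \<tau> where "\<tau> = \<epsilon> / (card \<C> + 1)"
    have tau: "\<tau> > 0" "\<tau> * (card \<C> + 1) \<le> \<epsilon>" using \<epsilon> by (auto simp: \<tau>_def)
    have "countable ((\<lambda>(b, q, z::int). b - q - \<tau> * z) ` (R \<times> Q \<times> UNIV))"
      using R Q by (intro countable_image countable_SIGMA) auto
    \<comment> \<open>An offset is bad only if one of its grid values added to an old sum lies in
      \<open>R\<close>; this excludes countably many reals.\<close>
    then obtain \<alpha> where alpha: "\<alpha> \<notin> (\<lambda>(b, q, z::int). b - q - \<tau> * z) ` (R \<times> Q \<times> UNIV)"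
      using uncountable_UNIV_real by (metis UNIV_I countable_subset subsetI)
    obtain \<C>' where C': "finite \<C>'" "\<And>C. C \<in> \<C>' \<Longrightarrow> closed C" "\<Phi> \<subseteq> \<Union>\<C>'"
      "\<And>C. C \<in> \<C>' \<Longrightarrow> \<exists>B\<in>\<C>. C \<subseteq> B" "\<And>C x y. C \<in> \<C>' \<Longrightarrow> x \<in> C \<Longrightarrow> y \<in> C \<Longrightarrow> \<bar>x v - y v\<bar> \<le> \<epsilon>"
      "\<And>x. x \<in> \<Phi> \<Longrightarrow> card {C\<in>\<C>'. x \<in> C} \<le>
          card {C\<in>\<C>. x \<in> C} + (if \<exists>z::int. x v = \<alpha> + \<tau> * z then 1 else 0)"
    proof (rule cut_cells[where \<C> = \<C> and \<Phi> = \<Phi> and u = "\<lambda>t. t v" and \<alpha> = \<alpha> and \<tau> = \<tau> and \<epsilon> = \<epsilon>])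
      show "continuous_on UNIV (\<lambda>t::nat \<Rightarrow> real. t v)" by (intro continuous_on_product_coordinates)
      show "finite \<C>" "\<Phi> \<subseteq> \<Union>\<C>" "\<tau> > 0" "\<tau> * (card \<C> + 1) \<le> \<epsilon>" by fact+
      show "closed C" if "C \<in> \<C>" for C by (rule C(2)[OF that])
      show "0 \<le> t v \<and> t v \<le> 1" if "t \<in> \<Phi>" for t by (rule rng[OF that])
    qed (rule that)
    define \<Gamma>' where "\<Gamma>' = \<Gamma>(v := {\<alpha> + \<tau> * z | z::int. True})"
    define Q' where "Q' = Q \<union> (\<lambda>(q, z::int). q + (\<alpha> + \<tau> * z)) ` (Q \<times> UNIV)"
    have "countable Q'" unfolding Q'_def using Q by auto
    moreover have "sum t W \<in> Q' \<and> (W \<noteq> {} \<longrightarrow> sum t W \<notin> R)"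
      if W: "W \<subseteq> insert v V" "\<forall>w\<in>W. t w \<in> \<Gamma>' w" for W t
    proof (cases "v \<in> W")
      case False
      then have "W \<subseteq> V" "\<forall>w\<in>W. t w \<in> \<Gamma> w" using W unfolding \<Gamma>'_def by (auto split: if_splits)
      then show ?thesis using gen unfolding Q'_def by blast
    next
      case True
      define W0 where "W0 = W - {v}"
      have "W0 \<subseteq> V" "\<forall>w\<in>W0. t w \<in> \<Gamma> w" using W unfolding \<Gamma>'_def W0_def by (auto split: if_splits)
      then have q: "sum t W0 \<in> Q" using gen by blast
      have "t v \<in> \<Gamma>' v" using W(2) True by blast
      then obtain z :: int where z: "t v = \<alpha> + \<tau> * z" unfolding \<Gamma>'_def by auto
      have "finite W" using W(1) insert.hyps(1) by (meson finite_insert finite_subset)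
      then have s: "sum t W = t v + sum t W0" using True unfolding W0_def by (simp add: sum.remove)
      have "sum t W \<notin> R"
      proof
        assume b: "sum t W \<in> R"
        have "\<alpha> = sum t W - sum t W0 - \<tau> * z" using s z by simp
        then have "\<alpha> \<in> (\<lambda>(b, q, z::int). b - q - \<tau> * z) ` (R \<times> Q \<times> UNIV)"
          using b q by (intro image_eqI[of _ _ "(sum t W, sum t W0, z)"]) simp_all
        then show False using alpha by blast
      qed
      moreover have "sum t W \<in> Q'" unfolding Q'_def s z using q by (auto intro!: image_eqI[of _ _ "(sum t W0, z)"])
      ultimately show ?thesis by blast
    qed
    moreover have "card {C\<in>\<C>'. t \<in> C} \<le> 1 + card {w\<in>insert v V. t w \<in> \<Gamma>' w}" if t: "t \<in> \<Phi>" for t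
    proof -
      have eq: "{w\<in>V. t w \<in> \<Gamma>' w} = {w\<in>V. t w \<in> \<Gamma> w}" using insert.hyps(2) unfolding \<Gamma>'_def by auto
      have "card {w\<in>insert v V. t w \<in> \<Gamma>' w} =
          card {w\<in>V. t w \<in> \<Gamma> w} + (if \<exists>z::int. t v = \<alpha> + \<tau> * z then 1 else 0)"
      proof (cases "\<exists>z::int. t v = \<alpha> + \<tau> * z")
        case True
        then have "{w\<in>insert v V. t w \<in> \<Gamma>' w} = insert v {w\<in>V. t w \<in> \<Gamma>' w}" unfolding \<Gamma>'_def by auto
        then show ?thesis using True insert.hyps unfolding eq by simp
      next
        case False
        then have "{w\<in>insert v V. t w \<in> \<Gamma>' w} = {w\<in>V. t w \<in> \<Gamma>' w}" unfolding \<Gamma>'_def by auto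
        then show ?thesis using False unfolding eq by simp
      qed
      then show ?thesis using C'(6)[OF t] ord[OF t] by linarith
    qed
    moreover have "\<forall>C\<in>\<C>'. \<forall>s\<in>C. \<forall>t\<in>C. \<forall>w\<in>insert v V. \<bar>s w - t w\<bar> \<le> \<epsilon>"
    proof (intro ballI)
      fix C s t w assume a: "C \<in> \<C>'" "s \<in> C" "t \<in> C" "w \<in> insert v V"
      obtain B where "B \<in> \<C>" "C \<subseteq> B" using C'(4) a(1) by blast
      then show "\<bar>s w - t w\<bar> \<le> \<epsilon>" using osc[of B s t w] C'(5)[OF a(1-3)] a by (cases "w = v") auto
    qed
    moreover have "\<forall>C\<in>\<C>'. closed C \<and> C \<subseteq> \<Phi>" using C'(2,4) C(3) by blast
    ultimately show ?case using C'(1,3) by (intro exI[of _ \<C>'] exI[of _ \<Gamma>'] exI[of _ Q']) blast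
  qed
  then obtain \<C> \<Gamma> Q where *: "finite \<C>" "\<forall>C\<in>\<C>. closed C \<and> C \<subseteq> \<Phi>" "\<Phi> \<subseteq> \<Union>\<C>"
      "\<forall>C\<in>\<C>. \<forall>s\<in>C. \<forall>t\<in>C. \<forall>v\<in>V. \<bar>s v - t v\<bar> \<le> \<epsilon>"
      "\<forall>t\<in>\<Phi>. card {C\<in>\<C>. t \<in> C} \<le> 1 + card {v\<in>V. t v \<in> \<Gamma> v}"
      "\<forall>W t. W \<subseteq> V \<longrightarrow> (\<forall>v\<in>W. t v \<in> \<Gamma> v) \<longrightarrow> sum t W \<in> Q \<and> (W \<noteq> {} \<longrightarrow> sum t W \<notin> R)"
    by (elim exE conjE)
  show thesis
    by (rule that[of \<C> \<Gamma>]) (use * in \<open>simp_all\<close>)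
qed

text \<open>Call a coordinate of a point cut if it lies on its grid. For generic grids a cut
  coordinate is positive, and the positive coordinates over one \<open>j\<close> are never all cut,
  because their sum is the prescribed \<open>y j\<close>. So every value of \<pi> on the positive
  coordinates leaves one of them uncut. By \<open>excess\<close> at most \<open>n\<close> are cut,
  hence at most \<open>n + 1\<close> cells meet.\<close>

lemma covering_dim_le_simplicial_fibre:
  fixes \<Phi> :: "(nat \<Rightarrow> real) set" and \<pi> :: "nat \<Rightarrow> nat" and y :: "nat \<Rightarrow> real"
  assumes \<Phi>: "compact \<Phi>" and rng: "\<And>t v. t \<in> \<Phi> \<Longrightarrow> 0 \<le> t v \<and> t v \<le> 1" and V: "finite V"
    and supp: "\<And>t v. t \<in> \<Phi> \<Longrightarrow> v \<notin> V \<Longrightarrow> t v = 0"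
    and excess: "\<And>t. t \<in> \<Phi> \<Longrightarrow> card {v\<in>V. 0 < t v} \<le> card (\<pi> ` {v\<in>V. 0 < t v}) + n"
    and fibre: "\<And>t j. t \<in> \<Phi> \<Longrightarrow> (\<Sum>v\<in>{v\<in>V. \<pi> v = j}. t v) = y j"
  shows "covering_dim_le (top_of_set \<Phi>) n"
proof (rule covering_dim_le_closed_covers[OF \<Phi>])
  fix \<U> assume U: "\<Phi> \<subseteq> \<Union>\<U>" "\<And>U. U \<in> \<U> \<Longrightarrow> open U"
  obtain e where e: "e > 0" "\<And>x. x \<in> \<Phi> \<Longrightarrow> \<exists>U\<in>\<U>. ball x e \<subseteq> U"
    using Heine_Borel_lemma[OF \<Phi> U] by metis
  define \<epsilon> where "\<epsilon> = e / 4"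
  have "\<epsilon> > 0" using e by (simp add: \<epsilon>_def)
  obtain \<C> \<Gamma> where C: "finite \<C>" "\<And>C. C \<in> \<C> \<Longrightarrow> closed C" "\<Phi> \<subseteq> \<Union>\<C>"
    "\<And>C s t v. C \<in> \<C> \<Longrightarrow> s \<in> C \<Longrightarrow> t \<in> C \<Longrightarrow> v \<in> V \<Longrightarrow> \<bar>s v - t v\<bar> \<le> \<epsilon>"
    "\<And>t. t \<in> \<Phi> \<Longrightarrow> card {C\<in>\<C>. t \<in> C} \<le> 1 + card {v\<in>V. t v \<in> \<Gamma> v}"
    "\<And>C. C \<in> \<C> \<Longrightarrow> C \<subseteq> \<Phi>"
    "\<And>W t. W \<subseteq> V \<Longrightarrow> W \<noteq> {} \<Longrightarrow> \<forall>v\<in>W. t v \<in> \<Gamma> v \<Longrightarrow> sum t W \<notin> insert 0 (range y)"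
  proof (rule generic_cells[where \<Phi> = \<Phi> and V = V and R = "insert 0 (range y)" and \<epsilon> = \<epsilon>])
    show "compact \<Phi>" "finite V" "\<epsilon> > 0" by fact+
    show "countable (insert 0 (range y))" by simp
    show "0 \<le> t v \<and> t v \<le> 1" if "t \<in> \<Phi>" for t v by (rule rng[OF that])
  qed (rule that)
  have "\<exists>U\<in>\<U>. C \<subseteq> U" if C': "C \<in> \<C> - {{}}" for C
  proof -
    obtain x where x: "x \<in> C" using C' by blast
    have xP: "x \<in> \<Phi>" using C(6)[of C] x C' by blast
    then obtain U where U': "U \<in> \<U>" "ball x e \<subseteq> U" using e(2) by blast
    have "C \<subseteq> ball x e"
    proof
      fix t assume t: "t \<in> C"
      have "dist (x v) (t v) \<le> \<epsilon>" for v
      proof (cases "v \<in> V")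
        case True
        then show ?thesis using C(4)[of C x t v] C' x t by (simp add: dist_real_def)
      next
        case False
        then show ?thesis using supp[OF xP] supp[of t v] C(6)[of C] t C' \<open>\<epsilon> > 0\<close> by auto
      qed
      then have "dist x t \<le> 2 * \<epsilon>" by (rule dist_fun_le)
      then show "t \<in> ball x e" using e(1) unfolding \<epsilon>_def by simp
    qed
    then show ?thesis using U' by blast
  qed
  moreover have "card {C\<in>\<C> - {{}}. t \<in> C} \<le> n + 1" if t: "t \<in> \<Phi>" for t
  proof -
    define A where "A = {v\<in>V. 0 < t v}"
    define W where "W = {v\<in>V. t v \<in> \<Gamma> v}"
    have fin: "finite A" unfolding A_def using V by simp
    have "W \<subseteq> A"
    proof
      fix v assume v: "v \<in> W"
      then have "sum t {v} \<notin> insert 0 (range y)" by (intro C(7)) (auto simp: W_def)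
      then show "v \<in> A" using v rng[OF t, of v] unfolding A_def W_def by auto
    qed
    have "\<exists>v\<in>A - W. \<pi> v = j" if j: "j \<in> \<pi> ` A" for j
    proof (rule ccontr)
      assume *: "\<not> ?thesis"
      define B where "B = {v\<in>A. \<pi> v = j}"
      have "B \<subseteq> W" using * unfolding B_def by blast
      then have "sum t B \<notin> insert 0 (range y)" using j
        by (intro C(7)) (auto simp: W_def B_def)
      moreover have "sum t B = (\<Sum>v\<in>{v\<in>V. \<pi> v = j}. t v)"
        unfolding B_def A_def
        by (rule sum.mono_neutral_left) (use V rng[OF t] in \<open>auto simp: not_less intro: antisym\<close>)
      ultimately show False using fibre[OF t] by auto
    qed
    then have "\<pi> ` A \<subseteq> \<pi> ` (A - W)" by (metis image_eqI subsetI)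
    then have "card (\<pi> ` A) \<le> card (A - W)"
      using fin by (meson card_image_le card_mono finite_Diff finite_imageI order_trans)
    moreover have "card (A - W) = card A - card W" "card W \<le> card A"
      using \<open>W \<subseteq> A\<close> fin by (auto intro: card_Diff_subset card_mono finite_subset)
    ultimately have "card W \<le> n" using excess[OF t] unfolding A_def[symmetric] by linarith
    moreover have "card {C\<in>\<C> - {{}}. t \<in> C} \<le> card {C\<in>\<C>. t \<in> C}"
      using C(1) by (intro card_mono) auto
    ultimately show ?thesis using C(5)[OF t] unfolding W_def by linarith
  qed
  moreover have "\<Phi> \<subseteq> \<Union>(\<C> - {{}})" using C(3) by blast
  ultimately show "\<exists>\<C>. finite \<C> \<and> \<Phi> \<subseteq> \<Union>\<C> \<and> (\<forall>C\<in>\<C>. closed C \<and> (\<exists>U\<in>\<U>. C \<subseteq> U)) \<and>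
        (\<forall>x\<in>\<Phi>. card {C\<in>\<C>. x \<in> C} \<le> n + 1)"
    using C(1,2) by (intro exI[of _ "\<C> - {{}}"]) blast
qed

section \<open>Finite polyhedra and nerves\<close>

lemma compact_geom_simplex:
  fixes \<sigma> :: "nat set"
  assumes "finite \<sigma>"
  shows "compact (geom_simplex \<sigma>)"
proof -
  define B where "B = (\<Pi>\<^sub>E v\<in>UNIV. if v \<in> \<sigma> then {0..1::real} else {0})"
  have "compactin (product_topology (\<lambda>_. euclidean) UNIV) B"
    unfolding B_def by (subst compactin_PiE) auto
  then have B: "compact B" unfolding euclidean_product_topology by simp
  have "geom_simplex \<sigma> = B \<inter> {t. (\<Sum>v\<in>\<sigma>. t v) = 1}"
  proof (intro equalityI subsetI)
    fix t assume t: "t \<in> geom_simplex \<sigma>"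
    have "t v \<le> 1" if "v \<in> \<sigma>" for v
    proof -
      have "t v \<le> sum t \<sigma>" using t that assms unfolding geom_simplex_def by (intro member_le_sum) auto
      then show ?thesis using t unfolding geom_simplex_def by simp
    qed
    then show "t \<in> B \<inter> {t. (\<Sum>v\<in>\<sigma>. t v) = 1}" using t unfolding geom_simplex_def B_def by auto
  next
    fix t assume t: "t \<in> B \<inter> {t. (\<Sum>v\<in>\<sigma>. t v) = 1}"
    then have tB: "t v \<in> (if v \<in> \<sigma> then {0..1} else {0})" for v unfolding B_def by (auto simp: PiE_iff)
    have "0 \<le> t v" "v \<notin> \<sigma> \<Longrightarrow> t v = 0" for v using tB[of v] by (auto split: if_splits)
    then show "t \<in> geom_simplex \<sigma>" using t unfolding geom_simplex_def by auto
  qed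
  moreover have "closed {t. (\<Sum>v\<in>\<sigma>. t v) = (1::real)}"
    by (intro closed_Collect_eq continuous_intros continuous_on_product_coordinates)
  ultimately show ?thesis using B by (simp add: compact_Int_closed)
qed

text \<open>With finitely many compact simplices, the complement of a weakly open set is a finite
  union of closed sets, so the weak topology is the subspace topology of the product.\<close>

lemma polyhedron_of_finite:
  fixes K :: "nat set set"
  assumes "finite K" and K: "\<And>\<sigma>. \<sigma> \<in> K \<Longrightarrow> finite \<sigma>"
  shows "polyhedron_of K = top_of_set (carrier_of K)"
  unfolding topology_eq
proof (intro allI)
  fix U
  have sub: "geom_simplex \<sigma> \<subseteq> carrier_of K" if "\<sigma> \<in> K" for \<sigma> using that unfolding carrier_of_def by blast
  show "openin (polyhedron_of K) U \<longleftrightarrow> openin (top_of_set (carrier_of K)) U"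
    unfolding openin_polyhedron_of polyhedron_openin_def euclidean_product_topology
  proof
    assume U: "openin (top_of_set (carrier_of K)) U"
    then obtain O' where O': "open O'" "U = carrier_of K \<inter> O'" unfolding openin_open by blast
    have "U \<inter> geom_simplex \<sigma> = geom_simplex \<sigma> \<inter> O'" if "\<sigma> \<in> K" for \<sigma> using sub[OF that] O' by blast
    then show "U \<subseteq> carrier_of K \<and> (\<forall>\<sigma>\<in>K. openin (top_of_set (geom_simplex \<sigma>)) (U \<inter> geom_simplex \<sigma>))"
      using O' by (auto intro: openin_open_Int)
  next
    assume U: "U \<subseteq> carrier_of K \<and> (\<forall>\<sigma>\<in>K. openin (top_of_set (geom_simplex \<sigma>)) (U \<inter> geom_simplex \<sigma>))"
    have "closed (geom_simplex \<sigma> - U)" if "\<sigma> \<in> K" for \<sigma>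
    proof -
      have "geom_simplex \<sigma> - U = geom_simplex \<sigma> - U \<inter> geom_simplex \<sigma>" by blast
      then have "closedin (top_of_set (geom_simplex \<sigma>)) (geom_simplex \<sigma> - U)"
        using U that by (metis closedin_diff closedin_subtopology_refl openin_closedin_eq topspace_euclidean_subtopology closedin_def Diff_subset double_diff openin_imp_subset)
      then show ?thesis using closedin_closed_trans[OF _ compact_imp_closed[OF compact_geom_simplex[OF K[OF that]]]] by blast
    qed
    then have "closed (\<Union>\<sigma>\<in>K. geom_simplex \<sigma> - U)" using assms(1) by blast
    moreover have "U = carrier_of K \<inter> - (\<Union>\<sigma>\<in>K. geom_simplex \<sigma> - U)"
      using U unfolding carrier_of_def by blast
    ultimately show "openin (top_of_set (carrier_of K)) U"
      by (metis openin_open_Int open_Compl)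
  qed
qed

lemma second_countable_top_of_set:
  "second_countable (top_of_set (S :: 'a::second_countable_topology set))"
proof -
  obtain \<B> :: "'a set set" where B: "countable \<B>" "\<And>U. U \<in> \<B> \<Longrightarrow> open U"
    "\<And>S. open S \<Longrightarrow> \<exists>\<U>. \<U> \<subseteq> \<B> \<and> S = \<Union>\<U>"
    using univ_second_countable by metis
  have "second_countable (euclidean :: 'a topology)"
    unfolding second_countable_def
  proof (intro exI conjI allI impI ballI)
    show "countable \<B>" by fact
    show "openin euclidean V" if "V \<in> \<B>" for V using B(2)[OF that] by simp
    fix U :: "'a set" and x assume "openin euclidean U \<and> x \<in> U"
    then show "\<exists>V\<in>\<B>. x \<in> V \<and> V \<subseteq> U" using B(3)[of U] by auto
  qed
  then show ?thesis by (rule second_countable_subtopology)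
qed

lemma compact_carrier_of:
  fixes K :: "nat set set"
  assumes "finite K" "\<And>\<sigma>. \<sigma> \<in> K \<Longrightarrow> finite \<sigma>"
  shows "compact (carrier_of K)"
  unfolding carrier_of_def using assms by (intro compact_UN compact_geom_simplex)

section \<open>Nerves of partitions of unity and the maps between them\<close>

definition nerve :: "'a set \<Rightarrow> nat set \<Rightarrow> (nat \<Rightarrow> 'a \<Rightarrow> real) \<Rightarrow> nat set set" where
  "nerve S V \<phi> = {\<sigma>. \<sigma> \<noteq> {} \<and> (\<exists>x\<in>S. \<sigma> \<subseteq> active V \<phi> x)}"

lemma nerve_finite:
  assumes "finite V"
  shows "finite (nerve S V \<phi>)" "\<And>\<sigma>. \<sigma> \<in> nerve S V \<phi> \<Longrightarrow> finite \<sigma> \<and> \<sigma> \<subseteq> V"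
proof -
  show *: "finite \<sigma> \<and> \<sigma> \<subseteq> V" if "\<sigma> \<in> nerve S V \<phi>" for \<sigma>
    using that assms unfolding nerve_def active_def by (auto intro: finite_subset)
  then have "nerve S V \<phi> \<subseteq> Pow V" by blast
  then show "finite (nerve S V \<phi>)" using assms by (simp add: finite_subset)
qed

lemma simplicial_cplx_nerve:
  assumes "finite V"
  shows "simplicial_cplx (nerve S V \<phi>)"
  unfolding simplicial_cplx_def
proof (intro ballI conjI allI impI)
  fix \<sigma> assume s: "\<sigma> \<in> nerve S V \<phi>"
  show "finite \<sigma>" using nerve_finite[OF assms] s by blast
  show "\<sigma> \<noteq> {}" using s unfolding nerve_def by blast
  show "\<tau> \<in> nerve S V \<phi>" if "\<tau> \<subseteq> \<sigma> \<and> \<tau> \<noteq> {}" for \<tau> using s that unfolding nerve_def by blast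
qed

text \<open>The polyhedron is covered by the open stars of its vertices, and the preimage of the
  star of \<open>v\<close> is the set where \<open>\<phi> v\<close> is positive. Functions that
  vanish everywhere give no vertex, which is why \<open>small\<close> speaks only of functions
  positive somewhere.\<close>

lemma cover_map_nerve:
  fixes \<phi> :: "nat \<Rightarrow> 'a \<Rightarrow> real"
  assumes V: "finite V" and cont: "\<And>v. v \<in> V \<Longrightarrow> continuous_map X euclideanreal (\<phi> v)"
    and nonneg: "\<And>v x. v \<in> V \<Longrightarrow> x \<in> topspace X \<Longrightarrow> 0 \<le> \<phi> v x"
    and one: "\<And>x. x \<in> topspace X \<Longrightarrow> (\<Sum>v\<in>V. \<phi> v x) = 1"
    and small: "\<And>v. v \<in> V \<Longrightarrow> \<exists>x\<in>topspace X. 0 < \<phi> v x \<Longrightarrow>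
        \<exists>U\<in>\<omega>. \<forall>x\<in>topspace X. 0 < \<phi> v x \<longrightarrow> x \<in> U"
  shows "cover_map \<omega> X (polyhedron_of (nerve (topspace X) V \<phi>)) (\<lambda>x v. if v \<in> V then \<phi> v x else 0)"
    (is "cover_map \<omega> X (polyhedron_of ?K) ?\<kappa>")
proof -
  have poly: "polyhedron_of ?K = top_of_set (carrier_of ?K)"
    by (rule polyhedron_of_finite[OF nerve_finite(1)[OF V]]) (use nerve_finite(2)[OF V] in blast)
  have inK: "?\<kappa> x \<in> carrier_of ?K" if x: "x \<in> topspace X" for x
  proof -
    define \<sigma> where "\<sigma> = active V \<phi> x"
    have sV: "\<sigma> \<subseteq> V" "finite \<sigma>" unfolding \<sigma>_def active_def using V by auto
    have zero: "\<phi> v x = 0" if "v \<in> V - \<sigma>" for v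
      using that nonneg[of v x] x unfolding \<sigma>_def active_def by auto
    have "sum (?\<kappa> x) \<sigma> = (\<Sum>v\<in>\<sigma>. \<phi> v x)" using sV by (intro sum.cong) auto
    also have "\<dots> = (\<Sum>v\<in>V. \<phi> v x)" by (rule sum.mono_neutral_left) (use V sV zero in auto)
    finally have s: "sum (?\<kappa> x) \<sigma> = 1" using one[OF x] by simp
    then have "\<sigma> \<noteq> {}" by auto
    then have "\<sigma> \<in> ?K" using x unfolding nerve_def \<sigma>_def by blast
    moreover have "?\<kappa> x \<in> geom_simplex \<sigma>"
      unfolding geom_simplex_def using s nonneg x zero by auto
    ultimately show ?thesis unfolding carrier_of_def by blast
  qed
  have "continuous_map X euclidean ?\<kappa>"
  proof -
    have "continuous_map X euclideanreal (\<lambda>x. if v \<in> V then \<phi> v x else 0)" for v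
      using cont by (cases "v \<in> V") auto
    then have "continuous_map X (product_topology (\<lambda>_. euclideanreal) UNIV) ?\<kappa>"
      by (subst continuous_map_componentwise_UNIV) simp
    then show ?thesis by (simp add: euclidean_product_topology)
  qed
  then have "continuous_map X (polyhedron_of ?K) ?\<kappa>"
    unfolding poly continuous_map_in_subtopology using inK by auto
  moreover define star where "star v = {t\<in>carrier_of ?K. 0 < t v}" for v
  have "open_cover (polyhedron_of ?K) (star ` \<Union>?K)"
    unfolding open_cover_def
  proof (intro conjI ballI)
    fix U assume "U \<in> star ` \<Union>?K"
    then obtain v where "U = carrier_of ?K \<inter> {t. 0 < t v}" unfolding star_def by auto
    moreover have "open {t::nat \<Rightarrow> real. 0 < t v}"
      by (intro open_Collect_less continuous_intros continuous_on_product_coordinates)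
    ultimately show "openin (polyhedron_of ?K) U" unfolding poly by (simp add: openin_open_Int)
  next
    have "\<exists>v\<in>\<Union>?K. t \<in> star v" if t: "t \<in> carrier_of ?K" for t
    proof -
      obtain \<sigma> where s: "\<sigma> \<in> ?K" "t \<in> geom_simplex \<sigma>" using t unfolding carrier_of_def by blast
      then have "\<exists>v\<in>\<sigma>. 0 < t v"
        unfolding geom_simplex_def by (smt (verit) mem_Collect_eq sum_nonpos)
      then show ?thesis using s t unfolding star_def by blast
    qed
    then show "\<Union>(star ` \<Union>?K) = topspace (polyhedron_of ?K)" unfolding star_def by auto
  qed
  moreover have "\<exists>U\<in>\<omega>. {x\<in>topspace X. ?\<kappa> x \<in> W} \<subseteq> U" if W: "W \<in> star ` \<Union>?K" for W
  proof -
    obtain \<sigma> v where s: "W = star v" "\<sigma> \<in> ?K" "v \<in> \<sigma>" using W by blast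
    then obtain x where "x \<in> topspace X" "v \<in> active V \<phi> x" unfolding nerve_def by blast
    then have "v \<in> V" "\<exists>x\<in>topspace X. 0 < \<phi> v x" unfolding active_def by auto
    then obtain U where "U \<in> \<omega>" "\<forall>x\<in>topspace X. 0 < \<phi> v x \<longrightarrow> x \<in> U" using small by meson
    then show ?thesis using \<open>v \<in> V\<close> unfolding s(1) star_def by auto
  qed
  ultimately show ?thesis unfolding cover_map_def by blast
qed

definition induced_map :: "nat set \<Rightarrow> (nat \<Rightarrow> nat) \<Rightarrow> (nat \<Rightarrow> real) \<Rightarrow> nat \<Rightarrow> real" where
  "induced_map V \<pi> t j = (\<Sum>v\<in>{v\<in>V. \<pi> v = j}. t v)"

lemma induced_map_geom_simplex:
  assumes V: "finite V" and \<sigma>: "\<sigma> \<subseteq> V"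
  shows "induced_map V \<pi> ` geom_simplex \<sigma> = geom_simplex (\<pi> ` \<sigma>)"
proof (intro equalityI subsetI)
  have fin: "finite \<sigma>" using V \<sigma> finite_subset by blast
  have ind: "induced_map V \<pi> t j = (\<Sum>v\<in>{v\<in>\<sigma>. \<pi> v = j}. t v)" if "\<And>v. v \<notin> \<sigma> \<Longrightarrow> t v = 0" for t j
    unfolding induced_map_def using V \<sigma> that by (intro sum.mono_neutral_right) auto
  fix s assume "s \<in> induced_map V \<pi> ` geom_simplex \<sigma>"
  then obtain t where t: "t \<in> geom_simplex \<sigma>" "s = induced_map V \<pi> t" by blast
  then have t': "\<And>v. 0 \<le> t v" "\<And>v. v \<notin> \<sigma> \<Longrightarrow> t v = 0" "sum t \<sigma> = 1" unfolding geom_simplex_def by auto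
  have "s j = 0" if "j \<notin> \<pi> ` \<sigma>" for j
  proof -
    have "induced_map V \<pi> t j = (\<Sum>v\<in>{v\<in>\<sigma>. \<pi> v = j}. t v)" by (rule ind[OF t'(2)])
    moreover have "{v\<in>\<sigma>. \<pi> v = j} = {}" using that by blast
    ultimately show ?thesis unfolding t(2) by (simp only: sum.empty)
  qed
  moreover have "0 \<le> s j" for j unfolding t(2) induced_map_def by (intro sum_nonneg t'(1))
  moreover have "sum s (\<pi> ` \<sigma>) = 1"
  proof -
    have "sum s (\<pi> ` \<sigma>) = (\<Sum>j\<in>\<pi> ` \<sigma>. \<Sum>v\<in>{v\<in>\<sigma>. \<pi> v = j}. t v)"
      unfolding t(2) by (intro sum.cong refl ind t'(2))
    then show ?thesis using sum.image_gen[OF fin, of t \<pi>] t'(3) by simp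
  qed
  ultimately show "s \<in> geom_simplex (\<pi> ` \<sigma>)" unfolding geom_simplex_def by blast
next
  have fin: "finite \<sigma>" using V \<sigma> finite_subset by blast
  fix s assume "s \<in> geom_simplex (\<pi> ` \<sigma>)"
  then have s: "\<And>j. 0 \<le> s j" "\<And>j. j \<notin> \<pi> ` \<sigma> \<Longrightarrow> s j = 0" "sum s (\<pi> ` \<sigma>) = 1" unfolding geom_simplex_def by auto
  \<comment> \<open>Surjectivity onto the image simplex: a section of \<pi> puts the whole weight of
    each image vertex on one vertex above it.\<close>
  define c where "c = inv_into \<sigma> \<pi>"
  have c: "c j \<in> \<sigma>" "\<pi> (c j) = j" if "j \<in> \<pi> ` \<sigma>" for j
    unfolding c_def using that by (auto intro: inv_into_into f_inv_into_f)
  define t where "t v = (if v \<in> \<sigma> \<and> v = c (\<pi> v) then s (\<pi> v) else 0)" for v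
  have eq: "(\<Sum>v\<in>{v\<in>A. \<pi> v = j}. t v) = s j" if "\<sigma> \<subseteq> A" "finite A" for A j
  proof (cases "j \<in> \<pi> ` \<sigma>")
    case True
    have "(\<Sum>v\<in>{v\<in>A. \<pi> v = j}. t v) = (\<Sum>v\<in>{c j}. t v)"
      using c[OF True] that by (intro sum.mono_neutral_right) (auto simp: t_def s(2))
    then show ?thesis using c[OF True] by (simp add: t_def)
  next
    case False
    then have "(\<Sum>v\<in>{v\<in>A. \<pi> v = j}. t v) = 0" by (intro sum.neutral) (auto simp: t_def s(2))
    then show ?thesis using s(2)[OF False] by simp
  qed
  have "sum t \<sigma> = 1"
    using sum.image_gen[OF fin, of t \<pi>] eq[OF order_refl fin] s(3) by simp
  then have "t \<in> geom_simplex \<sigma>" unfolding geom_simplex_def t_def using s(1) by auto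
  moreover have "induced_map V \<pi> t = s" unfolding induced_map_def using eq[OF \<sigma> V] by auto
  ultimately show "s \<in> induced_map V \<pi> ` geom_simplex \<sigma>" by blast
qed

lemma continuous_on_induced_map: "continuous_on A (induced_map V \<pi>)"
proof -
  have "continuous_on UNIV (\<lambda>t. induced_map V \<pi> t j)" for j
    unfolding induced_map_def by (intro continuous_intros continuous_on_product_coordinates)
  then have "continuous_on UNIV (induced_map V \<pi>)" by (rule continuous_on_coordinatewise_then_product)
  then show ?thesis by (rule continuous_on_subset) simp
qed

text \<open>Deleting vertices loses at most as many images as vertices. The bound thus passes from
  active sets to all simplices of the nerve, and from simplices to the supports of their
  points.\<close>

lemma card_excess_mono:
  assumes "finite B" "A \<subseteq> B" "card B \<le> card (\<pi> ` B) + n"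
  shows "card A \<le> card (\<pi> ` A) + n"
proof -
  have "\<pi> ` B = \<pi> ` A \<union> \<pi> ` (B - A)" using assms(2) by blast
  then have "card (\<pi> ` B) \<le> card (\<pi> ` A) + card (\<pi> ` (B - A))" by (simp add: card_Un_le)
  moreover have "card (\<pi> ` (B - A)) \<le> card (B - A)" using assms(1) by (intro card_image_le) auto
  moreover have "card (B - A) = card B - card A" "card A \<le> card B"
    using assms(1,2) by (auto intro: card_Diff_subset card_mono finite_subset)
  ultimately show ?thesis using assms(3) by linarith
qed

lemma induced_map_dimensional:
  assumes V: "finite V" and K: "K \<subseteq> Pow V" and J: "finite L" "\<And>\<tau>. \<tau> \<in> L \<Longrightarrow> finite \<tau>"
    and KL: "\<And>\<sigma>. \<sigma> \<in> K \<Longrightarrow> \<pi> ` \<sigma> \<in> L"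
    and excess: "\<And>\<sigma>. \<sigma> \<in> K \<Longrightarrow> card \<sigma> \<le> card (\<pi> ` \<sigma>) + n"
  shows "simplicial_map_on K L (induced_map V \<pi>)"
    and "dimensional_map n (polyhedron_of K) (polyhedron_of L) (induced_map V \<pi>)"
proof -
  define p where "p = induced_map V \<pi>"
  have finK: "finite K" "\<And>\<sigma>. \<sigma> \<in> K \<Longrightarrow> finite \<sigma>"
    using V K by (auto intro: finite_subset[of K] finite_subset[of _ V])
  have poly: "polyhedron_of K = top_of_set (carrier_of K)" "polyhedron_of L = top_of_set (carrier_of L)"
    using polyhedron_of_finite[OF finK] polyhedron_of_finite[OF J] by auto
  have img: "p ` geom_simplex \<sigma> = geom_simplex (\<pi> ` \<sigma>)" if "\<sigma> \<in> K" for \<sigma>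
    unfolding p_def using induced_map_geom_simplex[OF V] K that by blast
  have "p ` carrier_of K \<subseteq> carrier_of L"
    unfolding carrier_of_def using img KL by blast
  then have cont: "continuous_map (polyhedron_of K) (polyhedron_of L) p"
    unfolding poly using continuous_on_induced_map unfolding p_def by (simp add: image_subset_iff)
  have aff: "p (\<lambda>v. (1 - u) * s v + u * t v) = (\<lambda>w. (1 - u) * p s w + u * p t w)" for s t u
    unfolding p_def induced_map_def by (auto simp: sum.distrib sum_distrib_left)
  show "simplicial_map_on K L (induced_map V \<pi>)"
    unfolding simplicial_map_on_def p_def[symmetric] using cont img KL aff by blast
  show "dimensional_map n (polyhedron_of K) (polyhedron_of L) (induced_map V \<pi>)"
    unfolding dimensional_map_def p_def[symmetric]
  proof (intro conjI ballI)
    fix y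
    define \<Phi> where "\<Phi> = {t\<in>carrier_of K. p t = y}"
    have sub: "subtopology (polyhedron_of K) {t \<in> topspace (polyhedron_of K). p t = y} = top_of_set \<Phi>"
      unfolding poly \<Phi>_def subtopology_subtopology by (simp add: Int_absorb1 Collect_conj_eq)
    have simplex: "\<exists>\<sigma>\<in>K. t \<in> geom_simplex \<sigma>" if "t \<in> \<Phi>" for t
      using that unfolding \<Phi>_def carrier_of_def by blast
    have "covering_dim_le (top_of_set \<Phi>) n"
    proof (rule covering_dim_le_simplicial_fibre[OF _ _ V, where \<pi> = \<pi> and y = y])
      have "closed (p -` {y})"
        unfolding p_def using continuous_on_induced_map by (intro closed_vimage) auto
      moreover have "\<Phi> = carrier_of K \<inter> p -` {y}" unfolding \<Phi>_def by blast
      ultimately show "compact \<Phi>" using compact_carrier_of[OF finK] by (simp add: compact_Int_closed)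
      fix t assume t: "t \<in> \<Phi>"
      obtain \<sigma> where s: "\<sigma> \<in> K" "t \<in> geom_simplex \<sigma>" using simplex[OF t] by blast
      have t': "\<And>v. 0 \<le> t v" "\<And>v. v \<notin> \<sigma> \<Longrightarrow> t v = 0" "sum t \<sigma> = 1" using s(2) unfolding geom_simplex_def by auto
      show "0 \<le> t v \<and> t v \<le> 1" for v
      proof (cases "v \<in> \<sigma>")
        case True
        have "t v \<le> sum t \<sigma>" using True finK(2)[OF s(1)] t'(1) by (intro member_le_sum) auto
        then show ?thesis using t' by simp
      qed (use t' in auto)
      show "t v = 0" if "v \<notin> V" for v using that t'(2) s(1) K by blast
      show "(\<Sum>v\<in>{v\<in>V. \<pi> v = j}. t v) = y j" for j
        using t unfolding \<Phi>_def p_def induced_map_def by auto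
      have "{v\<in>V. 0 < t v} \<subseteq> \<sigma>" using t'(2) by force
      then show "card {v\<in>V. 0 < t v} \<le> card (\<pi> ` {v\<in>V. 0 < t v}) + n"
        by (rule card_excess_mono[OF finK(2)[OF s(1)] _ excess[OF s(1)]])
    qed
    then show "covering_dim_le (subtopology (polyhedron_of K) {x \<in> topspace (polyhedron_of K). p x = y}) n"
      unfolding sub .
  qed (rule cont)
qed

lemma polyhedron_of_finite_separable_metrizable:
  fixes K :: "nat set set"
  assumes "finite K" "\<And>\<sigma>. \<sigma> \<in> K \<Longrightarrow> finite \<sigma>"
  shows "metrizable_space (polyhedron_of K)" "separable_space (polyhedron_of K)"
proof -
  have "polyhedron_of K = top_of_set (carrier_of K)" using assms by (rule polyhedron_of_finite)
  then show "metrizable_space (polyhedron_of K)" "separable_space (polyhedron_of K)"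
    using metrizable_space_subtopology[OF metrizable_space_euclidean]
      second_countable_imp_separable_space[OF second_countable_top_of_set] by auto
qed

section \<open>Embedding compacta\<close>

text \<open>This brings abstract compacta into one metric type, where the preceding constructions
  apply. The coordinates are the distances to a countable dense set; they determine the point, and
  compactness turns the continuous injection into a homeomorphism onto its image.\<close>

lemma compact_metrizable_embedding:
  assumes "compact_space X" "metrizable_space X"
  obtains e :: "'a \<Rightarrow> nat \<Rightarrow> real" where "homeomorphic_map X (top_of_set (e ` topspace X)) e"
proof -
  obtain M d where Md: "Metric_space M d" "X = Metric_space.mtopology M d"
    using assms(2) unfolding metrizable_space_def by blast
  interpret Metric_space M d by (rule Md)
  have top: "topspace X = M" using Md(2) by simp
  have "mtotally_bounded M"
    using assms(1) compactin_imp_mtotally_bounded unfolding Md(2) compact_space_def topspace_mtopology by blast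
  then have "\<forall>n. \<exists>C. finite C \<and> C \<subseteq> M \<and> M \<subseteq> (\<Union>x\<in>C. mball x (inverse (real (Suc n))))"
    unfolding mtotally_bounded_def by auto
  then obtain C where C: "\<And>n. finite (C n)" "\<And>n. C n \<subseteq> M"
    "\<And>n. M \<subseteq> (\<Union>x\<in>C n. mball x (inverse (real (Suc n))))"
    by metis
  define D where "D = (\<Union>n. C n)"
  have D: "countable D" "D \<subseteq> M" unfolding D_def using C(1,2) by (auto intro: countable_finite)
  define e where "e x n = d x (from_nat_into D n)" for x n
  have near: "\<exists>c\<in>D. d c x < r" if "x \<in> M" "r > 0" for x r
  proof -
    obtain n where n: "inverse (real (Suc n)) < r" using reals_Archimedean[OF \<open>r > 0\<close>] by blast
    obtain c where "c \<in> C n" "x \<in> mball c (inverse (real (Suc n)))" using C(3) \<open>x \<in> M\<close> by blast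
    then have "d c x < r" "c \<in> D" using n unfolding D_def by auto
    then show ?thesis by blast
  qed
  have inj: "inj_on e M"
  proof (rule inj_onI, rule ccontr)
    fix x y assume xy: "x \<in> M" "y \<in> M" "e x = e y" "x \<noteq> y"
    then have r: "d x y > 0" by simp
    then obtain c where c: "c \<in> D" "d c x < d x y / 2" using near[OF xy(1), of "d x y / 2"] by auto
    obtain n where "from_nat_into D n = c" using from_nat_into_surj[OF D(1) c(1)] by blast
    then have eq: "d x c = d y c" using fun_cong[OF xy(3), of n] unfolding e_def by simp
    have "d x y \<le> d x c + d c y" using triangle xy c(1) D(2) by blast
    then show False using eq c(2) commute[of c x] commute[of c y] by linarith
  qed
  have cont: "continuous_map X euclidean e"
  proof -
    have "continuous_map X euclideanreal (\<lambda>x. e x n)" for n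
      unfolding continuous_map_def Md(2)
    proof (intro conjI allI impI)
      fix U :: "real set" assume U: "openin euclideanreal U"
      define c where "c = from_nat_into D n"
      show "openin mtopology {x \<in> topspace mtopology. e x n \<in> U}"
        unfolding openin_mtopology
      proof (intro conjI allI impI)
        fix x assume x: "x \<in> {x \<in> topspace mtopology. e x n \<in> U}"
        then have "D \<noteq> {}" using near[of x 1] by auto
        then have c: "c \<in> M" unfolding c_def using from_nat_into[of D n] D(2) by auto
        obtain r where r: "r > 0" "ball (d x c) r \<subseteq> U"
          using U x unfolding e_def c_def by (auto simp: open_contains_ball)
        have "mball x r \<subseteq> {x \<in> topspace mtopology. e x n \<in> U}"
        proof
          fix z assume z: "z \<in> mball x r"
          then have zM: "z \<in> M" "x \<in> M" "d x z < r" by auto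
          have "\<bar>d x c - d z c\<bar> \<le> d x z"
            using triangle[of x z c] triangle[of z x c] zM c commute[of x z] by (simp add: abs_le_iff)
          then have "d z c \<in> ball (d x c) r" using zM(3) by (simp add: dist_real_def)
          then show "z \<in> {x \<in> topspace mtopology. e x n \<in> U}" using r zM unfolding e_def c_def by auto
        qed
        then show "\<exists>r>0. mball x r \<subseteq> {x \<in> topspace mtopology. e x n \<in> U}" using r(1) by blast
      qed auto
    qed auto
    then have "continuous_map X (product_topology (\<lambda>_. euclideanreal) UNIV) e"
      by (subst continuous_map_componentwise_UNIV) simp
    then show ?thesis by (simp add: euclidean_product_topology)
  qed
  have "homeomorphic_map X (top_of_set (e ` topspace X)) e"
  proof (rule continuous_imp_homeomorphic_map)
    show "continuous_map X (top_of_set (e ` topspace X)) e"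
      using cont by (simp add: continuous_map_in_subtopology)
    show "Hausdorff_space (top_of_set (e ` topspace X))"
      by (simp add: Hausdorff_space_subtopology)
  qed (use assms(1) inj top in auto)
  then show thesis by (rule that)
qed

lemma covering_dim_le_homeomorphic:
  assumes g: "homeomorphic_map X Y g" and dim: "covering_dim_le X n"
  shows "covering_dim_le Y n"
  unfolding covering_dim_le_def
proof (intro allI impI)
  fix \<U> assume U: "finite \<U> \<and> open_cover Y \<U>"
  have cont: "continuous_map X Y g" and opn: "open_map X Y g" and img: "g ` topspace X = topspace Y"
    and inj: "inj_on g (topspace X)"
    using g unfolding homeomorphic_eq_everything_map by auto
  define pull where "pull U = {x\<in>topspace X. g x \<in> U}" for U
  have "finite (pull ` \<U>)" using U by blast
  moreover have "open_cover X (pull ` \<U>)"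
    unfolding open_cover_def
  proof (intro conjI ballI)
    show "openin X W" if W: "W \<in> pull ` \<U>" for W
    proof -
      obtain U where "U \<in> \<U>" "W = pull U" using W by blast
      moreover have "openin Y U" using U \<open>U \<in> \<U>\<close> unfolding open_cover_def by blast
      ultimately show ?thesis unfolding pull_def by (simp add: openin_continuous_map_preimage[OF cont])
    qed
    show "\<Union>(pull ` \<U>) = topspace X"
    proof (intro equalityI subsetI)
      fix x assume x: "x \<in> topspace X"
      then have "g x \<in> \<Union>\<U>" using U img unfolding open_cover_def by auto
      then show "x \<in> \<Union>(pull ` \<U>)" using x unfolding pull_def by blast
    qed (auto simp: pull_def)
  qed
  ultimately have "\<exists>\<V>. finite \<V> \<and> open_cover X \<V> \<and> (\<forall>V\<in>\<V>. \<exists>W\<in>pull ` \<U>. V \<subseteq> W) \<and>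
      (\<forall>x\<in>topspace X. card {V\<in>\<V>. x \<in> V} \<le> n + 1)"
    using dim unfolding covering_dim_le_def by blast
  then obtain \<V> where V: "finite \<V>" "open_cover X \<V>" "\<forall>V\<in>\<V>. \<exists>W\<in>pull ` \<U>. V \<subseteq> W"
      "\<forall>x\<in>topspace X. card {V\<in>\<V>. x \<in> V} \<le> n + 1"
    by (elim exE conjE)
  show "\<exists>\<V>. finite \<V> \<and> open_cover Y \<V> \<and> (\<forall>V\<in>\<V>. \<exists>U\<in>\<U>. V \<subseteq> U) \<and>
      (\<forall>y\<in>topspace Y. card {V \<in> \<V>. y \<in> V} \<le> n + 1)"
  proof (intro exI conjI ballI)
    show "finite ((`) g ` \<V>)" using V by blast
    show "open_cover Y ((`) g ` \<V>)"
      using V(2) opn img unfolding open_cover_def open_map_def by (auto simp: image_Union[symmetric])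
    show "\<exists>U\<in>\<U>. W \<subseteq> U" if W: "W \<in> (`) g ` \<V>" for W
    proof -
      obtain V where "V \<in> \<V>" "W = g ` V" using W by blast
      then obtain U where "U \<in> \<U>" "V \<subseteq> pull U" using V(3) by blast
      then show ?thesis using \<open>W = g ` V\<close> unfolding pull_def by blast
    qed
    fix y assume "y \<in> topspace Y"
    then obtain x where x: "x \<in> topspace X" "y = g x" using img by blast
    have "{W \<in> (`) g ` \<V>. y \<in> W} \<subseteq> (`) g ` {V\<in>\<V>. x \<in> V}"
    proof
      fix W assume "W \<in> {W \<in> (`) g ` \<V>. y \<in> W}"
      then obtain V where "V \<in> \<V>" "W = g ` V" "y \<in> g ` V" by blast
      moreover have "V \<subseteq> topspace X" using V(2) \<open>V \<in> \<V>\<close> unfolding open_cover_def by blast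
      moreover obtain w where w: "w \<in> V" "g w = g x" using x \<open>y \<in> g ` V\<close> by auto
      ultimately have "x \<in> V" using inj_onD[OF inj w(2)] x(1) by auto
      then show "W \<in> (`) g ` {V\<in>\<V>. x \<in> V}" using \<open>V \<in> \<V>\<close> \<open>W = g ` V\<close> by blast
    qed
    then have "card {W \<in> (`) g ` \<V>. y \<in> W} \<le> card ((`) g ` {V\<in>\<V>. x \<in> V})"
      using V(1) by (intro card_mono) auto
    also have "\<dots> \<le> card {V\<in>\<V>. x \<in> V}" using V(1) by (intro card_image_le) auto
    also have "\<dots> \<le> n + 1" using V(4) x(1) by blast
    finally show "card {W \<in> (`) g ` \<V>. y \<in> W} \<le> n + 1" .
  qed
qed

lemma embedded_open_cover:
  assumes e: "homeomorphic_map X (top_of_set (e ` topspace X)) e" and \<omega>: "open_cover X \<omega>"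
  obtains \<U> where "e ` topspace X \<subseteq> \<Union>\<U>" "\<And>U. U \<in> \<U> \<Longrightarrow> open U"
    "\<And>U. U \<in> \<U> \<Longrightarrow> \<exists>W\<in>\<omega>. \<forall>x\<in>topspace X. e x \<in> U \<longrightarrow> x \<in> W"
proof (rule that[of "{U. open U \<and> (\<exists>W\<in>\<omega>. \<forall>x\<in>topspace X. e x \<in> U \<longrightarrow> x \<in> W)}"])
  have inj: "inj_on e (topspace X)" and opn: "open_map X (top_of_set (e ` topspace X)) e"
    using e unfolding homeomorphic_eq_everything_map by auto
  show "e ` topspace X \<subseteq> \<Union>{U. open U \<and> (\<exists>W\<in>\<omega>. \<forall>x\<in>topspace X. e x \<in> U \<longrightarrow> x \<in> W)}"
  proof
    fix z assume "z \<in> e ` topspace X"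
    then obtain x where x: "x \<in> topspace X" "z = e x" by blast
    then obtain W where W: "W \<in> \<omega>" "x \<in> W" "openin X W" using \<omega> unfolding open_cover_def by blast
    then have "openin (top_of_set (e ` topspace X)) (e ` W)" using opn unfolding open_map_def by blast
    then obtain U where U: "open U" "e ` W = e ` topspace X \<inter> U" unfolding openin_open by blast
    have "y \<in> W" if "y \<in> topspace X" "e y \<in> U" for y
    proof -
      have "e y \<in> e ` W" using that U by blast
      then obtain w where w: "w \<in> W" "e w = e y" by auto
      have "w \<in> topspace X" using w(1) openin_subset[OF W(3)] by blast
      then show ?thesis using inj_onD[OF inj w(2)] that(1) w(1) by simp
    qed
    then show "z \<in> \<Union>{U. open U \<and> (\<exists>W\<in>\<omega>. \<forall>x\<in>topspace X. e x \<in> U \<longrightarrow> x \<in> W)}"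
      using U W x by blast
  qed
qed auto

text \<open>A sum of nonnegative terms is positive exactly when one of them is. This turns the
  comparison of the active sets at a point and at its image into a comparison of a simplex with its
  image under \<pi>.\<close>

lemma image_active:
  assumes V: "finite V" and nonneg: "\<And>v. v \<in> V \<Longrightarrow> 0 \<le> \<phi> v x" and sub: "\<pi> ` V \<subseteq> J"
    and sum: "\<And>j. j \<in> J \<Longrightarrow> (\<Sum>v\<in>{v\<in>V. \<pi> v = j}. \<phi> v x) = \<xi> j y"
  shows "\<pi> ` active V \<phi> x = active J \<xi> y"
proof (intro equalityI subsetI)
  fix j assume "j \<in> \<pi> ` active V \<phi> x"
  then obtain v where v: "v \<in> V" "0 < \<phi> v x" "j = \<pi> v" unfolding active_def by blast
  then have "0 < (\<Sum>v\<in>{v\<in>V. \<pi> v = j}. \<phi> v x)"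
    using V nonneg by (intro sum_pos2[of _ v]) auto
  then show "j \<in> active J \<xi> y" using sum[of j] v sub unfolding active_def by auto
next
  fix j assume "j \<in> active J \<xi> y"
  then have j: "j \<in> J" "0 < \<xi> j y" unfolding active_def by auto
  have "\<exists>v\<in>{v\<in>V. \<pi> v = j}. 0 < \<phi> v x"
  proof (rule ccontr)
    assume "\<not> ?thesis"
    then have "(\<Sum>v\<in>{v\<in>V. \<pi> v = j}. \<phi> v x) \<le> 0" by (intro sum_nonpos) (auto simp: not_less)
    then show False using sum[OF j(1)] j(2) by simp
  qed
  then show "j \<in> \<pi> ` active V \<phi> x" unfolding active_def by auto
qed

section \<open>Transport to embedded compacta and assembly of the two nerves\<close>

theorem theorem1p2:
  fixes X :: "'a topology" and Y :: "'b topology" and f :: "'a \<Rightarrow> 'b" and k :: nat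
  assumes "compact_space X" and "metrizable_space X"
    and "compact_space Y" and "metrizable_space Y"
    and "dimensional_map k X Y f"
  shows "admits_simplicial_approximation (k + 1) X Y f"
  unfolding admits_simplicial_approximation_def
proof (intro allI impI)
  fix \<omega>X \<omega>Y assume \<omega>: "open_cover X \<omega>X \<and> open_cover Y \<omega>Y"
  have f: "continuous_map X Y f"
    and dim: "\<And>y. y \<in> topspace Y \<Longrightarrow> covering_dim_le (subtopology X {x\<in>topspace X. f x = y}) k"
    using assms(5) unfolding dimensional_map_def by auto
  have fXY: "f x \<in> topspace Y" if "x \<in> topspace X" for x
    using f that by (simp add: continuous_map_def Pi_iff)
  obtain eX :: "'a \<Rightarrow> nat \<Rightarrow> real" where eX: "homeomorphic_map X (top_of_set (eX ` topspace X)) eX"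
    using compact_metrizable_embedding[OF assms(1,2)] by blast
  obtain eY :: "'b \<Rightarrow> nat \<Rightarrow> real" where eY: "homeomorphic_map Y (top_of_set (eY ` topspace Y)) eY"
    using compact_metrizable_embedding[OF assms(3,4)] by blast
  define S where "S = eX ` topspace X"
  define T where "T = eY ` topspace Y"
  have ceX: "continuous_map X (top_of_set S) eX" and ceY: "continuous_map Y (top_of_set T) eY"
    using eX eY homeomorphic_imp_continuous_map unfolding S_def T_def by blast+
  have S: "compact S"
    using image_compactin[OF _ continuous_map_into_fulltopology[OF ceX], of "topspace X"] assms(1)
    unfolding S_def compact_space_def by simp
  have T: "compact T"
    using image_compactin[OF _ continuous_map_into_fulltopology[OF ceY], of "topspace Y"] assms(3)
    unfolding T_def compact_space_def by simp
  obtain g where g: "homeomorphic_maps X (top_of_set S) eX g"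
    using eX unfolding S_def homeomorphic_map_maps by blast
  have gX: "g (eX x) = x" if "x \<in> topspace X" for x using g that unfolding homeomorphic_maps_def by blast
  define f' where "f' = eY \<circ> f \<circ> g"
  have f'e: "f' (eX x) = eY (f x)" if "x \<in> topspace X" for x unfolding f'_def using gX[OF that] by simp
  have "continuous_map (top_of_set S) (top_of_set T) f'"
    unfolding f'_def using g f ceY unfolding homeomorphic_maps_def
    by (metis continuous_map_compose comp_assoc)
  then have f': "continuous_on S f'" "f' ` S \<subseteq> T" by (auto simp: continuous_map_in_subtopology)
  have dim': "covering_dim_le (top_of_set {z\<in>S. f' z = y'}) k" if y': "y' \<in> f' ` S" for y'
  proof -
    obtain x0 where x0: "x0 \<in> topspace X" "y' = eY (f x0)" using y' f'e unfolding S_def by auto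
    have injY: "inj_on eY (topspace Y)" using eY unfolding homeomorphic_eq_everything_map by auto
    define F where "F = {x\<in>topspace X. f x = f x0}"
    define F' where "F' = {z\<in>S. f' z = y'}"
    have "eX ` F = F'"
    proof (intro equalityI subsetI)
      fix z assume "z \<in> F'"
      then obtain x where x: "x \<in> topspace X" "z = eX x" "eY (f x) = eY (f x0)"
        unfolding F'_def S_def x0(2) using f'e by auto
      then have "f x = f x0" using inj_onD[OF injY x(3)] fXY x0(1) by blast
      then show "z \<in> eX ` F" using x unfolding F_def by blast
    next
      fix z assume "z \<in> eX ` F"
      then show "z \<in> F'" unfolding F_def F'_def S_def x0(2) using f'e by auto
    qed
    then have "eX ` (topspace X \<inter> F) = topspace (top_of_set S) \<inter> F'"
      unfolding F_def F'_def by (simp add: Int_absorb1 Collect_conj_eq[symmetric] Int_def)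
    then have "homeomorphic_map (subtopology X F) (subtopology (top_of_set S) F') eX"
      using homeomorphic_map_subtopologies eX unfolding S_def by blast
    moreover have "subtopology (top_of_set S) F' = top_of_set F'"
      unfolding subtopology_subtopology F'_def by (simp add: Int_absorb1 Collect_conj_eq)
    ultimately have "homeomorphic_map (subtopology X F) (top_of_set F') eX" by simp
    moreover have "covering_dim_le (subtopology X F) k"
      unfolding F_def by (rule dim[OF fXY[OF x0(1)]])
    ultimately have "covering_dim_le (top_of_set F') k" by (rule covering_dim_le_homeomorphic)
    then show ?thesis unfolding F'_def .
  qed
  obtain \<U> where U: "S \<subseteq> \<Union>\<U>" "\<And>U. U \<in> \<U> \<Longrightarrow> open U"
    "\<And>U. U \<in> \<U> \<Longrightarrow> \<exists>W\<in>\<omega>X. \<forall>x\<in>topspace X. eX x \<in> U \<longrightarrow> x \<in> W"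
    using embedded_open_cover[OF eX] \<omega> unfolding S_def by metis
  obtain \<V> where V: "T \<subseteq> \<Union>\<V>" "\<And>U. U \<in> \<V> \<Longrightarrow> open U"
    "\<And>U. U \<in> \<V> \<Longrightarrow> \<exists>W\<in>\<omega>Y. \<forall>y\<in>topspace Y. eY y \<in> U \<longrightarrow> y \<in> W"
    using embedded_open_cover[OF eY] \<omega> unfolding T_def by metis
  obtain A \<phi> \<pi> J \<xi> where part: "partition_of_unity T J \<xi>" "partition_of_unity S A \<phi>"
    "refines_partition S A \<phi> \<pi> J (\<lambda>j x. \<xi> j (f' x))"
    "\<And>v. v \<in> A \<Longrightarrow> \<exists>x\<in>S. 0 < \<phi> v x \<Longrightarrow> \<exists>U\<in>\<U>. \<forall>x\<in>S. 0 < \<phi> v x \<longrightarrow> x \<in> U"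
    "\<And>j. j \<in> J \<Longrightarrow> \<exists>U\<in>\<V>. \<forall>y\<in>T. 0 < \<xi> j y \<longrightarrow> y \<in> U"
    "\<And>x. x \<in> S \<Longrightarrow> card (active A \<phi> x) \<le> card (active J \<xi> (f' x)) + (k + 1)"
  proof (rule partitions_of_unity_over_map[where S = S and T = T and f = f' and k = k and \<U> = \<U> and \<V> = \<V>])
    show "covering_dim_le (top_of_set {z\<in>S. f' z = y}) k" if "y \<in> f' ` S" for y by (rule dim'[OF that])
    show "open W" if "W \<in> \<U>" for W by (rule U(2)[OF that])
    show "open W" if "W \<in> \<V>" for W by (rule V(2)[OF that])
    show "compact S" "compact T" "continuous_on S f'" "f' ` S \<subseteq> T" "S \<subseteq> \<Union>\<U>" "T \<subseteq> \<Union>\<V>" by fact+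
  qed (rule that)
  define \<alpha> where "\<alpha> v x = \<phi> v (eX x)" for v x
  define \<beta> where "\<beta> j y = \<xi> j (eY y)" for j y
  have A: "finite A" and J: "finite J" using part(1,2) unfolding partition_of_unity_def by auto
  have \<alpha>: "continuous_map X euclideanreal (\<alpha> v)" "\<And>x. x \<in> topspace X \<Longrightarrow> 0 \<le> \<alpha> v x" if "v \<in> A" for v
  proof -
    have "continuous_map (top_of_set S) euclideanreal (\<phi> v)"
      using part(2) that unfolding partition_of_unity_def by simp
    then show "continuous_map X euclideanreal (\<alpha> v)"
      using continuous_map_compose[OF ceX] unfolding \<alpha>_def comp_def by blast
    show "\<And>x. x \<in> topspace X \<Longrightarrow> 0 \<le> \<alpha> v x"
      using part(2) that unfolding partition_of_unity_def \<alpha>_def S_def by simp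
  qed
  have \<beta>: "continuous_map Y euclideanreal (\<beta> j)" "\<And>y. y \<in> topspace Y \<Longrightarrow> 0 \<le> \<beta> j y" if "j \<in> J" for j
  proof -
    have "continuous_map (top_of_set T) euclideanreal (\<xi> j)"
      using part(1) that unfolding partition_of_unity_def by simp
    then show "continuous_map Y euclideanreal (\<beta> j)"
      using continuous_map_compose[OF ceY] unfolding \<beta>_def comp_def by blast
    show "\<And>y. y \<in> topspace Y \<Longrightarrow> 0 \<le> \<beta> j y"
      using part(1) that unfolding partition_of_unity_def \<beta>_def T_def by simp
  qed
  have \<alpha>1: "(\<Sum>v\<in>A. \<alpha> v x) = 1" if "x \<in> topspace X" for x
    using part(2) that unfolding partition_of_unity_def \<alpha>_def S_def by simp
  have \<beta>1: "(\<Sum>j\<in>J. \<beta> j y) = 1" if "y \<in> topspace Y" for y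
    using part(1) that unfolding partition_of_unity_def \<beta>_def T_def by simp
  have \<pi>: "\<pi> ` A \<subseteq> J" using part(3) unfolding refines_partition_def by blast
  have push: "(\<Sum>v\<in>{v\<in>A. \<pi> v = j}. \<alpha> v x) = \<beta> j (f x)" if "j \<in> J" "x \<in> topspace X" for j x
    using part(3) that f'e[OF that(2)] unfolding refines_partition_def \<alpha>_def \<beta>_def S_def by simp
  have act: "\<pi> ` active A \<alpha> x = active J \<beta> (f x)" if x: "x \<in> topspace X" for x
    by (rule image_active[OF A]) (use \<alpha>(2) \<pi> push x in auto)
  define K where "K = nerve (topspace X) A \<alpha>"
  define L where "L = nerve (topspace Y) J \<beta>"
  define \<kappa>X where "\<kappa>X x v = (if v \<in> A then \<alpha> v x else 0)" for x v
  define \<kappa>Y where "\<kappa>Y y j = (if j \<in> J then \<beta> j y else 0)" for y j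
  have finK: "finite K" "\<And>\<sigma>. \<sigma> \<in> K \<Longrightarrow> finite \<sigma>" and KA: "K \<subseteq> Pow A"
    unfolding K_def using nerve_finite[OF A] by blast+
  have finL: "finite L" "\<And>\<sigma>. \<sigma> \<in> L \<Longrightarrow> finite \<sigma>"
    unfolding L_def using nerve_finite[OF J] by blast+
  have K: "\<exists>x\<in>topspace X. \<sigma> \<noteq> {} \<and> \<sigma> \<subseteq> active A \<alpha> x" if "\<sigma> \<in> K" for \<sigma>
    using that unfolding K_def nerve_def by blast
  have KL: "\<pi> ` \<sigma> \<in> L" if \<sigma>: "\<sigma> \<in> K" for \<sigma>
  proof -
    obtain x where x: "x \<in> topspace X" "\<sigma> \<noteq> {}" "\<sigma> \<subseteq> active A \<alpha> x" using K[OF \<sigma>] by blast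
    then have "\<pi> ` \<sigma> \<subseteq> active J \<beta> (f x)" using act[OF x(1)] by blast
    then show ?thesis unfolding L_def nerve_def using x fXY by blast
  qed
  have excess: "card \<sigma> \<le> card (\<pi> ` \<sigma>) + (k + 1)" if \<sigma>: "\<sigma> \<in> K" for \<sigma>
  proof -
    obtain x where x: "x \<in> topspace X" "\<sigma> \<subseteq> active A \<alpha> x" using K[OF \<sigma>] by blast
    have "card (active A \<alpha> x) \<le> card (active J \<beta> (f x)) + (k + 1)"
      using part(6)[of "eX x"] f'e[OF x(1)] x(1) unfolding active_def \<alpha>_def \<beta>_def S_def by simp
    then show ?thesis
      using card_excess_mono[OF _ x(2), of \<pi> "k + 1"] A unfolding act[OF x(1)] by (simp add: active_def)
  qed
  have cX: "cover_map \<omega>X X (polyhedron_of K) \<kappa>X"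
    unfolding K_def \<kappa>X_def[abs_def]
  proof (rule cover_map_nerve[OF A \<alpha> \<alpha>1])
    fix v assume v: "v \<in> A" "\<exists>x\<in>topspace X. 0 < \<alpha> v x"
    then have "\<exists>x\<in>S. 0 < \<phi> v x" unfolding \<alpha>_def S_def by blast
    then obtain U' where U': "U' \<in> \<U>" "\<And>x. x \<in> topspace X \<Longrightarrow> 0 < \<alpha> v x \<Longrightarrow> eX x \<in> U'"
      using part(4)[OF v(1)] unfolding \<alpha>_def S_def by auto
    show "\<exists>U\<in>\<omega>X. \<forall>x\<in>topspace X. 0 < \<alpha> v x \<longrightarrow> x \<in> U" using U(3)[OF U'(1)] U'(2) by blast
  qed
  have cY: "cover_map \<omega>Y Y (polyhedron_of L) \<kappa>Y"
    unfolding L_def \<kappa>Y_def[abs_def]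
  proof (rule cover_map_nerve[OF J \<beta> \<beta>1])
    fix j assume j: "j \<in> J"
    obtain U' where U': "U' \<in> \<V>" "\<And>y. y \<in> topspace Y \<Longrightarrow> 0 < \<beta> j y \<Longrightarrow> eY y \<in> U'"
      using part(5)[OF j] unfolding \<beta>_def T_def by auto
    show "\<exists>U\<in>\<omega>Y. \<forall>y\<in>topspace Y. 0 < \<beta> j y \<longrightarrow> y \<in> U" using V(3)[OF U'(1)] U'(2) by blast
  qed
  have comm: "induced_map A \<pi> (\<kappa>X x) = \<kappa>Y (f x)" if x: "x \<in> topspace X" for x
  proof
    fix j
    have eq: "induced_map A \<pi> (\<kappa>X x) j = (\<Sum>v\<in>{v\<in>A. \<pi> v = j}. \<alpha> v x)"
      unfolding induced_map_def \<kappa>X_def by (intro sum.cong) auto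
    show "induced_map A \<pi> (\<kappa>X x) j = \<kappa>Y (f x) j"
    proof (cases "j \<in> J")
      case True
      then show ?thesis using push x unfolding eq \<kappa>Y_def by simp
    next
      case False
      then have "{v\<in>A. \<pi> v = j} = {}" using \<pi> by blast
      then show ?thesis using False unfolding eq \<kappa>Y_def by (simp only: sum.empty if_False)
    qed
  qed
  show "\<exists>(K :: nat set set) (L :: nat set set) \<kappa>X \<kappa>Y p.
           simplicial_cplx K \<and> metrizable_space (polyhedron_of K) \<and>
           separable_space (polyhedron_of K) \<and>
           simplicial_cplx L \<and> metrizable_space (polyhedron_of L) \<and>
           separable_space (polyhedron_of L) \<and>
           cover_map \<omega>X X (polyhedron_of K) \<kappa>X \<and>
           cover_map \<omega>Y Y (polyhedron_of L) \<kappa>Y \<and>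
           simplicial_map_on K L p \<and>
           dimensional_map (k + 1) (polyhedron_of K) (polyhedron_of L) p \<and>
           (\<forall>x\<in>topspace X. p (\<kappa>X x) = \<kappa>Y (f x))"
  proof (intro exI conjI ballI)
    show "simplicial_cplx K" "simplicial_cplx L"
      unfolding K_def L_def using A J by (auto intro: simplicial_cplx_nerve)
    show "metrizable_space (polyhedron_of K)" "separable_space (polyhedron_of K)"
      using polyhedron_of_finite_separable_metrizable finK by blast+
    show "metrizable_space (polyhedron_of L)" "separable_space (polyhedron_of L)"
      using polyhedron_of_finite_separable_metrizable finL by blast+
    show "simplicial_map_on K L (induced_map A \<pi>)"
      "dimensional_map (k + 1) (polyhedron_of K) (polyhedron_of L) (induced_map A \<pi>)"
      using induced_map_dimensional[OF A KA finL KL excess] by auto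
    show "cover_map \<omega>X X (polyhedron_of K) \<kappa>X" "cover_map \<omega>Y Y (polyhedron_of L) \<kappa>Y" by fact+
    show "induced_map A \<pi> (\<kappa>X x) = \<kappa>Y (f x)" if "x \<in> topspace X" for x by (rule comm[OF that])
  qed
qed

end
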